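(* Let $n\geq 0$ and let $U$ be a finitely generated completely simple semigroup. Then the following are equivalent: (i) $U$ is of type left-$\mathrm{FP}_n$; (ii) $U$ is of type right-$\mathrm{FP}_n$; (iii) all maximal subgroups of $U$ are of type $\mathrm{FP}_n$.
   Context: For a monoid $S$, $\mathbb{Z}S$ denotes the integral monoid ring, and $\mathbb{Z}$ is regarded as the trivial left (respectively right) $\mathbb{Z}S$-module via the augmentation $\epsilon_S:\mathbb{Z}S\to\mathbb{Z}$, $s\mapsto 1$ ($s\in S$). For $n\geq 0$, the monoid $S$ is of type left-$\mathrm{FP}_n$ (respectively right-$\mathrm{FP}_n$) if there is an exact sequence $A_n\to A_{n-1}\to\cdots\to A_0\to\mathbb{Z}\to 0$ of left (respectively right) $\mathbb{Z}S$-modules with $A_0,\ldots,A_n$ finitely generated and free. A semigroup $S$ without a two-sided identity is of type left-$\mathrm{FP}_n$ (right-$\mathrm{FP}_n$) if the monoid $S^1=S\cup\{1\}$, obtained by adjoining an identity element, is. For a group, left-$\mathrm{FP}_n$ and right-$\mathrm{FP}_n$ are equivalent and one says "type $\mathrm{FP}_n$". A semigroup is simple if it has no proper two-sided ideals, and completely simple if it is simple and has minimal left and minimal right ideals. For an idempotent $e\in U$, the maximal subgroup of $U$ containing $e$ is the group of units of $eUe$. *)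

theory Defs
  imports "HOL-Algebra.Module" "HOL-Algebra.AbelCoset" "HOL-Library.Poly_Mapping"
begin

section \<open>Semigroups\<close>

text \<open>A semigroup is given by a carrier set \<open>S\<close> and a binary operation \<open>f\<close>.\<close>

definition semigroup_on :: "'a set \<Rightarrow> ('a \<Rightarrow> 'a \<Rightarrow> 'a) \<Rightarrow> bool" where
  "semigroup_on S f \<longleftrightarrow>
     (\<forall>x\<in>S. \<forall>y\<in>S. f x y \<in> S) \<and>
     (\<forall>x\<in>S. \<forall>y\<in>S. \<forall>z\<in>S. f (f x y) z = f x (f y z))"

definition is_identity :: "'a set \<Rightarrow> ('a \<Rightarrow> 'a \<Rightarrow> 'a) \<Rightarrow> 'a \<Rightarrow> bool" where
  "is_identity S f e \<longleftrightarrow> e \<in> S \<and> (\<forall>x\<in>S. f e x = x \<and> f x e = x)"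

definition subsemigroup_generated :: "('a \<Rightarrow> 'a \<Rightarrow> 'a) \<Rightarrow> 'a set \<Rightarrow> 'a set" where
  "subsemigroup_generated f X = \<Inter>{T. X \<subseteq> T \<and> (\<forall>x\<in>T. \<forall>y\<in>T. f x y \<in> T)}"

definition finitely_generated_semigroup :: "'a set \<Rightarrow> ('a \<Rightarrow> 'a \<Rightarrow> 'a) \<Rightarrow> bool" where
  "finitely_generated_semigroup S f \<longleftrightarrow>
     (\<exists>X. finite X \<and> X \<subseteq> S \<and> subsemigroup_generated f X = S)"

text \<open>Ideals are nonempty by convention.\<close>

definition left_ideal :: "'a set \<Rightarrow> ('a \<Rightarrow> 'a \<Rightarrow> 'a) \<Rightarrow> 'a set \<Rightarrow> bool" where
  "left_ideal S f I \<longleftrightarrow> I \<noteq> {} \<and> I \<subseteq> S \<and> (\<forall>s\<in>S. \<forall>x\<in>I. f s x \<in> I)"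

definition right_ideal :: "'a set \<Rightarrow> ('a \<Rightarrow> 'a \<Rightarrow> 'a) \<Rightarrow> 'a set \<Rightarrow> bool" where
  "right_ideal S f I \<longleftrightarrow> I \<noteq> {} \<and> I \<subseteq> S \<and> (\<forall>s\<in>S. \<forall>x\<in>I. f x s \<in> I)"

definition two_sided_ideal :: "'a set \<Rightarrow> ('a \<Rightarrow> 'a \<Rightarrow> 'a) \<Rightarrow> 'a set \<Rightarrow> bool" where
  "two_sided_ideal S f I \<longleftrightarrow> left_ideal S f I \<and> right_ideal S f I"

definition minimal_left_ideal :: "'a set \<Rightarrow> ('a \<Rightarrow> 'a \<Rightarrow> 'a) \<Rightarrow> 'a set \<Rightarrow> bool" where
  "minimal_left_ideal S f I \<longleftrightarrow>
     left_ideal S f I \<and> (\<forall>J. left_ideal S f J \<and> J \<subseteq> I \<longrightarrow> J = I)"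

definition minimal_right_ideal :: "'a set \<Rightarrow> ('a \<Rightarrow> 'a \<Rightarrow> 'a) \<Rightarrow> 'a set \<Rightarrow> bool" where
  "minimal_right_ideal S f I \<longleftrightarrow>
     right_ideal S f I \<and> (\<forall>J. right_ideal S f J \<and> J \<subseteq> I \<longrightarrow> J = I)"

definition simple_semigroup :: "'a set \<Rightarrow> ('a \<Rightarrow> 'a \<Rightarrow> 'a) \<Rightarrow> bool" where
  "simple_semigroup S f \<longleftrightarrow> semigroup_on S f \<and> (\<forall>I. two_sided_ideal S f I \<longrightarrow> I = S)"

definition completely_simple_semigroup :: "'a set \<Rightarrow> ('a \<Rightarrow> 'a \<Rightarrow> 'a) \<Rightarrow> bool" where
  "completely_simple_semigroup S f \<longleftrightarrow>
     simple_semigroup S f \<and> (\<exists>I. minimal_left_ideal S f I) \<and> (\<exists>I. minimal_right_ideal S f I)"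

definition idempotents :: "'a set \<Rightarrow> ('a \<Rightarrow> 'a \<Rightarrow> 'a) \<Rightarrow> 'a set" where
  "idempotents S f = {e \<in> S. f e e = e}"

definition local_monoid :: "'a set \<Rightarrow> ('a \<Rightarrow> 'a \<Rightarrow> 'a) \<Rightarrow> 'a \<Rightarrow> 'a monoid" where
  "local_monoid S f e = \<lparr>carrier = (\<lambda>x. f (f e x) e) ` S, mult = f, one = e\<rparr>"

definition maximal_subgroup :: "'a set \<Rightarrow> ('a \<Rightarrow> 'a \<Rightarrow> 'a) \<Rightarrow> 'a \<Rightarrow> 'a monoid" where
  "maximal_subgroup S f e = units_of (local_monoid S f e)"

text \<open>\<open>None\<close> is the new identity.\<close>

definition adjoin_identity :: "'a set \<Rightarrow> ('a \<Rightarrow> 'a \<Rightarrow> 'a) \<Rightarrow> 'a option monoid" where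
  "adjoin_identity S f =
     \<lparr>carrier = insert None (Some ` S),
      mult = (\<lambda>x y. case x of None \<Rightarrow> y
                     | Some a \<Rightarrow> (case y of None \<Rightarrow> x | Some b \<Rightarrow> Some (f a b))),
      one = None\<rparr>"


section \<open>Left and right modules over a ring that need not be commutative\<close>

text \<open>The locale \<open>module\<close> of HOL-Algebra requires a commutative ring; the two locales below
  reuse its record type. In a right module, \<open>a \<odot>\<^bsub>M\<^esub> x\<close> stands for \<open>x \<cdot> a\<close>.\<close>

locale left_module = R?: ring R + M?: abelian_group M
  for R :: "('r, 'k) ring_scheme" (structure) and M :: "('r, 'm, 'z) module_scheme" (structure) +
  assumes smult_closed:
      "\<lbrakk>a \<in> carrier R; x \<in> carrier M\<rbrakk> \<Longrightarrow> a \<odot>\<^bsub>M\<^esub> x \<in> carrier M"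
    and smult_l_distr:
      "\<lbrakk>a \<in> carrier R; b \<in> carrier R; x \<in> carrier M\<rbrakk> \<Longrightarrow>
       (a \<oplus>\<^bsub>R\<^esub> b) \<odot>\<^bsub>M\<^esub> x = a \<odot>\<^bsub>M\<^esub> x \<oplus>\<^bsub>M\<^esub> b \<odot>\<^bsub>M\<^esub> x"
    and smult_r_distr:
      "\<lbrakk>a \<in> carrier R; x \<in> carrier M; y \<in> carrier M\<rbrakk> \<Longrightarrow>
       a \<odot>\<^bsub>M\<^esub> (x \<oplus>\<^bsub>M\<^esub> y) = a \<odot>\<^bsub>M\<^esub> x \<oplus>\<^bsub>M\<^esub> a \<odot>\<^bsub>M\<^esub> y"
    and smult_assoc:
      "\<lbrakk>a \<in> carrier R; b \<in> carrier R; x \<in> carrier M\<rbrakk> \<Longrightarrow>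
       (a \<otimes>\<^bsub>R\<^esub> b) \<odot>\<^bsub>M\<^esub> x = a \<odot>\<^bsub>M\<^esub> (b \<odot>\<^bsub>M\<^esub> x)"
    and smult_one:
      "x \<in> carrier M \<Longrightarrow> \<one>\<^bsub>R\<^esub> \<odot>\<^bsub>M\<^esub> x = x"

locale right_module = R?: ring R + M?: abelian_group M
  for R :: "('r, 'k) ring_scheme" (structure) and M :: "('r, 'm, 'z) module_scheme" (structure) +
  assumes smult_closed:
      "\<lbrakk>a \<in> carrier R; x \<in> carrier M\<rbrakk> \<Longrightarrow> a \<odot>\<^bsub>M\<^esub> x \<in> carrier M"
    and smult_l_distr:
      "\<lbrakk>a \<in> carrier R; b \<in> carrier R; x \<in> carrier M\<rbrakk> \<Longrightarrow>
       (a \<oplus>\<^bsub>R\<^esub> b) \<odot>\<^bsub>M\<^esub> x = a \<odot>\<^bsub>M\<^esub> x \<oplus>\<^bsub>M\<^esub> b \<odot>\<^bsub>M\<^esub> x"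
    and smult_r_distr:
      "\<lbrakk>a \<in> carrier R; x \<in> carrier M; y \<in> carrier M\<rbrakk> \<Longrightarrow>
       a \<odot>\<^bsub>M\<^esub> (x \<oplus>\<^bsub>M\<^esub> y) = a \<odot>\<^bsub>M\<^esub> x \<oplus>\<^bsub>M\<^esub> a \<odot>\<^bsub>M\<^esub> y"
    and smult_assoc:
      "\<lbrakk>a \<in> carrier R; b \<in> carrier R; x \<in> carrier M\<rbrakk> \<Longrightarrow>
       (a \<otimes>\<^bsub>R\<^esub> b) \<odot>\<^bsub>M\<^esub> x = b \<odot>\<^bsub>M\<^esub> (a \<odot>\<^bsub>M\<^esub> x)"
    and smult_one:
      "x \<in> carrier M \<Longrightarrow> \<one>\<^bsub>R\<^esub> \<odot>\<^bsub>M\<^esub> x = x"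

text \<open>The following notions refer only to addition and scalar action, and so serve for left
  and for right modules alike.\<close>

definition module_hom ::
  "('r, 'k) ring_scheme \<Rightarrow> ('r, 'm, 'y) module_scheme \<Rightarrow> ('r, 'n, 'z) module_scheme \<Rightarrow> ('m \<Rightarrow> 'n) set"
  where
  "module_hom R M N =
     {h \<in> carrier M \<rightarrow> carrier N.
        (\<forall>x\<in>carrier M. \<forall>y\<in>carrier M. h (x \<oplus>\<^bsub>M\<^esub> y) = h x \<oplus>\<^bsub>N\<^esub> h y) \<and>
        (\<forall>a\<in>carrier R. \<forall>x\<in>carrier M. h (a \<odot>\<^bsub>M\<^esub> x) = a \<odot>\<^bsub>N\<^esub> h x)}"

definition module_basis ::
  "('r, 'k) ring_scheme \<Rightarrow> ('r, 'm, 'z) module_scheme \<Rightarrow> 'm set \<Rightarrow> bool" where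
  "module_basis R M B \<longleftrightarrow>
     finite B \<and> B \<subseteq> carrier M \<and>
     (\<forall>x\<in>carrier M. \<exists>!c. c \<in> B \<rightarrow>\<^sub>E carrier R \<and> x = (\<Oplus>\<^bsub>M\<^esub>b\<in>B. c b \<odot>\<^bsub>M\<^esub> b))"

definition finitely_generated_free ::
  "('r, 'k) ring_scheme \<Rightarrow> ('r, 'm, 'z) module_scheme \<Rightarrow> bool" where
  "finitely_generated_free R M \<longleftrightarrow> (\<exists>B. module_basis R M B)"


section \<open>Integral monoid rings and the trivial module\<close>

text \<open>Elements of the integral monoid ring are the finitely supported integer-valued functions
  whose support lies in the carrier of the monoid; multiplication is convolution.\<close>

definition monoid_ring :: "('a, 'k) monoid_scheme \<Rightarrow> ('a \<Rightarrow>\<^sub>0 int) ring" where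
  "monoid_ring S =
     \<lparr>carrier = {a. Poly_Mapping.keys a \<subseteq> carrier S},
      mult = (\<lambda>a b. \<Sum>s\<in>Poly_Mapping.keys a. \<Sum>t\<in>Poly_Mapping.keys b.
                Poly_Mapping.single (s \<otimes>\<^bsub>S\<^esub> t) (Poly_Mapping.lookup a s * Poly_Mapping.lookup b t)),
      one = Poly_Mapping.single \<one>\<^bsub>S\<^esub> 1,
      zero = 0,
      add = (+)\<rparr>"

definition augmentation :: "('a \<Rightarrow>\<^sub>0 int) \<Rightarrow> int" where
  "augmentation a = (\<Sum>s\<in>Poly_Mapping.keys a. Poly_Mapping.lookup a s)"

definition trivial_module :: "('a \<Rightarrow>\<^sub>0 int, int) module" where
  "trivial_module =
     \<lparr>carrier = UNIV, mult = (*), one = 1, zero = 0, add = (+),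
      smult = (\<lambda>a k. augmentation a * k)\<rparr>"


lemma monoid_ring_mult_superset:
  assumes "finite X" "finite Y" "Poly_Mapping.keys a \<subseteq> X" "Poly_Mapping.keys b \<subseteq> Y"
  shows "a \<otimes>\<^bsub>monoid_ring S\<^esub> b =
    (\<Sum>s\<in>X. \<Sum>t\<in>Y.
       Poly_Mapping.single (s \<otimes>\<^bsub>S\<^esub> t) (Poly_Mapping.lookup a s * Poly_Mapping.lookup b t))"
proof -
  have "(\<Sum>t\<in>Poly_Mapping.keys b.
          Poly_Mapping.single (s \<otimes>\<^bsub>S\<^esub> t) (Poly_Mapping.lookup a s * Poly_Mapping.lookup b t)) =
        (\<Sum>t\<in>Y. Poly_Mapping.single (s \<otimes>\<^bsub>S\<^esub> t) (Poly_Mapping.lookup a s * Poly_Mapping.lookup b t))"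
    for s
    using assms by (intro sum.mono_neutral_left) (auto simp: in_keys_iff)
  then show ?thesis
    using assms
    by (auto simp: monoid_ring_def in_keys_iff intro!: sum.mono_neutral_left)
qed

lemma monoid_ring_add_mult:
  "(a + b) \<otimes>\<^bsub>monoid_ring S\<^esub> c = a \<otimes>\<^bsub>monoid_ring S\<^esub> c + b \<otimes>\<^bsub>monoid_ring S\<^esub> c"
proof -
  let ?X = "Poly_Mapping.keys a \<union> Poly_Mapping.keys b"
  have "Poly_Mapping.keys (a + b) \<subseteq> ?X"
    by (rule keys_add)
  then show ?thesis
    by (simp add: monoid_ring_mult_superset[where X = ?X and Y = "Poly_Mapping.keys c"]
        lookup_add distrib_right single_add sum.distrib)
qed

lemma monoid_ring_mult_add:
  "c \<otimes>\<^bsub>monoid_ring S\<^esub> (a + b) = c \<otimes>\<^bsub>monoid_ring S\<^esub> a + c \<otimes>\<^bsub>monoid_ring S\<^esub> b"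
proof -
  let ?X = "Poly_Mapping.keys a \<union> Poly_Mapping.keys b"
  have "Poly_Mapping.keys (a + b) \<subseteq> ?X"
    by (rule keys_add)
  then show ?thesis
    by (simp add: monoid_ring_mult_superset[where Y = ?X and X = "Poly_Mapping.keys c"]
        lookup_add distrib_left single_add sum.distrib)
qed

lemma monoid_ring_mult_zero [simp]:
  "0 \<otimes>\<^bsub>monoid_ring S\<^esub> a = 0" "a \<otimes>\<^bsub>monoid_ring S\<^esub> 0 = 0"
  by (simp_all add: monoid_ring_def)

lemma monoid_ring_diff_mult:
  "(a - b) \<otimes>\<^bsub>monoid_ring S\<^esub> c = a \<otimes>\<^bsub>monoid_ring S\<^esub> c - b \<otimes>\<^bsub>monoid_ring S\<^esub> c"
  using monoid_ring_add_mult[where a = "a - b" and b = b and c = c and S = S] by (simp add: algebra_simps)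

lemma monoid_ring_mult_diff:
  "c \<otimes>\<^bsub>monoid_ring S\<^esub> (a - b) = c \<otimes>\<^bsub>monoid_ring S\<^esub> a - c \<otimes>\<^bsub>monoid_ring S\<^esub> b"
  using monoid_ring_mult_add[where a = "a - b" and b = b and c = c and S = S] by (simp add: algebra_simps)

lemma monoid_ring_mult_single:
  "Poly_Mapping.single s m \<otimes>\<^bsub>monoid_ring S\<^esub> Poly_Mapping.single t k =
   Poly_Mapping.single (s \<otimes>\<^bsub>S\<^esub> t) (m * k)"
  by (simp add: monoid_ring_mult_superset[where X = "{s}" and Y = "{t}"])

lemma ring_monoid_ring:
  assumes "monoid S"
  shows "ring (monoid_ring S)"
proof -
  interpret monoid S by fact
  let ?R = "monoid_ring S"
  have carr: "x \<in> carrier ?R \<longleftrightarrow> Poly_Mapping.keys x \<subseteq> carrier S" for x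
    by (simp add: monoid_ring_def)
  have closed: "x \<otimes>\<^bsub>?R\<^esub> y \<in> carrier ?R" if "x \<in> carrier ?R" "y \<in> carrier ?R" for x y
  proof -
    have "Poly_Mapping.keys (\<Sum>s\<in>Poly_Mapping.keys x. \<Sum>t\<in>Poly_Mapping.keys y.
            Poly_Mapping.single (s \<otimes>\<^bsub>S\<^esub> t) (Poly_Mapping.lookup x s * Poly_Mapping.lookup y t))
          \<subseteq> carrier S"
      using that unfolding carr
      by (intro order_trans[OF keys_sum] UN_least) (auto split: if_splits)
    then show ?thesis by (simp add: monoid_ring_def)
  qed
  have grp: "abelian_group ?R"
  proof (rule abelian_groupI)
    fix x assume x: "x \<in> carrier ?R"
    show "\<exists>y\<in>carrier ?R. y \<oplus>\<^bsub>?R\<^esub> x = \<zero>\<^bsub>?R\<^esub>"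
      using x by (intro bexI[of _ "- x"]) (auto simp: monoid_ring_def)
  qed (use keys_add in \<open>force simp: monoid_ring_def algebra_simps\<close>)+
  have mon: "Group.monoid ?R"
  proof (rule monoidI)
    show "\<one>\<^bsub>?R\<^esub> \<in> carrier ?R" by (simp add: monoid_ring_def)
  next
    fix x y z assume "x \<in> carrier ?R" "y \<in> carrier ?R" "z \<in> carrier ?R"
    then have k: "Poly_Mapping.keys x \<subseteq> carrier S" "Poly_Mapping.keys y \<subseteq> carrier S"
      "Poly_Mapping.keys z \<subseteq> carrier S"
      by (simp_all add: carr)
    show "x \<otimes>\<^bsub>?R\<^esub> y \<otimes>\<^bsub>?R\<^esub> z = x \<otimes>\<^bsub>?R\<^esub> (y \<otimes>\<^bsub>?R\<^esub> z)"
      using k(1)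
    proof (induction x rule: frag_induction)
      case (one s)
      show ?case using k(2)
      proof (induction y rule: frag_induction)
        case (one t)
        show ?case using k(3)
        proof (induction z rule: frag_induction)
          case (one u)
          then show ?case
            using \<open>s \<in> carrier S\<close> \<open>t \<in> carrier S\<close> by (simp add: monoid_ring_mult_single m_assoc)
        qed (simp_all add: monoid_ring_mult_diff)
      qed (simp_all add: monoid_ring_mult_diff monoid_ring_diff_mult)
    qed (simp_all add: monoid_ring_diff_mult)
  next
    fix x assume "x \<in> carrier ?R"
    then have k: "Poly_Mapping.keys x \<subseteq> carrier S"
      by (simp add: carr)
    have one: "\<one>\<^bsub>?R\<^esub> = Poly_Mapping.single \<one>\<^bsub>S\<^esub> 1"
      by (simp add: monoid_ring_def)
    show "\<one>\<^bsub>?R\<^esub> \<otimes>\<^bsub>?R\<^esub> x = x" using k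
      by (induction x rule: frag_induction)
        (simp_all add: one monoid_ring_mult_single monoid_ring_mult_diff)
    show "x \<otimes>\<^bsub>?R\<^esub> \<one>\<^bsub>?R\<^esub> = x" using k
      by (induction x rule: frag_induction)
        (simp_all add: one monoid_ring_mult_single monoid_ring_diff_mult)
  qed (rule closed)
  show ?thesis
    by (rule ringI[OF grp mon])
      (use monoid_ring_add_mult[where S = S] monoid_ring_mult_add[where S = S] in
        \<open>simp_all add: monoid_ring_def\<close>)
qed

lemma augmentation_superset:
  assumes "finite X" "Poly_Mapping.keys a \<subseteq> X"
  shows "augmentation a = (\<Sum>s\<in>X. Poly_Mapping.lookup a s)"
  unfolding augmentation_def using assms
  by (intro sum.mono_neutral_left) (auto simp: in_keys_iff)

lemma augmentation_single [simp]: "augmentation (Poly_Mapping.single s m) = m"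
  by (simp add: augmentation_superset[where X = "{s}"])

lemma augmentation_zero [simp]: "augmentation 0 = 0"
  by (simp add: augmentation_def)

lemma augmentation_add: "augmentation (a + b) = augmentation a + augmentation b"
proof -
  let ?X = "Poly_Mapping.keys a \<union> Poly_Mapping.keys b"
  have "Poly_Mapping.keys (a + b) \<subseteq> ?X"
    by (rule keys_add)
  then show ?thesis
    by (simp add: augmentation_superset[where X = ?X] lookup_add sum.distrib)
qed

lemma augmentation_diff: "augmentation (a - b) = augmentation a - augmentation b"
  using augmentation_add[of "a - b" b] by simp

lemma augmentation_mult:
  "augmentation (a \<otimes>\<^bsub>monoid_ring S\<^esub> b) = augmentation a * augmentation b"
proof -
  have "Poly_Mapping.keys a \<subseteq> UNIV" "Poly_Mapping.keys b \<subseteq> UNIV" by simp_all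
  then show ?thesis
  proof (induction a rule: frag_induction)
    case (one s)
    from one(2) show ?case
      by (induction b rule: frag_induction)
        (simp_all add: monoid_ring_mult_single monoid_ring_mult_diff augmentation_diff)
  qed (simp_all add: monoid_ring_diff_mult augmentation_diff left_diff_distrib)
qed

lemma abelian_group_trivial_module: "abelian_group trivial_module"
  by (rule abelian_groupI)
    (auto simp: trivial_module_def intro: exI[of _ "- x" for x :: int])

lemma
  assumes "monoid S"
  shows left_module_trivial: "left_module (monoid_ring S) trivial_module"
    and right_module_trivial: "right_module (monoid_ring S) trivial_module"
proof -
  have one: "augmentation \<one>\<^bsub>monoid_ring S\<^esub> = 1"
    by (simp add: monoid_ring_def)
  have add: "augmentation (a \<oplus>\<^bsub>monoid_ring S\<^esub> b) = augmentation a + augmentation b" for a b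
    by (simp add: monoid_ring_def augmentation_add)
  show "left_module (monoid_ring S) trivial_module"
    by (intro left_module.intro left_module_axioms.intro ring_monoid_ring
        abelian_group_trivial_module assms)
      (simp_all add: trivial_module_def one add augmentation_mult algebra_simps)
  show "right_module (monoid_ring S) trivial_module"
    by (intro right_module.intro right_module_axioms.intro ring_monoid_ring
        abelian_group_trivial_module assms)
      (simp_all add: trivial_module_def one add augmentation_mult algebra_simps)
qed


section \<open>Finiteness properties\<close>

text \<open>Exactness of \<open>A n \<rightarrow> \<dots> \<rightarrow> A 0 \<rightarrow> \<int> \<rightarrow> 0\<close>, where \<open>d i\<close> maps \<open>A (Suc i)\<close>
  to \<open>A i\<close> and \<open>\<epsilon>\<close> maps \<open>A 0\<close> to the integers. Nothing is required at \<open>A n\<close>.\<close>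

definition exact_to_trivial ::
  "('a, 'k) monoid_scheme \<Rightarrow> nat \<Rightarrow> (nat \<Rightarrow> ('a \<Rightarrow>\<^sub>0 int, 'm) module) \<Rightarrow>
   (nat \<Rightarrow> 'm \<Rightarrow> 'm) \<Rightarrow> ('m \<Rightarrow> int) \<Rightarrow> bool" where
  "exact_to_trivial S n A d \<epsilon> \<longleftrightarrow>
     \<epsilon> \<in> module_hom (monoid_ring S) (A 0) trivial_module \<and>
     (\<forall>i<n. d i \<in> module_hom (monoid_ring S) (A (Suc i)) (A i)) \<and>
     \<epsilon> ` carrier (A 0) = carrier (trivial_module :: ('a \<Rightarrow>\<^sub>0 int, int) module) \<and>
     (0 < n \<longrightarrow>
        d 0 ` carrier (A 1) = a_kernel (A 0) (trivial_module :: ('a \<Rightarrow>\<^sub>0 int, int) module) \<epsilon>) \<and>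
     (\<forall>i. Suc i < n \<longrightarrow>
        d (Suc i) ` carrier (A (Suc (Suc i))) = a_kernel (A (Suc i)) (A i) (d i))"

text \<open>The modules are taken with elements in the type \<open>nat \<Rightarrow> ('a \<Rightarrow>\<^sub>0 int)\<close>. This is no
  restriction: a free module of rank \<open>k\<close> is isomorphic to the one whose elements are the
  functions from \<open>nat\<close> to the monoid ring that vanish outside \<open>{..<k}\<close>.\<close>

definition monoid_left_FP :: "nat \<Rightarrow> ('a, 'k) monoid_scheme \<Rightarrow> bool" where
  "monoid_left_FP n S \<longleftrightarrow>
     (\<exists>(A :: nat \<Rightarrow> ('a \<Rightarrow>\<^sub>0 int, nat \<Rightarrow> ('a \<Rightarrow>\<^sub>0 int)) module) d \<epsilon>.
        (\<forall>i\<le>n. left_module (monoid_ring S) (A i) \<and> finitely_generated_free (monoid_ring S) (A i)) \<and>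
        exact_to_trivial S n A d \<epsilon>)"

definition monoid_right_FP :: "nat \<Rightarrow> ('a, 'k) monoid_scheme \<Rightarrow> bool" where
  "monoid_right_FP n S \<longleftrightarrow>
     (\<exists>(A :: nat \<Rightarrow> ('a \<Rightarrow>\<^sub>0 int, nat \<Rightarrow> ('a \<Rightarrow>\<^sub>0 int)) module) d \<epsilon>.
        (\<forall>i\<le>n. right_module (monoid_ring S) (A i) \<and> finitely_generated_free (monoid_ring S) (A i)) \<and>
        exact_to_trivial S n A d \<epsilon>)"

text \<open>A semigroup with an identity is treated as a monoid as it stands; otherwise an identity is
  adjoined.\<close>

definition semigroup_left_FP :: "nat \<Rightarrow> 'a set \<Rightarrow> ('a \<Rightarrow> 'a \<Rightarrow> 'a) \<Rightarrow> bool" where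
  "semigroup_left_FP n S f \<longleftrightarrow>
     (\<exists>e. is_identity S f e \<and> monoid_left_FP n \<lparr>carrier = S, mult = f, one = e\<rparr>) \<or>
     (\<nexists>e. is_identity S f e) \<and> monoid_left_FP n (adjoin_identity S f)"

definition semigroup_right_FP :: "nat \<Rightarrow> 'a set \<Rightarrow> ('a \<Rightarrow> 'a \<Rightarrow> 'a) \<Rightarrow> bool" where
  "semigroup_right_FP n S f \<longleftrightarrow>
     (\<exists>e. is_identity S f e \<and> monoid_right_FP n \<lparr>carrier = S, mult = f, one = e\<rparr>) \<or>
     (\<nexists>e. is_identity S f e) \<and> monoid_right_FP n (adjoin_identity S f)"

text \<open>For a group the left and right conditions are equivalent (by inversion); the left one is
  taken as the definition.\<close>

definition group_FP :: "nat \<Rightarrow> ('a, 'k) monoid_scheme \<Rightarrow> bool" where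
  "group_FP n G \<longleftrightarrow> monoid_left_FP n G"

end

theory Submission
  imports Defs "HOL-Library.Function_Algebras" "HOL-Library.Nat_Bijection"
begin

text \<open>
  Let \<open>e\<close> be an idempotent of \<open>U\<close> and \<open>S\<close> the monoid \<open>U\<close> with an identity adjoined. In a
  completely simple semigroup \<open>eUe\<close> is already a group \<open>G\<close>, the maximal subgroup at \<open>e\<close>. Right
  multiplication makes \<open>Ue\<close> a free \<open>G\<close>-set with one orbit for each principal right ideal
  of \<open>U\<close>, and left multiplication makes \<open>eU\<close> a free \<open>G\<close>-set with one orbit for each principal left
  ideal. The right ideal generated by a product is the one generated by its first factor, so a
  finitely generated \<open>U\<close> has only finitely many of them, and likewise on the left. The
  theorem thus compares modules over \<open>\<int>S\<close> with modules over its corner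
  \<open>\<int>G = e \<int>S e\<close>, where \<open>\<int>Se\<close> and \<open>e\<int>S\<close> are free of finite rank over \<open>\<int>G\<close>.

  From \<open>S\<close> to \<open>G\<close>: multiplication by \<open>e\<close> is an exact functor. It takes a resolution of \<open>\<int>\<close> by
  finitely generated free \<open>\<int>S\<close>-modules to a resolution of \<open>e\<int> = \<int>\<close> by finitely generated free
  \<open>\<int>G\<close>-modules (\<open>type_FP_restrict\<close>).

  From \<open>G\<close> to \<open>S\<close>: tensoring with \<open>\<int>Se\<close> is exact, so a resolution of \<open>\<int>\<close> over \<open>\<int>G\<close> becomes a
  resolution, by sums of copies of the projective module \<open>\<int>Se\<close>, of the permutation module on the
  set \<open>I\<close> of principal right ideals (\<open>fp_induce\<close>). This module maps onto \<open>\<int>\<close>. An element of \<open>U\<close>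
  moves all of \<open>I\<close> to a single point, so \<open>U\<close> acts by zero on the kernel, which is therefore a sum of
  copies of \<open>\<int>S/\<int>U\<close>. Since \<open>\<int>U\<close> is the direct sum of the projective modules \<open>\<int>Sp\<close>, one
  idempotent \<open>p\<close> for each principal left ideal, the kernel has a resolution of length one by
  finitely generated projectives, and \<open>\<int>\<close> inherits type FP over \<open>\<int>S\<close>
  (\<open>fp_null_extension\<close>, \<open>type_FP_trivial_induce\<close>).

  If \<open>U\<close> has an identity, then \<open>U = G\<close> and there is nothing to do. The statement about right
  modules is the statement about left modules for the opposite semigroup, whose maximal subgroups
  are the opposite groups; inversion identifies these with the original ones.

  Resolutions are handled one step at a time, through syzygies of finite generating families. A
  generator may carry an idempotent \<open>\<epsilon>\<close> that fixes it, in which case only coefficients in \<open>R\<epsilon>\<close> are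
  used; this amounts to resolving by the projective modules \<open>R\<epsilon>\<close>, and makes \<open>\<int>Se\<close> and
  \<open>\<int>Sp\<close> as convenient as free modules. Direct sums with projectives are harmless
  (\<open>fp_add_projective\<close>), whence free resolutions can be recovered in the end
  (\<open>type_FP_free_cover\<close>, \<open>monoid_left_FP_iff_type_FP\<close>).
\<close>

section \<open>Modules over a ring on a subset of an additive group\<close>

lemma sum_fun_apply: "(\<Sum>j\<in>J. f j) i = (\<Sum>j\<in>J. f j i)"
  for f :: "'j \<Rightarrow> 'i \<Rightarrow> 'r::comm_monoid_add"
  by (induction J rule: infinite_finite_induct) auto

text \<open>Rings and modules live on subsets of types that already carry an addition, so that finite
  combinations are ordinary sums. Monoid rings and their syzygy modules are of this kind.\<close>

locale ring_on =
  fixes R :: "'r::ab_group_add set"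
    and mul :: "'r \<Rightarrow> 'r \<Rightarrow> 'r" (infixl "\<star>" 70)
    and one :: 'r
  assumes zero_mem [simp, intro]: "0 \<in> R"
    and add_mem [simp, intro]: "a \<in> R \<Longrightarrow> b \<in> R \<Longrightarrow> a + b \<in> R"
    and uminus_mem [simp, intro]: "a \<in> R \<Longrightarrow> - a \<in> R"
    and mul_mem [simp, intro]: "a \<in> R \<Longrightarrow> b \<in> R \<Longrightarrow> a \<star> b \<in> R"
    and one_mem [simp, intro]: "one \<in> R"
    and mul_assoc: "a \<in> R \<Longrightarrow> b \<in> R \<Longrightarrow> c \<in> R \<Longrightarrow> a \<star> b \<star> c = a \<star> (b \<star> c)"
    and add_mul: "a \<in> R \<Longrightarrow> b \<in> R \<Longrightarrow> c \<in> R \<Longrightarrow> (a + b) \<star> c = a \<star> c + b \<star> c"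
    and mul_add: "a \<in> R \<Longrightarrow> b \<in> R \<Longrightarrow> c \<in> R \<Longrightarrow> a \<star> (b + c) = a \<star> b + a \<star> c"
    and one_mul [simp]: "a \<in> R \<Longrightarrow> one \<star> a = a"
    and mul_one [simp]: "a \<in> R \<Longrightarrow> a \<star> one = a"

locale module_on = ring_on R mul one
  for R :: "'r::ab_group_add set" and mul (infixl "\<star>" 70) and one :: 'r +
  fixes M :: "'m::ab_group_add set"
    and act :: "'r \<Rightarrow> 'm \<Rightarrow> 'm" (infixr "\<rhd>" 75)
  assumes zero_memM [simp, intro]: "0 \<in> M"
    and add_memM [simp, intro]: "x \<in> M \<Longrightarrow> y \<in> M \<Longrightarrow> x + y \<in> M"
    and act_memM [simp, intro]: "a \<in> R \<Longrightarrow> x \<in> M \<Longrightarrow> a \<rhd> x \<in> M"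
    and add_act: "a \<in> R \<Longrightarrow> b \<in> R \<Longrightarrow> x \<in> M \<Longrightarrow> (a + b) \<rhd> x = a \<rhd> x + b \<rhd> x"
    and act_add: "a \<in> R \<Longrightarrow> x \<in> M \<Longrightarrow> y \<in> M \<Longrightarrow> a \<rhd> (x + y) = a \<rhd> x + a \<rhd> y"
    and mul_act: "a \<in> R \<Longrightarrow> b \<in> R \<Longrightarrow> x \<in> M \<Longrightarrow> (a \<star> b) \<rhd> x = a \<rhd> b \<rhd> x"
    and one_act [simp]: "x \<in> M \<Longrightarrow> one \<rhd> x = x"
begin

lemma zero_act [simp]: "x \<in> M \<Longrightarrow> 0 \<rhd> x = 0"
  using add_act[of 0 0 x] by simp

lemma act_zero [simp]: "a \<in> R \<Longrightarrow> a \<rhd> 0 = 0"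
  using act_add[of a 0 0] by simp

lemma uminus_act: "a \<in> R \<Longrightarrow> x \<in> M \<Longrightarrow> (- a) \<rhd> x = - (a \<rhd> x)"
  using add_act[of a "- a" x] by (simp add: add_eq_0_iff)

lemma uminus_memM [simp, intro]: "x \<in> M \<Longrightarrow> - x \<in> M"
  using uminus_act[of one x] act_memM[of "- one" x] by simp

lemma diff_memM [simp, intro]: "x \<in> M \<Longrightarrow> y \<in> M \<Longrightarrow> x - y \<in> M"
  using add_memM[of x "- y"] by simp

lemma act_uminus: "a \<in> R \<Longrightarrow> x \<in> M \<Longrightarrow> a \<rhd> (- x) = - (a \<rhd> x)"
  using act_add[of a x "- x"] by (simp add: add_eq_0_iff)

lemma act_diff: "a \<in> R \<Longrightarrow> x \<in> M \<Longrightarrow> y \<in> M \<Longrightarrow> a \<rhd> (x - y) = a \<rhd> x - a \<rhd> y"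
  using act_add[of a x "- y"] by (simp add: act_uminus)

lemma diff_act: "a \<in> R \<Longrightarrow> b \<in> R \<Longrightarrow> x \<in> M \<Longrightarrow> (a - b) \<rhd> x = a \<rhd> x - b \<rhd> x"
  using add_act[of a "- b" x] by (simp add: uminus_act)

lemma sum_memM: "(\<And>j. j \<in> J \<Longrightarrow> f j \<in> M) \<Longrightarrow> sum f J \<in> M"
  by (induction J rule: infinite_finite_induct) auto

lemma act_sum:
  "a \<in> R \<Longrightarrow> (\<And>j. j \<in> J \<Longrightarrow> f j \<in> M) \<Longrightarrow> a \<rhd> sum f J = (\<Sum>j\<in>J. a \<rhd> f j)"
  by (induction J rule: infinite_finite_induct) (auto simp: act_add sum_memM)

lemma sum_memR: "(\<And>j. j \<in> J \<Longrightarrow> f j \<in> R) \<Longrightarrow> sum f J \<in> R"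
  by (induction J rule: infinite_finite_induct) auto

lemma sum_act:
  "x \<in> M \<Longrightarrow> (\<And>j. j \<in> J \<Longrightarrow> f j \<in> R) \<Longrightarrow> sum f J \<rhd> x = (\<Sum>j\<in>J. f j \<rhd> x)"
  by (induction J rule: infinite_finite_induct) (auto simp: add_act sum_memR)

text \<open>Additivity on the carrier alone is enough for finite sums; the maps below are not additive on the
  whole type.\<close>

lemma hom_sum:
  fixes \<psi> :: "'m \<Rightarrow> 'n::ab_group_add"
  assumes add: "\<And>x y. x \<in> M \<Longrightarrow> y \<in> M \<Longrightarrow> \<psi> (x + y) = \<psi> x + \<psi> y"
    and mem: "\<And>j. j \<in> J \<Longrightarrow> f j \<in> M"
  shows "\<psi> (sum f J) = (\<Sum>j\<in>J. \<psi> (f j))"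
proof -
  have "\<psi> 0 = 0"
    using add[of 0 0] by simp
  with mem show ?thesis
    by (induction J rule: infinite_finite_induct) (auto simp: add sum_memM)
qed

end

section \<open>Type FP by iterated syzygies\<close>

context ring_on
begin

abbreviation lmod :: "'m::ab_group_add set \<Rightarrow> ('r \<Rightarrow> 'm \<Rightarrow> 'm) \<Rightarrow> bool" where
  "lmod M act \<equiv> module_on R mul one M act"

definition smul :: "'r \<Rightarrow> (nat \<Rightarrow> 'r) \<Rightarrow> nat \<Rightarrow> 'r" where
  "smul a c = (\<lambda>j. a \<star> c j)"

lemma regular: "lmod R mul"
  by unfold_locales (auto simp: add_mul mul_add mul_assoc)

sublocale reg: module_on R mul one R mul
  by (rule regular)

lemma lmod_funs: "lmod {c. \<forall>j. c j \<in> R} smul"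
  by unfold_locales (auto simp: smul_def fun_eq_iff add_mul mul_add mul_assoc)

lemma lmod_subset:
  assumes "lmod M act" "N \<subseteq> M" "0 \<in> N" "\<And>x y. x \<in> N \<Longrightarrow> y \<in> N \<Longrightarrow> x + y \<in> N"
    "\<And>a x. a \<in> R \<Longrightarrow> x \<in> N \<Longrightarrow> act a x \<in> N"
  shows "lmod N act"
proof -
  interpret M: module_on R mul one M act by fact
  show ?thesis
    using assms(2-)
    by unfold_locales (auto simp: M.add_act M.act_add M.mul_act subset_iff)
qed

text \<open>The family \<open>x\<close> is the image of the standard generators under a surjection from the direct sum of
  the projective modules \<open>R(\<epsilon> j)\<close> onto \<open>M\<close>; its kernel is \<open>syz act J \<epsilon> x\<close> below. Index sets consist
  of natural numbers so that all syzygies lie in one type.\<close>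

definition covers ::
  "'m::ab_group_add set \<Rightarrow> ('r \<Rightarrow> 'm \<Rightarrow> 'm) \<Rightarrow> nat set \<Rightarrow> (nat \<Rightarrow> 'r) \<Rightarrow> (nat \<Rightarrow> 'm) \<Rightarrow> bool" where
  "covers M act J \<epsilon> x \<longleftrightarrow>
     finite J \<and>
     (\<forall>j\<in>J. \<epsilon> j \<in> R \<and> \<epsilon> j \<star> \<epsilon> j = \<epsilon> j \<and> x j \<in> M \<and> act (\<epsilon> j) (x j) = x j) \<and>
     (\<forall>m\<in>M. \<exists>c. (\<forall>j\<in>J. c j \<in> R) \<and> m = (\<Sum>j\<in>J. act (c j) (x j)))"

definition syz ::
  "('r \<Rightarrow> 'm::ab_group_add \<Rightarrow> 'm) \<Rightarrow> nat set \<Rightarrow> (nat \<Rightarrow> 'r) \<Rightarrow> (nat \<Rightarrow> 'm) \<Rightarrow> (nat \<Rightarrow> 'r) set" where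
  "syz act J \<epsilon> x =
     {c. (\<forall>j. c j \<in> R) \<and> (\<forall>j. j \<notin> J \<longrightarrow> c j = 0) \<and> (\<forall>j\<in>J. c j \<star> \<epsilon> j = c j) \<and>
         (\<Sum>j\<in>J. act (c j) (x j)) = 0}"

abbreviation free_covers where
  "free_covers M act J \<equiv> covers M act J (\<lambda>_. one)"

abbreviation free_syz where
  "free_syz act J \<equiv> syz act J (\<lambda>_. one)"

text \<open>\<open>fp n K\<close> says that \<open>K\<close> has type FP below degree \<open>n\<close>, that is, type \<open>FP\<^sub>n\<^sub>-\<^sub>1\<close>: with this
  shift the recursion starts from an empty condition. A module with arbitrary elements needs one
  step of its own before the recursion stays within the type of syzygies; this is \<open>type_FP\<close>.\<close>

primrec fp :: "nat \<Rightarrow> (nat \<Rightarrow> 'r) set \<Rightarrow> bool" where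
  "fp 0 K \<longleftrightarrow> True"
| "fp (Suc n) K \<longleftrightarrow> (\<exists>J \<epsilon> x. covers K smul J \<epsilon> x \<and> fp n (syz smul J \<epsilon> x))"

definition type_FP :: "nat \<Rightarrow> 'm::ab_group_add set \<Rightarrow> ('r \<Rightarrow> 'm \<Rightarrow> 'm) \<Rightarrow> bool" where
  "type_FP n M act \<longleftrightarrow> (\<exists>J \<epsilon> x. covers M act J \<epsilon> x \<and> fp n (syz act J \<epsilon> x))"

lemma fp_Suc: "fp (Suc n) K \<longleftrightarrow> type_FP n K smul"
  by (simp add: type_FP_def)

lemma coversD:
  assumes "covers M act J \<epsilon> x"
  shows "finite J" "j \<in> J \<Longrightarrow> \<epsilon> j \<in> R" "j \<in> J \<Longrightarrow> \<epsilon> j \<star> \<epsilon> j = \<epsilon> j" "j \<in> J \<Longrightarrow> x j \<in> M"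
    "j \<in> J \<Longrightarrow> act (\<epsilon> j) (x j) = x j"
  using assms by (auto simp: covers_def)

text \<open>Since \<open>\<epsilon> j\<close> fixes \<open>x j\<close>, any coefficient \<open>c j\<close> may be replaced by \<open>c j \<star> \<epsilon> j\<close>.\<close>

lemma covers_coeffs:
  assumes "covers M act J \<epsilon> x" "lmod M act" "m \<in> M"
  obtains c where "\<And>j. c j \<in> R" "\<And>j. j \<notin> J \<Longrightarrow> c j = 0" "\<And>j. j \<in> J \<Longrightarrow> c j \<star> \<epsilon> j = c j"
    "m = (\<Sum>j\<in>J. act (c j) (x j))"
proof -
  interpret M: module_on R mul one M act by fact
  obtain c where c: "\<forall>j\<in>J. c j \<in> R" "m = (\<Sum>j\<in>J. act (c j) (x j))"
    using assms by (auto simp: covers_def)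
  note D = coversD[OF assms(1)]
  show thesis
  proof (rule that[of "\<lambda>j. if j \<in> J then c j \<star> \<epsilon> j else 0"])
    have "act (c j \<star> \<epsilon> j) (x j) = act (c j) (x j)" if "j \<in> J" for j
      using that c D(2-5)[of j] by (simp add: M.mul_act)
    then show "m = (\<Sum>j\<in>J. act (if j \<in> J then c j \<star> \<epsilon> j else 0) (x j))"
      using c(2) by simp
  qed (use c D in \<open>auto simp: mul_assoc\<close>)
qed

lemma lmod_syz:
  assumes "lmod M act" "covers M act J \<epsilon> x"
  shows "lmod (syz act J \<epsilon> x) smul"
proof -
  interpret M: module_on R mul one M act by fact
  note D = coversD[OF assms(2)]
  show ?thesis
  proof (rule lmod_subset[OF lmod_funs])
    show "0 \<in> syz act J \<epsilon> x"
      using D by (auto simp: syz_def)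
  next
    fix c d assume cd: "c \<in> syz act J \<epsilon> x" "d \<in> syz act J \<epsilon> x"
    have "(\<Sum>j\<in>J. act ((c + d) j) (x j)) = (\<Sum>j\<in>J. act (c j) (x j)) + (\<Sum>j\<in>J. act (d j) (x j))"
      unfolding sum.distrib[symmetric]
      by (rule sum.cong) (use cd D in \<open>auto simp: syz_def M.add_act\<close>)
    then show "c + d \<in> syz act J \<epsilon> x"
      using cd D by (auto simp: syz_def add_mul)
  next
    fix a c assume a: "a \<in> R" and c: "c \<in> syz act J \<epsilon> x"
    have "(\<Sum>j\<in>J. act (a \<star> c j) (x j)) = (\<Sum>j\<in>J. act a (act (c j) (x j)))"
      by (rule sum.cong) (use a c D in \<open>auto simp: syz_def M.mul_act\<close>)
    also have "\<dots> = act a (\<Sum>j\<in>J. act (c j) (x j))"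
      by (rule M.act_sum[symmetric]) (use a c D in \<open>auto simp: syz_def\<close>)
    finally show "smul a c \<in> syz act J \<epsilon> x"
      using a c D by (auto simp: syz_def smul_def mul_assoc)
  qed (auto simp: syz_def)
qed

end

lemma finite_fresh_copy:
  fixes J :: "nat set" and L :: "'l set"
  assumes "finite J" "finite L"
  obtains h where "inj_on h L" "J \<inter> h ` L = {}"
proof -
  obtain g where g: "bij_betw g L {0..<card L}"
    using ex_bij_betw_finite_nat[OF assms(2)] by blast
  obtain k where k: "\<And>j. j \<in> J \<Longrightarrow> j < k"
    using assms(1) by (auto simp: finite_nat_set_iff_bounded)
  show thesis
  proof (rule that[of "\<lambda>l. k + g l"])
    show "inj_on (\<lambda>l. k + g l) L"
      using g by (auto simp: bij_betw_def inj_on_def)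
  qed (use k in fastforce)
qed

context ring_on
begin

text \<open>Generators of a submodule \<open>A\<close> of \<open>B\<close>, enlarged by a family \<open>z\<close> that generates \<open>B\<close> modulo \<open>A\<close>. The
  new generators get fresh indices, so the old syzygy module is literally the part of the new one
  that vanishes on them.\<close>

lemma covers_join:
  fixes L :: "'l set"
  assumes B: "lmod B act" and "A \<subseteq> B" and cov: "covers A act J \<epsilon> x" and L: "finite L"
    and \<eta>: "\<And>l. l \<in> L \<Longrightarrow> \<eta> l \<in> R" "\<And>l. l \<in> L \<Longrightarrow> \<eta> l \<star> \<eta> l = \<eta> l"
    and z: "\<And>l. l \<in> L \<Longrightarrow> z l \<in> B" "\<And>l. l \<in> L \<Longrightarrow> act (\<eta> l) (z l) = z l"
    and span: "\<And>b. b \<in> B \<Longrightarrow> \<exists>a\<in>A. \<exists>c. (\<forall>l\<in>L. c l \<in> R) \<and> b = a + (\<Sum>l\<in>L. act (c l) (z l))"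
  obtains h \<epsilon>' x' where "inj_on h L" "J \<inter> h ` L = {}"
    "\<forall>j\<in>J. \<epsilon>' j = \<epsilon> j" "\<forall>l\<in>L. \<epsilon>' (h l) = \<eta> l"
    "\<forall>c. (\<Sum>k\<in>J \<union> h ` L. act (c k) (x' k)) =
          (\<Sum>j\<in>J. act (c j) (x j)) + (\<Sum>l\<in>L. act (c (h l)) (z l))"
    "covers B act (J \<union> h ` L) \<epsilon>' x'"
    "syz act J \<epsilon> x = {c \<in> syz act (J \<union> h ` L) \<epsilon>' x'. \<forall>l\<in>L. c (h l) = 0}"
proof -
  interpret B: module_on R mul one B act by fact
  note D = coversD[OF cov]
  obtain h where inj: "inj_on h L" and disj: "J \<inter> h ` L = {}"
    using finite_fresh_copy[OF D(1) L] .
  define g where "g = the_inv_into L h"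
  have g: "g (h l) = l" if "l \<in> L" for l
    using inj that by (simp add: g_def the_inv_into_f_f)
  define \<epsilon>' where "\<epsilon>' k = (if k \<in> J then \<epsilon> k else \<eta> (g k))" for k
  define x' where "x' k = (if k \<in> J then x k else z (g k))" for k
  have hJ: "h l \<notin> J" if "l \<in> L" for l
    using disj that by blast
  have onJ: "\<epsilon>' j = \<epsilon> j" "x' j = x j" if "j \<in> J" for j
    using that by (simp_all add: \<epsilon>'_def x'_def)
  have onL: "\<epsilon>' (h l) = \<eta> l" "x' (h l) = z l" if "l \<in> L" for l
    using that hJ g by (simp_all add: \<epsilon>'_def x'_def)
  have sum: "(\<Sum>k\<in>J \<union> h ` L. act (c k) (x' k)) =
      (\<Sum>j\<in>J. act (c j) (x j)) + (\<Sum>l\<in>L. act (c (h l)) (z l))" for c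
    using D(1) L disj inj
    by (simp add: sum.union_disjoint sum.reindex onJ onL)
  have cov': "covers B act (J \<union> h ` L) \<epsilon>' x'"
    unfolding covers_def
  proof (intro conjI ballI)
    show "finite (J \<union> h ` L)"
      using D(1) L by simp
  next
    fix k assume k: "k \<in> J \<union> h ` L"
    show "\<epsilon>' k \<in> R" "\<epsilon>' k \<star> \<epsilon>' k = \<epsilon>' k" "x' k \<in> B" "act (\<epsilon>' k) (x' k) = x' k"
      using k D \<open>A \<subseteq> B\<close> \<eta> z by (auto simp: onJ onL)
  next
    fix b assume "b \<in> B"
    then obtain a c where ac: "a \<in> A" "\<forall>l\<in>L. c l \<in> R" "b = a + (\<Sum>l\<in>L. act (c l) (z l))"
      using span by blast
    obtain d where d: "\<forall>j\<in>J. d j \<in> R" "a = (\<Sum>j\<in>J. act (d j) (x j))"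
      using cov ac(1) by (auto simp: covers_def)
    define c' where "c' k = (if k \<in> J then d k else c (g k))" for k
    have "b = (\<Sum>k\<in>J \<union> h ` L. act (c' k) (x' k))"
      unfolding sum ac(3) d(2) using hJ g by (simp add: c'_def)
    moreover have "\<forall>k\<in>J \<union> h ` L. c' k \<in> R"
      using ac(2) d(1) hJ g by (auto simp: c'_def)
    ultimately show "\<exists>c. (\<forall>k\<in>J \<union> h ` L. c k \<in> R) \<and> b = (\<Sum>k\<in>J \<union> h ` L. act (c k) (x' k))"
      by blast
  qed
  have syz: "syz act J \<epsilon> x = {c \<in> syz act (J \<union> h ` L) \<epsilon>' x'. \<forall>l\<in>L. c (h l) = 0}"
  proof (intro Set.set_eqI iffI)
    fix c assume c: "c \<in> syz act J \<epsilon> x"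
    then have c0: "c (h l) = 0" if "l \<in> L" for l
      using that hJ by (simp add: syz_def)
    then show "c \<in> {c \<in> syz act (J \<union> h ` L) \<epsilon>' x'. \<forall>l\<in>L. c (h l) = 0}"
      using c \<eta> z by (auto simp: syz_def sum onJ onL)
  next
    fix c assume "c \<in> {c \<in> syz act (J \<union> h ` L) \<epsilon>' x'. \<forall>l\<in>L. c (h l) = 0}"
    then have c: "c \<in> syz act (J \<union> h ` L) \<epsilon>' x'" and c0: "\<And>l. l \<in> L \<Longrightarrow> c (h l) = 0"
      by auto
    have "c j = 0" if "j \<notin> J" for j
      using c c0 that by (cases "j \<in> h ` L") (auto simp: syz_def)
    moreover have "(\<Sum>j\<in>J. act (c j) (x j)) = 0"
      using c sum[of c] c0 z by (simp add: syz_def)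
    moreover have "c j \<star> \<epsilon> j = c j" if "j \<in> J" for j
      using c that onJ(1)[OF that] unfolding syz_def by force
    ultimately show "c \<in> syz act J \<epsilon> x"
      using c by (simp add: syz_def)
  qed
  show thesis
  proof (rule that[OF inj disj _ _ _ cov' syz])
  qed (simp_all add: onJ onL sum)
qed

text \<open>A complement that is a sum of modules \<open>R(\<eta> l)\<close> contributes no syzygies: the generators of \<open>A\<close>
  together with the \<open>z l\<close> have the same syzygies as those of \<open>A\<close> alone.\<close>

lemma fp_add_projective:
  fixes L :: "'l set"
  assumes B: "lmod B smul" and A: "A \<subseteq> B" "lmod A smul" "fp n A" and L: "finite L"
    and \<eta>: "\<And>l. l \<in> L \<Longrightarrow> \<eta> l \<in> R" "\<And>l. l \<in> L \<Longrightarrow> \<eta> l \<star> \<eta> l = \<eta> l"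
    and z: "\<And>l. l \<in> L \<Longrightarrow> z l \<in> B" "\<And>l. l \<in> L \<Longrightarrow> smul (\<eta> l) (z l) = z l"
    and span: "\<And>b. b \<in> B \<Longrightarrow> \<exists>a\<in>A. \<exists>c. (\<forall>l\<in>L. c l \<in> R) \<and> b = a + (\<Sum>l\<in>L. smul (c l) (z l))"
    and indep: "\<And>a c l. a \<in> A \<Longrightarrow> (\<And>l. l \<in> L \<Longrightarrow> c l \<in> R \<and> c l \<star> \<eta> l = c l) \<Longrightarrow>
       a + (\<Sum>l\<in>L. smul (c l) (z l)) = 0 \<Longrightarrow> l \<in> L \<Longrightarrow> c l = 0"
  shows "fp n B"
proof (cases n)
  case (Suc m)
  obtain J \<epsilon> x where cov: "covers A smul J \<epsilon> x" and fp: "fp m (syz smul J \<epsilon> x)"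
    using A(3) Suc by auto
  interpret A: module_on R mul one A smul by fact
  note D = coversD[OF cov]
  obtain h \<epsilon>' x' where h: "inj_on h L" "J \<inter> h ` L = {}"
    and "\<forall>j\<in>J. \<epsilon>' j = \<epsilon> j"
    and \<epsilon>': "\<forall>l\<in>L. \<epsilon>' (h l) = \<eta> l"
    and sum: "\<forall>c. (\<Sum>k\<in>J \<union> h ` L. smul (c k) (x' k)) =
          (\<Sum>j\<in>J. smul (c j) (x j)) + (\<Sum>l\<in>L. smul (c (h l)) (z l))"
    and cov': "covers B smul (J \<union> h ` L) \<epsilon>' x'"
    and syz: "syz smul J \<epsilon> x = {c \<in> syz smul (J \<union> h ` L) \<epsilon>' x'. \<forall>l\<in>L. c (h l) = 0}"
    by (rule covers_join[OF B A(1) cov L \<eta> z span]) (assumption | rule that)+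
  have "c (h l) = 0" if c: "c \<in> syz smul (J \<union> h ` L) \<epsilon>' x'" and l: "l \<in> L" for c l
  proof (rule indep[of "\<Sum>j\<in>J. smul (c j) (x j)" "\<lambda>l. c (h l)"])
    show "(\<Sum>j\<in>J. smul (c j) (x j)) \<in> A"
      using c D by (intro A.sum_memM) (auto simp: syz_def)
    show "(\<Sum>j\<in>J. smul (c j) (x j)) + (\<Sum>l\<in>L. smul (c (h l)) (z l)) = 0"
      using c sum[rule_format, of c, symmetric] by (simp add: syz_def)
    show "c (h l) \<in> R \<and> c (h l) \<star> \<eta> l = c (h l)" if "l \<in> L" for l
      using c that bspec[OF \<epsilon>' that, symmetric] by (auto simp: syz_def)
  qed (rule l)
  then have "syz smul J \<epsilon> x = syz smul (J \<union> h ` L) \<epsilon>' x'"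
    unfolding syz by blast
  then show ?thesis
    using fp cov' Suc by auto
qed simp

text \<open>Dropping the idempotents adds to the syzygies the complement of the sum of the \<open>R(\<epsilon> j)\<close>
  in a free module, which is the sum of the projective modules \<open>R(1 - \<epsilon> j)\<close>.\<close>

lemma type_FP_free_cover:
  assumes "lmod M act" "type_FP n M act"
  obtains J x where "free_covers M act J x" "fp n (free_syz act J x)"
proof -
  interpret M: module_on R mul one M act by fact
  obtain J \<epsilon> x where cov: "covers M act J \<epsilon> x" and fp: "fp n (syz act J \<epsilon> x)"
    using assms(2) by (auto simp: type_FP_def)
  note D = coversD[OF cov]
  have cov1: "free_covers M act J x"
    using cov by (auto simp: covers_def)
  define z where "z j = (\<lambda>i. if i = j then one - \<epsilon> j else 0)" for j :: nat
  have \<epsilon>1: "(one - \<epsilon> j) \<star> \<epsilon> j = 0" "(one - \<epsilon> j) \<star> (one - \<epsilon> j) = one - \<epsilon> j" if "j \<in> J" for j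
    using D(2,3)[OF that] by (simp_all add: reg.diff_act reg.act_diff)
  have smul_z: "(\<Sum>j\<in>J. smul (c j) (z j)) i = (if i \<in> J then c i \<star> (one - \<epsilon> i) else 0)"
    if "\<forall>j\<in>J. c j \<in> R" for c i
  proof -
    have "(\<Sum>j\<in>J. smul (c j) (z j)) i = (\<Sum>j\<in>J. if i = j then c j \<star> (one - \<epsilon> j) else 0)"
      unfolding sum_fun_apply by (rule sum.cong) (use that in \<open>auto simp: smul_def z_def\<close>)
    then show ?thesis
      using D(1) by simp
  qed
  have "fp n (free_syz act J x)"
  proof (rule fp_add_projective[OF lmod_syz[OF assms(1) cov1] _ lmod_syz[OF assms(1) cov] fp D(1),
        where \<eta> = "\<lambda>j. one - \<epsilon> j" and z = z])
    show "syz act J \<epsilon> x \<subseteq> free_syz act J x"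
      by (auto simp: syz_def)
  next
    fix j assume j: "j \<in> J"
    show "one - \<epsilon> j \<in> R" "(one - \<epsilon> j) \<star> (one - \<epsilon> j) = one - \<epsilon> j"
      using D j \<epsilon>1 by auto
    show "smul (one - \<epsilon> j) (z j) = z j"
      using j D \<epsilon>1(2) by (auto simp: smul_def z_def fun_eq_iff)
    have "(\<Sum>i\<in>J. act (z j i) (x i)) = (\<Sum>i\<in>J. if i = j then act (one - \<epsilon> j) (x j) else 0)"
      by (rule sum.cong) (use D in \<open>auto simp: z_def\<close>)
    also have "\<dots> = 0"
      using D j by (simp add: M.diff_act)
    finally show "z j \<in> free_syz act J x"
      using D j by (auto simp: syz_def z_def)
  next
    fix b assume b: "b \<in> free_syz act J x"
    have "(\<Sum>j\<in>J. act (b j \<star> \<epsilon> j) (x j)) = (\<Sum>j\<in>J. act (b j) (x j))"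
      by (rule sum.cong) (use b D in \<open>auto simp: M.mul_act syz_def\<close>)
    then have a: "(\<lambda>j. if j \<in> J then b j \<star> \<epsilon> j else 0) \<in> syz act J \<epsilon> x"
      using b D by (auto simp: syz_def mul_assoc)
    have "b = (\<lambda>j. if j \<in> J then b j \<star> \<epsilon> j else 0) + (\<Sum>j\<in>J. smul (b j) (z j))"
    proof
      fix i show "b i = ((\<lambda>j. if j \<in> J then b j \<star> \<epsilon> j else 0) + (\<Sum>j\<in>J. smul (b j) (z j))) i"
        using b D(2)[of i] by (auto simp: syz_def smul_z reg.act_diff)
    qed
    with a b show "\<exists>a\<in>syz act J \<epsilon> x. \<exists>c. (\<forall>j\<in>J. c j \<in> R) \<and> b = a + (\<Sum>j\<in>J. smul (c j) (z j))"
      by (intro bexI[OF _ a] exI[of _ b]) (auto simp: syz_def)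
  next
    fix a c j
    assume a: "a \<in> syz act J \<epsilon> x" and c: "\<And>j. j \<in> J \<Longrightarrow> c j \<in> R \<and> c j \<star> (one - \<epsilon> j) = c j"
      and sum: "a + (\<Sum>j\<in>J. smul (c j) (z j)) = 0" and j: "j \<in> J"
    have "a j + c j = 0"
      using fun_cong[OF sum, of j] j c by (simp add: smul_z)
    have "c j \<star> \<epsilon> j = c j \<star> ((one - \<epsilon> j) \<star> \<epsilon> j)"
      using c[OF j] D(2)[OF j] mul_assoc[of "c j" "one - \<epsilon> j" "\<epsilon> j"] by auto
    then have "c j \<star> \<epsilon> j = 0"
      using c[OF j] \<epsilon>1(1)[OF j] by simp
    moreover have "a j \<star> \<epsilon> j + c j \<star> \<epsilon> j = 0"
      using a c[OF j] D(2)[OF j] \<open>a j + c j = 0\<close>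
      by (subst add_mul[symmetric]) (auto simp: syz_def)
    ultimately have "a j = 0"
      using a j by (simp add: syz_def)
    with \<open>a j + c j = 0\<close> show "c j = 0"
      by simp
  qed
  with cov1 show thesis
    by (rule that)
qed

text \<open>Think of \<open>N\<close> as a ring of scalars and of \<open>Q\<close> as a complementary ideal. Then \<open>B / A\<close> is free
  over \<open>N\<close> on the classes of the \<open>y i\<close>, and \<open>Q\<close> acts on it by zero. A syzygy of the generators of \<open>A\<close> together with
  the \<open>y i\<close> has its \<open>y\<close>-coefficients in \<open>Q\<close>; conversely every element of \<open>Q\<close> occurs as such a
  coefficient, because \<open>Q\<close> maps \<open>y i\<close> into \<open>A\<close>. The new syzygies are thus an extension of sums of
  copies of \<open>Q\<close> by the old ones. It splits, since \<open>Q\<close> is the sum of the projective modules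
  \<open>R(e l)\<close>.\<close>

lemma fp_null_extension:
  fixes I :: "'i set" and \<Lambda> :: "'l set"
  assumes B: "lmod B smul" and A: "A \<subseteq> B" "lmod A smul" "fp n A"
    and I: "finite I" and y: "\<And>i. i \<in> I \<Longrightarrow> y i \<in> B"
    and span: "\<And>b. b \<in> B \<Longrightarrow> \<exists>a\<in>A. \<exists>c. (\<forall>i\<in>I. c i \<in> R) \<and> b = a + (\<Sum>i\<in>I. smul (c i) (y i))"
    and indep: "\<And>c i. (\<And>i. i \<in> I \<Longrightarrow> c i \<in> N) \<Longrightarrow> (\<Sum>i\<in>I. smul (c i) (y i)) \<in> A \<Longrightarrow> i \<in> I \<Longrightarrow> c i = 0"
    and Q: "Q \<subseteq> R" and N: "N \<subseteq> R"
    and decomp: "\<And>a. a \<in> R \<Longrightarrow> \<exists>\<nu>\<in>N. \<exists>q\<in>Q. a = \<nu> + q"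
    and null: "\<And>q i. q \<in> Q \<Longrightarrow> i \<in> I \<Longrightarrow> smul q (y i) \<in> A"
    and \<Lambda>: "finite \<Lambda>" and e: "\<And>l. l \<in> \<Lambda> \<Longrightarrow> e l \<in> Q" "\<And>l. l \<in> \<Lambda> \<Longrightarrow> e l \<star> e l = e l"
    and Q_span: "\<And>q. q \<in> Q \<Longrightarrow> \<exists>c. (\<forall>l\<in>\<Lambda>. c l \<in> R) \<and> q = (\<Sum>l\<in>\<Lambda>. c l \<star> e l)"
    and Q_indep: "\<And>c l. (\<And>l. l \<in> \<Lambda> \<Longrightarrow> c l \<in> R \<and> c l \<star> e l = c l) \<Longrightarrow> (\<Sum>l\<in>\<Lambda>. c l) = 0 \<Longrightarrow>
       l \<in> \<Lambda> \<Longrightarrow> c l = 0"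
  shows "fp n B"
proof (cases n)
  case (Suc m)
  interpret B: module_on R mul one B smul by fact
  interpret A: module_on R mul one A smul by fact
  obtain J \<epsilon> x where cov: "covers A smul J \<epsilon> x" and fp: "fp m (syz smul J \<epsilon> x)"
    using A(3) Suc by auto
  note D = coversD[OF cov]
  obtain h \<epsilon>' x' where h: "inj_on h I" "J \<inter> h ` I = {}"
    and \<epsilon>': "\<forall>j\<in>J. \<epsilon>' j = \<epsilon> j" "\<forall>i\<in>I. \<epsilon>' (h i) = one"
    and sum: "\<forall>c. (\<Sum>k\<in>J \<union> h ` I. smul (c k) (x' k)) =
          (\<Sum>j\<in>J. smul (c j) (x j)) + (\<Sum>i\<in>I. smul (c (h i)) (y i))"
    and cov': "covers B smul (J \<union> h ` I) \<epsilon>' x'"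
    and syz: "syz smul J \<epsilon> x = {c \<in> syz smul (J \<union> h ` I) \<epsilon>' x'. \<forall>i\<in>I. c (h i) = 0}"
    by (rule covers_join[OF B A(1) cov I, where \<eta> = "\<lambda>_. one", OF _ _ y _ span])
      (assumption | rule that | simp add: y)+
  let ?K = "syz smul J \<epsilon> x" and ?K' = "syz smul (J \<union> h ` I) \<epsilon>' x'"
  interpret K': module_on R mul one ?K' smul
    by (rule lmod_syz[OF B cov'])
  have hJ: "h i \<notin> J" if "i \<in> I" for i
    using h(2) that by blast
  \<comment> \<open>Modulo \<open>A\<close> only the scalar parts of the coefficients matter, and the \<open>y i\<close> are independent
    over the scalars.\<close>
  have in_Q: "c (h i) \<in> Q" if c: "c \<in> ?K'" and i: "i \<in> I" for c i
  proof -
    have "\<forall>i. \<exists>\<nu> q. i \<in> I \<longrightarrow> \<nu> \<in> N \<and> q \<in> Q \<and> c (h i) = \<nu> + q"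
      using decomp c unfolding syz_def by blast
    then obtain \<nu> q where \<nu>q: "\<And>i. i \<in> I \<Longrightarrow> \<nu> i \<in> N" "\<And>i. i \<in> I \<Longrightarrow> q i \<in> Q"
      "\<And>i. i \<in> I \<Longrightarrow> c (h i) = \<nu> i + q i"
      by metis
    have "(\<Sum>i\<in>I. smul (c (h i)) (y i)) = (\<Sum>i\<in>I. smul (\<nu> i) (y i)) + (\<Sum>i\<in>I. smul (q i) (y i))"
      unfolding sum.distrib[symmetric]
      by (rule sum.cong) (use \<nu>q Q N y in \<open>auto simp: B.add_act subset_iff\<close>)
    moreover have "(\<Sum>j\<in>J. smul (c j) (x j)) + (\<Sum>i\<in>I. smul (c (h i)) (y i)) = 0"
      using c sum[rule_format, of c, symmetric] by (simp add: syz_def)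
    ultimately have "(\<Sum>i\<in>I. smul (\<nu> i) (y i)) =
        - (\<Sum>j\<in>J. smul (c j) (x j)) - (\<Sum>i\<in>I. smul (q i) (y i))"
      by (simp add: eq_diff_eq eq_neg_iff_add_eq_0 algebra_simps)
    moreover have "(\<Sum>j\<in>J. smul (c j) (x j)) \<in> A"
      using c D by (intro A.sum_memM) (auto simp: syz_def)
    moreover have "(\<Sum>i\<in>I. smul (q i) (y i)) \<in> A"
      using null \<nu>q by (intro A.sum_memM) auto
    ultimately have "\<nu> i = 0"
      using indep[of \<nu> i] \<nu>q(1) i by auto
    then show ?thesis
      using \<nu>q i by simp
  qed
  \<comment> \<open>The splitting: \<open>e l\<close> in the coordinate of \<open>y i\<close> is completed to a syzygy by writing
    \<open>e l\<close> times \<open>y i\<close> in the generators of \<open>A\<close>; multiplying by \<open>e l\<close> once more makes it fixed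
    by \<open>e l\<close>.\<close>
  have "\<exists>z. z \<in> ?K' \<and> smul (e l) z = z \<and> z (h i) = e l \<and> (\<forall>i'\<in>I - {i}. z (h i') = 0)"
    if l: "l \<in> \<Lambda>" and i: "i \<in> I" for l i
  proof -
    have eR: "e l \<in> R"
      using e(1) l Q by auto
    obtain c where c: "\<And>j. c j \<in> R" "\<And>j. j \<notin> J \<Longrightarrow> c j = 0" "\<And>j. j \<in> J \<Longrightarrow> c j \<star> \<epsilon> j = c j"
      "smul (e l) (y i) = (\<Sum>j\<in>J. smul (c j) (x j))"
      using covers_coeffs[OF cov A(2) null[OF e(1)[OF l] i]] by metis
    define z where "z k = (if k = h i then e l else - (e l \<star> c k))" for k
    have z0: "z (h i') = 0" if "i' \<in> I - {i}" for i'
      using that c(2)[of "h i'"] hJ h(1) i eR by (auto simp: z_def inj_on_def)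
    have "(\<Sum>j\<in>J. smul (z j) (x j)) = (\<Sum>j\<in>J. - smul (e l) (smul (c j) (x j)))"
      by (rule sum.cong)
        (use c(1) eR D hJ i in \<open>auto simp: z_def A.uminus_act A.mul_act\<close>)
    also have "\<dots> = - smul (e l) (smul (e l) (y i))"
      unfolding c(4) sum_negf using c(1) eR D by (subst A.act_sum) auto
    also have "\<dots> = - smul (e l) (y i)"
      using eR y[OF i] e(2)[OF l] by (simp add: B.mul_act[symmetric])
    finally have s1: "(\<Sum>j\<in>J. smul (z j) (x j)) = - smul (e l) (y i)" .
    have "(\<Sum>i'\<in>I. smul (z (h i')) (y i')) = (\<Sum>i'\<in>I. if i' = i then smul (e l) (y i) else 0)"
      by (rule sum.cong) (use z0 y in \<open>auto simp: z_def\<close>)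
    then have s2: "(\<Sum>i'\<in>I. smul (z (h i')) (y i')) = smul (e l) (y i)"
      using I i by simp
    have "z \<in> ?K'"
      unfolding syz_def mem_Collect_eq
    proof (intro conjI allI ballI impI)
      fix k
      show zR: "z k \<in> R"
        using c(1) eR by (simp add: z_def)
      show "z k = 0" if "k \<notin> J \<union> h ` I"
        using that c(2)[of k] eR i by (auto simp: z_def)
      show "z k \<star> \<epsilon>' k = z k" if "k \<in> J \<union> h ` I"
      proof (cases "k \<in> J")
        case True
        then show ?thesis
          using c(1)[of k] c(3)[of k] eR i hJ D(2)[OF True]
          by (auto simp: z_def \<epsilon>' reg.uminus_act mul_assoc)
      next
        case False
        then show ?thesis
          using that zR by (auto simp: \<epsilon>')
      qed
    qed (simp add: sum s1 s2)
    moreover have "smul (e l) z = z"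
      using e(2)[OF l] eR c(1)
      by (auto simp: smul_def z_def fun_eq_iff reg.act_uminus mul_assoc[symmetric])
    ultimately show ?thesis
      using z0 by (intro exI[of _ z]) (auto simp: z_def)
  qed
  then have "\<forall>p. \<exists>z. p \<in> \<Lambda> \<times> I \<longrightarrow> z \<in> ?K' \<and> smul (e (fst p)) z = z \<and> z (h (snd p)) = e (fst p) \<and>
      (\<forall>i'\<in>I - {snd p}. z (h i') = 0)"
    by (auto simp: mem_Times_iff)
  then obtain z where z: "\<And>p. p \<in> \<Lambda> \<times> I \<Longrightarrow> z p \<in> ?K'"
    "\<And>p. p \<in> \<Lambda> \<times> I \<Longrightarrow> smul (e (fst p)) (z p) = z p"
    "\<And>p. p \<in> \<Lambda> \<times> I \<Longrightarrow> z p (h (snd p)) = e (fst p)"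
    "\<And>p i'. p \<in> \<Lambda> \<times> I \<Longrightarrow> i' \<in> I - {snd p} \<Longrightarrow> z p (h i') = 0"
    by metis
  have z_h: "(\<Sum>p\<in>\<Lambda> \<times> I. smul (c p) (z p)) (h i) = (\<Sum>l\<in>\<Lambda>. c (l, i) \<star> e l)"
    if c: "\<And>p. p \<in> \<Lambda> \<times> I \<Longrightarrow> c p \<in> R" and i: "i \<in> I" for c i
  proof -
    have "(\<Sum>p\<in>\<Lambda> \<times> I. smul (c p) (z p)) (h i) = (\<Sum>p\<in>\<Lambda> \<times> I. c p \<star> z p (h i))"
      by (simp add: sum_fun_apply smul_def)
    also have "\<dots> = (\<Sum>l\<in>\<Lambda>. \<Sum>i'\<in>I. c (l, i') \<star> z (l, i') (h i))"
      by (subst sum.cartesian_product) (simp add: case_prod_unfold)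
    also have "\<dots> = (\<Sum>l\<in>\<Lambda>. \<Sum>i'\<in>I. if i' = i then c (l, i) \<star> e l else 0)"
      by (intro sum.cong refl) (use z(3,4) c i in auto)
    finally show ?thesis
      using I i by simp
  qed
  have "fp m ?K'"
  proof (rule fp_add_projective[OF K'.module_on_axioms _ lmod_syz[OF A(2) cov] fp,
        where L = "\<Lambda> \<times> I" and \<eta> = "\<lambda>p. e (fst p)" and z = z])
    fix b assume b: "b \<in> ?K'"
    have "\<forall>i. \<exists>c. i \<in> I \<longrightarrow> (\<forall>l\<in>\<Lambda>. c l \<in> R) \<and> b (h i) = (\<Sum>l\<in>\<Lambda>. c l \<star> e l)"
      using Q_span in_Q[OF b] by blast
    then obtain c where c: "\<And>i l. i \<in> I \<Longrightarrow> l \<in> \<Lambda> \<Longrightarrow> c i l \<in> R"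
      "\<And>i. i \<in> I \<Longrightarrow> b (h i) = (\<Sum>l\<in>\<Lambda>. c i l \<star> e l)"
      by metis
    define c' where "c' p = c (snd p) (fst p)" for p
    have c': "c' p \<in> R" if "p \<in> \<Lambda> \<times> I" for p
      using c(1) that by (auto simp: c'_def)
    let ?a = "b - (\<Sum>p\<in>\<Lambda> \<times> I. smul (c' p) (z p))"
    have "?a \<in> ?K'"
      using b c' z(1) by (intro K'.diff_memM K'.sum_memM) auto
    moreover have "?a (h i) = 0" if "i \<in> I" for i
      using z_h[OF c' that] c(2)[OF that] by (simp add: c'_def)
    ultimately have "?a \<in> ?K"
      unfolding syz by blast
    then show "\<exists>a\<in>?K. \<exists>c. (\<forall>p\<in>\<Lambda> \<times> I. c p \<in> R) \<and> b = a + (\<Sum>p\<in>\<Lambda> \<times> I. smul (c p) (z p))"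
      using c' by (intro bexI[of _ ?a] exI[of _ c']) auto
  next
    fix a c p
    assume a: "a \<in> ?K" and c: "\<And>p. p \<in> \<Lambda> \<times> I \<Longrightarrow> c p \<in> R \<and> c p \<star> e (fst p) = c p"
      and s: "a + (\<Sum>p\<in>\<Lambda> \<times> I. smul (c p) (z p)) = 0" and p: "p \<in> \<Lambda> \<times> I"
    obtain l i where li: "p = (l, i)" "l \<in> \<Lambda>" "i \<in> I"
      using p by auto
    have "(\<Sum>p\<in>\<Lambda> \<times> I. smul (c p) (z p)) (h i) = 0"
      using fun_cong[OF s, of "h i"] a li(3) unfolding syz by simp
    then have "(\<Sum>l\<in>\<Lambda>. c (l, i)) = 0"
      using z_h[of c i] c li(3) by auto
    then show "c p = 0"
      unfolding li(1) by (rule Q_indep[rotated]) (use c li in auto)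
  qed (use I \<Lambda> e Q z syz in auto)
  then show ?thesis
    using cov' Suc by auto
qed simp

end

section \<open>Passing between a ring and a corner\<close>

text \<open>The homomorphism \<open>\<iota>\<close> need not preserve units: \<open>e\<close> is merely an idempotent of \<open>R\<close>. The example to
  keep in mind is the inclusion of the corner \<open>eRe\<close>.\<close>

locale ring_corner = R: ring_on R mul one + T: ring_on T mulT oneT
  for R :: "'r::ab_group_add set" and mul (infixl "\<star>" 70) and one :: 'r
    and T :: "'t::ab_group_add set" and mulT (infixl "\<bullet>" 70) and oneT :: 't +
  fixes \<iota> :: "'t \<Rightarrow> 'r"
  assumes \<iota>_mem [simp, intro]: "t \<in> T \<Longrightarrow> \<iota> t \<in> R"
    and \<iota>_add: "s \<in> T \<Longrightarrow> t \<in> T \<Longrightarrow> \<iota> (s + t) = \<iota> s + \<iota> t"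
    and \<iota>_mul: "s \<in> T \<Longrightarrow> t \<in> T \<Longrightarrow> \<iota> (s \<bullet> t) = \<iota> s \<star> \<iota> t"
begin

abbreviation e :: 'r where
  "e \<equiv> \<iota> oneT"

lemma \<iota>_zero [simp]: "\<iota> 0 = 0"
  using \<iota>_add[of 0 0] by simp

lemma \<iota>_uminus: "t \<in> T \<Longrightarrow> \<iota> (- t) = - \<iota> t"
  using \<iota>_add[of t "- t"] by (simp add: add_eq_0_iff)

lemma \<iota>_diff: "s \<in> T \<Longrightarrow> t \<in> T \<Longrightarrow> \<iota> (s - t) = \<iota> s - \<iota> t"
  using \<iota>_add[of s "- t"] by (simp add: \<iota>_uminus)

lemma e_\<iota> [simp]: "t \<in> T \<Longrightarrow> e \<star> \<iota> t = \<iota> t" "t \<in> T \<Longrightarrow> \<iota> t \<star> e = \<iota> t"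
  by (simp_all flip: \<iota>_mul)

end

text \<open>Here \<open>eR\<close> is a free left \<open>T\<close>-module on the \<open>u l\<close>.\<close>

locale left_free_corner = ring_corner +
  fixes \<Lambda> :: "nat set" and u :: "nat \<Rightarrow> 'a"
  assumes finite_\<Lambda>: "finite \<Lambda>"
    and u_mem [simp, intro]: "l \<in> \<Lambda> \<Longrightarrow> u l \<in> R"
    and e_u [simp]: "l \<in> \<Lambda> \<Longrightarrow> e \<star> u l = u l"
    and u_span: "a \<in> R \<Longrightarrow> e \<star> a = a \<Longrightarrow> \<exists>t. (\<forall>l\<in>\<Lambda>. t l \<in> T) \<and> a = (\<Sum>l\<in>\<Lambda>. \<iota> (t l) \<star> u l)"
    and u_indep: "(\<And>l. l \<in> \<Lambda> \<Longrightarrow> t l \<in> T) \<Longrightarrow> (\<Sum>l\<in>\<Lambda>. \<iota> (t l) \<star> u l) = 0 \<Longrightarrow> l \<in> \<Lambda> \<Longrightarrow> t l = 0"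
begin

text \<open>An isomorphism of the \<open>T\<close>-module \<open>M'\<close> with \<open>eM\<close>.\<close>

definition restricts ::
  "('m \<Rightarrow> 'n) \<Rightarrow> 'm::ab_group_add set \<Rightarrow> ('b \<Rightarrow> 'm \<Rightarrow> 'm) \<Rightarrow>
   'n::ab_group_add set \<Rightarrow> ('a \<Rightarrow> 'n \<Rightarrow> 'n) \<Rightarrow> bool" where
  "restricts \<psi> M' act' M act \<longleftrightarrow>
     (\<forall>x\<in>M'. \<forall>y\<in>M'. \<psi> (x + y) = \<psi> x + \<psi> y) \<and>
     (\<forall>t\<in>T. \<forall>x\<in>M'. \<psi> (act' t x) = act (\<iota> t) (\<psi> x)) \<and>
     inj_on \<psi> M' \<and> \<psi> ` M' = {m \<in> M. act e m = m}"

text \<open>If the \<open>x j\<close> generate \<open>M\<close> over \<open>R\<close>, then the \<open>u l \<rhd> x j\<close> generate \<open>eM\<close> over \<open>T\<close>, and the map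
  \<open>\<Psi>\<close>, which collects the coefficients of a \<open>T\<close>-combination into coefficients in \<open>eR\<close>,
  identifies the new syzygies with \<open>e\<close> times the old ones. The coefficients must range over all of
  \<open>R\<close> here: for an idempotent \<open>\<epsilon>\<close> the \<open>T\<close>-module \<open>eR\<epsilon>\<close> need not be free. One step of the recursion
  is stated on its own because \<open>M\<close> and \<open>M'\<close> may have any type.\<close>

lemma type_FP_restrict_step:
  assumes IH: "\<And>K K' \<psi>. R.fp n K \<Longrightarrow> R.lmod K R.smul \<Longrightarrow> T.lmod K' T.smul \<Longrightarrow>
      restricts \<psi> K' T.smul K R.smul \<Longrightarrow> T.fp n K'"
    and M: "R.lmod M act" and M': "T.lmod M' act'" and \<psi>: "restricts \<psi> M' act' M act"
    and FP: "R.type_FP n M act"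
  shows "T.type_FP n M' act'"
proof -
  interpret M: module_on R mul one M act by fact
  interpret M': module_on T mulT oneT M' act' by fact
  have \<psi>_add: "\<And>x y. x \<in> M' \<Longrightarrow> y \<in> M' \<Longrightarrow> \<psi> (x + y) = \<psi> x + \<psi> y"
    and \<psi>_act: "\<And>t x. t \<in> T \<Longrightarrow> x \<in> M' \<Longrightarrow> \<psi> (act' t x) = act (\<iota> t) (\<psi> x)"
    and \<psi>_inj: "inj_on \<psi> M'" and \<psi>_img: "\<psi> ` M' = {m \<in> M. act e m = m}"
    using \<psi> by (auto simp: restricts_def)
  obtain J x where cov: "R.free_covers M act J x" and fp: "R.fp n (R.free_syz act J x)"
    using R.type_FP_free_cover[OF M FP] .
  note D = R.coversD[OF cov]
  define J' where "J' = prod_encode ` (J \<times> \<Lambda>)"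
  define y where "y k = inv_into M' \<psi> (act (u (snd (prod_decode k))) (x (fst (prod_decode k))))" for k
  define \<Psi> where "\<Psi> c j = (if j \<in> J then \<Sum>l\<in>\<Lambda>. \<iota> (c (prod_encode (j, l))) \<star> u l else 0)" for c j
  have J'I: "prod_encode (j, l) \<in> J'" if "j \<in> J" "l \<in> \<Lambda>" for j l
    using that by (auto simp: J'_def)
  have y: "y (prod_encode (j, l)) \<in> M'" "\<psi> (y (prod_encode (j, l))) = act (u l) (x j)"
    if "j \<in> J" "l \<in> \<Lambda>" for j l
  proof -
    have "act (u l) (x j) \<in> \<psi> ` M'"
      unfolding \<psi>_img using that D by (simp flip: M.mul_act)
    then show "y (prod_encode (j, l)) \<in> M'" "\<psi> (y (prod_encode (j, l))) = act (u l) (x j)"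
      by (simp_all add: y_def inv_into_into f_inv_into_f)
  qed
  have sum_J': "(\<Sum>k\<in>J'. F k) = (\<Sum>j\<in>J. \<Sum>l\<in>\<Lambda>. F (prod_encode (j, l)))" for F :: "nat \<Rightarrow> 'z::comm_monoid_add"
    unfolding J'_def
    by (simp add: sum.reindex inj_prod_encode sum.cartesian_product case_prod_unfold)
  have \<Psi>_mem: "\<Psi> c j \<in> R" if "\<And>k. k \<in> J' \<Longrightarrow> c k \<in> T" for c j
    unfolding \<Psi>_def using that J'I by (auto intro!: R.reg.sum_memM)
  have \<psi>_comb: "\<psi> (\<Sum>k\<in>J'. act' (c k) (y k)) = (\<Sum>j\<in>J. act (\<Psi> c j) (x j))"
    if c: "\<And>k. k \<in> J' \<Longrightarrow> c k \<in> T" for c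
  proof -
    have "\<psi> (\<Sum>k\<in>J'. act' (c k) (y k)) = (\<Sum>k\<in>J'. \<psi> (act' (c k) (y k)))"
      using \<psi>_add c y by (intro M'.hom_sum) (auto simp: J'_def)
    also have "\<dots> = (\<Sum>j\<in>J. \<Sum>l\<in>\<Lambda>. act (\<iota> (c (prod_encode (j, l))) \<star> u l) (x j))"
      unfolding sum_J' by (intro sum.cong refl) (use c y J'I D in \<open>auto simp: \<psi>_act M.mul_act\<close>)
    also have "\<dots> = (\<Sum>j\<in>J. act (\<Psi> c j) (x j))"
    proof (rule sum.cong)
      fix j assume "j \<in> J"
      then show "(\<Sum>l\<in>\<Lambda>. act (\<iota> (c (prod_encode (j, l))) \<star> u l) (x j)) = act (\<Psi> c j) (x j)"
        unfolding \<Psi>_def using c J'I D by (simp add: M.sum_act)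
    qed simp
    finally show ?thesis .
  qed
  have comb_mem: "(\<Sum>k\<in>J'. act' (c k) (y k)) \<in> M'" if "\<And>k. k \<in> J' \<Longrightarrow> c k \<in> T" for c
    using that y by (intro M'.sum_memM) (auto simp: J'_def)
  have \<Psi>_onto: "\<exists>c. (\<forall>k. c k \<in> T) \<and> (\<forall>k. k \<notin> J' \<longrightarrow> c k = 0) \<and> (\<forall>j\<in>J. \<Psi> c j = a j)"
    if a: "\<And>j. j \<in> J \<Longrightarrow> a j \<in> R" "\<And>j. j \<in> J \<Longrightarrow> e \<star> a j = a j" for a
  proof -
    have "\<forall>j. \<exists>t. j \<in> J \<longrightarrow> (\<forall>l\<in>\<Lambda>. t l \<in> T) \<and> a j = (\<Sum>l\<in>\<Lambda>. \<iota> (t l) \<star> u l)"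
      using u_span a by blast
    then obtain t where t: "\<And>j l. j \<in> J \<Longrightarrow> l \<in> \<Lambda> \<Longrightarrow> t j l \<in> T"
      "\<And>j. j \<in> J \<Longrightarrow> a j = (\<Sum>l\<in>\<Lambda>. \<iota> (t j l) \<star> u l)"
      by metis
    define c where "c k = (if k \<in> J' then t (fst (prod_decode k)) (snd (prod_decode k)) else 0)" for k
    show ?thesis
    proof (intro exI[of _ c] conjI)
      show "\<forall>k. c k \<in> T"
        using t(1) by (auto simp: c_def J'_def)
      show "\<forall>j\<in>J. \<Psi> c j = a j"
        using J'I t(2) by (auto simp: \<Psi>_def c_def)
    qed (simp add: c_def)
  qed
  have cov': "T.free_covers M' act' J' y"
    unfolding T.covers_def
  proof (intro conjI ballI)
    show "finite J'"
      using D(1) finite_\<Lambda> by (simp add: J'_def)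
  next
    fix k assume "k \<in> J'"
    then show "y k \<in> M'" "act' oneT (y k) = y k"
      using y by (auto simp: J'_def)
  next
    fix m assume m: "m \<in> M'"
    then have em: "\<psi> m \<in> M" "act e (\<psi> m) = \<psi> m"
      using \<psi>_img by blast+
    obtain a where a: "\<And>j. a j \<in> R" "\<psi> m = (\<Sum>j\<in>J. act (a j) (x j))"
      using R.covers_coeffs[OF cov M em(1)] by metis
    have "e \<star> (e \<star> a j) = e \<star> a j" for j
      using a by (simp flip: R.mul_assoc)
    then have "\<exists>c. (\<forall>k. c k \<in> T) \<and> (\<forall>k. k \<notin> J' \<longrightarrow> c k = 0) \<and> (\<forall>j\<in>J. \<Psi> c j = e \<star> a j)"
      using a(1) by (intro \<Psi>_onto) auto
    then obtain c where c: "\<And>k. c k \<in> T" "\<And>j. j \<in> J \<Longrightarrow> \<Psi> c j = e \<star> a j"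
      by metis
    have "\<psi> m = act e (\<Sum>j\<in>J. act (a j) (x j))"
      using em(2) a(2) by simp
    also have "\<dots> = (\<Sum>j\<in>J. act e (act (a j) (x j)))"
      using a D by (intro M.act_sum) auto
    also have "\<dots> = (\<Sum>j\<in>J. act (\<Psi> c j) (x j))"
      using a D c by (intro sum.cong refl) (simp add: M.mul_act)
    also have "\<dots> = \<psi> (\<Sum>k\<in>J'. act' (c k) (y k))"
      using \<psi>_comb c(1) by simp
    finally have "m = (\<Sum>k\<in>J'. act' (c k) (y k))"
      by (rule inj_onD[OF \<psi>_inj]) (intro m comb_mem c(1))+
    with c(1) show "\<exists>c. (\<forall>k\<in>J'. c k \<in> T) \<and> m = (\<Sum>k\<in>J'. act' (c k) (y k))"
      by (intro exI[of _ c]) simp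
  qed auto
  let ?K = "R.free_syz act J x" and ?K' = "T.free_syz act' J' y"
  have K'T: "c k \<in> T" if "c \<in> ?K'" for c k
    using that by (auto simp: T.syz_def)
  have "restricts \<Psi> ?K' T.smul ?K R.smul"
    unfolding restricts_def
  proof (intro conjI ballI)
    fix c d assume "c \<in> ?K'" "d \<in> ?K'"
    then show "\<Psi> (c + d) = \<Psi> c + \<Psi> d"
      using K'T by (auto simp: \<Psi>_def fun_eq_iff \<iota>_add R.add_mul sum.distrib)
  next
    fix t c assume "t \<in> T" "c \<in> ?K'"
    then show "\<Psi> (T.smul t c) = R.smul (\<iota> t) (\<Psi> c)"
      using K'T by (auto simp: \<Psi>_def fun_eq_iff T.smul_def R.smul_def \<iota>_mul R.reg.act_sum R.mul_assoc)
  next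
    show "inj_on \<Psi> ?K'"
    proof (rule inj_onI)
      fix c d assume cd: "c \<in> ?K'" "d \<in> ?K'" and eq: "\<Psi> c = \<Psi> d"
      have "c (prod_encode (j, l)) = d (prod_encode (j, l))" if "j \<in> J" "l \<in> \<Lambda>" for j l
      proof -
        have "(\<Sum>l\<in>\<Lambda>. \<iota> (c (prod_encode (j, l)) - d (prod_encode (j, l))) \<star> u l) = \<Psi> c j - \<Psi> d j"
          unfolding sum_subtractf[symmetric] \<Psi>_def using that cd K'T
          by (simp add: \<iota>_diff R.reg.diff_act sum_subtractf)
        then have "c (prod_encode (j, l)) - d (prod_encode (j, l)) = 0"
          using u_indep[of "\<lambda>l. c (prod_encode (j, l)) - d (prod_encode (j, l))" l] that cd K'T eq
          by simp
        then show ?thesis by simp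
      qed
      then have "c k = d k" if "k \<in> J'" for k
        using that by (auto simp: J'_def)
      moreover have "c k = d k" if "k \<notin> J'" for k
        using that cd by (simp add: T.syz_def)
      ultimately show "c = d"
        by blast
    qed
  next
    show "\<Psi> ` ?K' = {k \<in> ?K. R.smul e k = k}"
    proof (intro Set.set_eqI iffI)
      fix k assume "k \<in> \<Psi> ` ?K'"
      then obtain c where c: "c \<in> ?K'" "k = \<Psi> c"
        by auto
      have "\<psi> 0 = 0"
        using \<psi>_add[of 0 0] by simp
      then have "(\<Sum>j\<in>J. act (\<Psi> c j) (x j)) = 0"
        using c(1) \<psi>_comb[of c, OF K'T[OF c(1)]] by (simp add: T.syz_def)
      moreover have "\<forall>j. j \<notin> J \<longrightarrow> \<Psi> c j = 0"
        by (simp add: \<Psi>_def)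
      moreover have "\<Psi> c j \<in> R" for j
        by (rule \<Psi>_mem) (rule K'T[OF c(1)])
      ultimately have "k \<in> ?K"
        unfolding c(2) R.syz_def by simp
      moreover have "e \<star> \<Psi> c j = \<Psi> c j" for j
        unfolding \<Psi>_def using K'T[OF c(1)] by (auto simp: R.reg.act_sum simp flip: R.mul_assoc)
      ultimately show "k \<in> {k \<in> ?K. R.smul e k = k}"
        unfolding c(2) by (simp add: R.smul_def)
    next
      fix k assume "k \<in> {k \<in> ?K. R.smul e k = k}"
      then have k: "k \<in> ?K" "\<And>j. e \<star> k j = k j"
        by (auto simp: R.smul_def fun_eq_iff)
      then have "\<exists>c. (\<forall>i. c i \<in> T) \<and> (\<forall>i. i \<notin> J' \<longrightarrow> c i = 0) \<and> (\<forall>j\<in>J. \<Psi> c j = k j)"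
        by (intro \<Psi>_onto) (auto simp: R.syz_def)
      then obtain c where c: "\<And>i. c i \<in> T" "\<And>i. i \<notin> J' \<Longrightarrow> c i = 0" "\<And>j. j \<in> J \<Longrightarrow> \<Psi> c j = k j"
        by metis
      have "\<psi> (\<Sum>k\<in>J'. act' (c k) (y k)) = \<psi> 0"
        using k(1) c(3) \<psi>_comb[of c, OF c(1)] \<psi>_add[of 0 0] by (simp add: R.syz_def)
      then have "(\<Sum>k\<in>J'. act' (c k) (y k)) = 0"
        by (rule inj_onD[OF \<psi>_inj]) (intro M'.zero_memM comb_mem c(1))+
      then have "c \<in> ?K'"
        using c by (simp add: T.syz_def)
      moreover have "\<Psi> c = k"
        using c(3) k(1) by (auto simp: fun_eq_iff R.syz_def \<Psi>_def)
      ultimately show "k \<in> \<Psi> ` ?K'"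
        by blast
    qed
  qed
  then have "T.fp n ?K'"
    by (rule IH[OF fp R.lmod_syz[OF M cov] T.lmod_syz[OF M' cov']])
  with cov' show ?thesis
    by (auto simp: T.type_FP_def)
qed

lemma fp_restrict:
  "R.fp n K \<Longrightarrow> R.lmod K R.smul \<Longrightarrow> T.lmod K' T.smul \<Longrightarrow> restricts \<psi> K' T.smul K R.smul \<Longrightarrow>
   T.fp n K'"
proof (induction n arbitrary: K K' \<psi>)
  case (Suc n)
  show ?case
    using type_FP_restrict_step[OF Suc.IH Suc.prems(2-4)] Suc.prems(1)
    by (simp add: R.fp_Suc T.fp_Suc del: R.fp.simps T.fp.simps)
qed simp

lemma type_FP_restrict:
  assumes "R.lmod M act" "T.lmod M' act'" "restricts \<psi> M' act' M act" "R.type_FP n M act"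
  shows "T.type_FP n M' act'"
  by (rule type_FP_restrict_step[OF _ assms]) (rule fp_restrict)

end

text \<open>Here \<open>Re\<close> is a free right \<open>T\<close>-module on the \<open>r i\<close>.\<close>

locale right_free_corner = ring_corner +
  fixes I :: "'i set" and r :: "'i \<Rightarrow> 'a"
  assumes finite_I: "finite I"
    and r_mem [simp, intro]: "i \<in> I \<Longrightarrow> r i \<in> R"
    and r_e [simp]: "i \<in> I \<Longrightarrow> r i \<star> e = r i"
    and r_span: "a \<in> R \<Longrightarrow> a \<star> e = a \<Longrightarrow> \<exists>t. (\<forall>i\<in>I. t i \<in> T) \<and> a = (\<Sum>i\<in>I. r i \<star> \<iota> (t i))"
    and r_indep: "(\<And>i. i \<in> I \<Longrightarrow> t i \<in> T) \<Longrightarrow> (\<Sum>i\<in>I. r i \<star> \<iota> (t i)) = 0 \<Longrightarrow> i \<in> I \<Longrightarrow> t i = 0"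
begin

text \<open>\<open>M\<close> is the module induced from \<open>M'\<close>, that is, the tensor product of \<open>Re\<close> with \<open>M'\<close> over \<open>T\<close>. As
  \<open>Re\<close> is free over \<open>T\<close>, this says that \<open>M\<close> is the direct sum of the translates of \<open>M'\<close> by
  the \<open>r i\<close>.\<close>

definition induces ::
  "('m \<Rightarrow> 'n) \<Rightarrow> 'm::ab_group_add set \<Rightarrow> ('b \<Rightarrow> 'm \<Rightarrow> 'm) \<Rightarrow>
   'n::ab_group_add set \<Rightarrow> ('a \<Rightarrow> 'n \<Rightarrow> 'n) \<Rightarrow> bool" where
  "induces \<psi> M' act' M act \<longleftrightarrow>
     (\<forall>x\<in>M'. \<forall>y\<in>M'. \<psi> (x + y) = \<psi> x + \<psi> y) \<and>
     (\<forall>t\<in>T. \<forall>x\<in>M'. \<psi> (act' t x) = act (\<iota> t) (\<psi> x)) \<and>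
     \<psi> ` M' \<subseteq> M \<and>
     (\<forall>m\<in>M. \<exists>m'. (\<forall>i\<in>I. m' i \<in> M') \<and> m = (\<Sum>i\<in>I. act (r i) (\<psi> (m' i)))) \<and>
     (\<forall>m'. (\<forall>i\<in>I. m' i \<in> M') \<longrightarrow> (\<Sum>i\<in>I. act (r i) (\<psi> (m' i))) = 0 \<longrightarrow> (\<forall>i\<in>I. m' i = 0))"

lemma induces_span:
  assumes "induces \<psi> M' act' M act" "m \<in> M"
  shows "\<exists>m'. (\<forall>i\<in>I. m' i \<in> M') \<and> m = (\<Sum>i\<in>I. act (r i) (\<psi> (m' i)))"
  using assms unfolding induces_def by (elim conjE) (rule bspec)

lemma induces_indep:
  assumes "induces \<psi> M' act' M act" "\<forall>i\<in>I. m' i \<in> M'" "(\<Sum>i\<in>I. act (r i) (\<psi> (m' i))) = 0"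
  shows "\<forall>i\<in>I. m' i = 0"
  using assms unfolding induces_def by (elim conjE allE[of _ m']) (drule (1) mp, drule (1) mp)

text \<open>Splitting the coefficients along the \<open>r i\<close> splits a combination of elements of \<open>M'\<close> into
  its translates. This gives generation and, read with the directness of the sum, the
  relations.\<close>

lemma induced_combination:
  assumes M: "R.lmod M act" and M': "T.lmod M' act'" and \<psi>: "induces \<psi> M' act' M act"
    and J: "finite J" and x: "\<And>j. j \<in> J \<Longrightarrow> x j \<in> M'"
    and t: "\<And>i j. i \<in> I \<Longrightarrow> j \<in> J \<Longrightarrow> t i j \<in> T"
    and a: "\<And>j. j \<in> J \<Longrightarrow> a j = (\<Sum>i\<in>I. r i \<star> \<iota> (t i j))"
  shows "(\<Sum>j\<in>J. act (a j) (\<psi> (x j))) = (\<Sum>i\<in>I. act (r i) (\<psi> (\<Sum>j\<in>J. act' (t i j) (x j))))"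
proof -
  interpret M: module_on R mul one M act by fact
  interpret M': module_on T mulT oneT M' act' by fact
  have \<psi>_mem: "\<psi> m \<in> M" if "m \<in> M'" for m
    using \<psi> that by (auto simp: induces_def)
  have "\<psi> (\<Sum>j\<in>J. act' (t i j) (x j)) = (\<Sum>j\<in>J. act (\<iota> (t i j)) (\<psi> (x j)))" if "i \<in> I" for i
  proof -
    have "\<psi> (\<Sum>j\<in>J. act' (t i j) (x j)) = (\<Sum>j\<in>J. \<psi> (act' (t i j) (x j)))"
      by (rule M'.hom_sum) (use \<psi> x t that in \<open>auto simp: induces_def\<close>)
    then show ?thesis
      using \<psi> x t that by (simp add: induces_def)
  qed
  then have "(\<Sum>i\<in>I. act (r i) (\<psi> (\<Sum>j\<in>J. act' (t i j) (x j)))) =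
      (\<Sum>i\<in>I. \<Sum>j\<in>J. act (r i \<star> \<iota> (t i j)) (\<psi> (x j)))"
    using x t \<psi>_mem by (intro sum.cong refl) (simp add: M.act_sum M.mul_act)
  also have "\<dots> = (\<Sum>j\<in>J. act (a j) (\<psi> (x j)))"
    by (subst sum.swap, intro sum.cong refl) (use a x t \<psi>_mem in \<open>simp add: M.sum_act\<close>)
  finally show ?thesis ..
qed

lemma covers_induce:
  assumes M: "R.lmod M act" and M': "T.lmod M' act'" and \<psi>: "induces \<psi> M' act' M act"
    and cov: "T.covers M' act' J \<epsilon> x"
  shows "R.covers M act J (\<lambda>j. \<iota> (\<epsilon> j)) (\<lambda>j. \<psi> (x j))"
  unfolding R.covers_def
proof (intro conjI ballI)
  interpret M: module_on R mul one M act by fact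
  interpret M': module_on T mulT oneT M' act' by fact
  note D = T.coversD[OF cov]
  show "finite J"
    by (rule D)
  show "\<iota> (\<epsilon> j) \<in> R" "\<iota> (\<epsilon> j) \<star> \<iota> (\<epsilon> j) = \<iota> (\<epsilon> j)" "\<psi> (x j) \<in> M" if "j \<in> J" for j
    using \<psi> D(2-4)[OF that] by (auto simp: induces_def simp flip: \<iota>_mul)
  show "act (\<iota> (\<epsilon> j)) (\<psi> (x j)) = \<psi> (x j)" if "j \<in> J" for j
  proof -
    have "\<psi> (act' (\<epsilon> j) (x j)) = act (\<iota> (\<epsilon> j)) (\<psi> (x j))"
      using \<psi> D(2,4)[OF that] by (simp add: induces_def)
    then show ?thesis
      using D(5)[OF that] by simp
  qed
  fix m assume "m \<in> M"
  then obtain m' where m': "\<forall>i\<in>I. m' i \<in> M'" "m = (\<Sum>i\<in>I. act (r i) (\<psi> (m' i)))"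
    using induces_span[OF \<psi>] by metis
  have "\<forall>i. \<exists>t. i \<in> I \<longrightarrow> (\<forall>j\<in>J. t j \<in> T) \<and> m' i = (\<Sum>j\<in>J. act' (t j) (x j))"
    using cov m'(1) unfolding T.covers_def by blast
  then obtain t where t: "\<And>i j. i \<in> I \<Longrightarrow> j \<in> J \<Longrightarrow> t i j \<in> T"
    "\<And>i. i \<in> I \<Longrightarrow> m' i = (\<Sum>j\<in>J. act' (t i j) (x j))"
    by metis
  have "m = (\<Sum>j\<in>J. act (\<Sum>i\<in>I. r i \<star> \<iota> (t i j)) (\<psi> (x j)))"
    using m'(2) t D by (subst induced_combination[OF M M' \<psi>]) auto
  then show "\<exists>c. (\<forall>j\<in>J. c j \<in> R) \<and> m = (\<Sum>j\<in>J. act (c j) (\<psi> (x j)))"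
    using t(1) by (intro exI[of _ "\<lambda>j. \<Sum>i\<in>I. r i \<star> \<iota> (t i j)"]) (auto intro!: R.reg.sum_memM)
qed

text \<open>The components of an element of \<open>R\<epsilon>\<close> lie in \<open>T\<epsilon>\<close>, by uniqueness of components.\<close>

lemma syz_split:
  assumes a: "a \<in> R" "a \<star> \<iota> \<epsilon> = a" and \<epsilon>: "\<epsilon> \<in> T"
  shows "\<exists>t. (\<forall>i\<in>I. t i \<in> T \<and> t i \<bullet> \<epsilon> = t i) \<and> a = (\<Sum>i\<in>I. r i \<star> \<iota> (t i))"
proof -
  have "a \<star> e = a"
    using R.mul_assoc[of a "\<iota> \<epsilon>" e] a \<epsilon> by simp
  then obtain t where t: "\<And>i. i \<in> I \<Longrightarrow> t i \<in> T" "a = (\<Sum>i\<in>I. r i \<star> \<iota> (t i))"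
    using r_span[OF a(1)] by blast
  have "(\<Sum>i\<in>I. r i \<star> \<iota> (t i \<bullet> \<epsilon> - t i)) = (\<Sum>i\<in>I. r i \<star> \<iota> (t i) \<star> \<iota> \<epsilon>) - (\<Sum>i\<in>I. r i \<star> \<iota> (t i))"
    unfolding sum_subtractf[symmetric]
    by (rule sum.cong) (use t \<epsilon> in \<open>auto simp: \<iota>_diff \<iota>_mul R.reg.act_diff R.mul_assoc\<close>)
  also have "(\<Sum>i\<in>I. r i \<star> \<iota> (t i) \<star> \<iota> \<epsilon>) = a \<star> \<iota> \<epsilon>"
    unfolding t(2) by (rule R.reg.sum_act[symmetric]) (use t \<epsilon> in auto)
  finally have "(\<Sum>i\<in>I. r i \<star> \<iota> (t i \<bullet> \<epsilon> - t i)) = 0"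
    using a t by simp
  then have "t i \<bullet> \<epsilon> - t i = 0" if "i \<in> I" for i
    using r_indep[of "\<lambda>i. t i \<bullet> \<epsilon> - t i" i] t \<epsilon> that by auto
  with t show ?thesis
    by (intro exI[of _ t]) auto
qed

lemma syz_split_family:
  assumes k: "k \<in> R.syz act J (\<lambda>j. \<iota> (\<epsilon> j)) x" and \<epsilon>: "\<And>j. j \<in> J \<Longrightarrow> \<epsilon> j \<in> T"
  obtains t where "\<And>i j. i \<in> I \<Longrightarrow> t i j \<in> T" "\<And>i j. j \<notin> J \<Longrightarrow> t i j = 0"
    "\<And>i j. i \<in> I \<Longrightarrow> j \<in> J \<Longrightarrow> t i j \<bullet> \<epsilon> j = t i j" "\<And>j. k j = (\<Sum>i\<in>I. r i \<star> \<iota> (t i j))"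
proof -
  have "\<exists>t. j \<in> J \<longrightarrow> (\<forall>i\<in>I. t i \<in> T \<and> t i \<bullet> \<epsilon> j = t i) \<and> k j = (\<Sum>i\<in>I. r i \<star> \<iota> (t i))" for j
    using k \<epsilon>[of j] syz_split[of "k j" "\<epsilon> j"] by (cases "j \<in> J") (auto simp: R.syz_def)
  then obtain t where t: "\<And>j i. j \<in> J \<Longrightarrow> i \<in> I \<Longrightarrow> t j i \<in> T"
    "\<And>j i. j \<in> J \<Longrightarrow> i \<in> I \<Longrightarrow> t j i \<bullet> \<epsilon> j = t j i"
    "\<And>j. j \<in> J \<Longrightarrow> k j = (\<Sum>i\<in>I. r i \<star> \<iota> (t j i))"
    by metis
  show thesis
  proof (rule that[of "\<lambda>i j. if j \<in> J then t j i else 0"])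
    show "k j = (\<Sum>i\<in>I. r i \<star> \<iota> (if j \<in> J then t j i else 0))" for j
      using t(3)[of j] k by (cases "j \<in> J") (simp_all add: R.syz_def)
  qed (use t in auto)
qed

text \<open>For modules of tuples directness of the sum holds coordinate by coordinate in \<open>Re\<close>; what remains
  is that the components of a tuple in \<open>K\<close> lie in \<open>K'\<close>.\<close>

lemma induces_coefficientwise:
  assumes T: "\<And>c j. c \<in> K' \<Longrightarrow> c j \<in> T" and K: "\<And>c. c \<in> K' \<Longrightarrow> (\<lambda>j. \<iota> (c j)) \<in> K"
    and split: "\<And>k. k \<in> K \<Longrightarrow> \<exists>m'. (\<forall>i\<in>I. m' i \<in> K') \<and> (\<forall>j. k j = (\<Sum>i\<in>I. r i \<star> \<iota> (m' i j)))"
  shows "induces (\<lambda>c j. \<iota> (c j)) K' T.smul K R.smul"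
  unfolding induces_def
proof (intro conjI ballI allI impI subsetI)
  fix c d assume "c \<in> K'" "d \<in> K'"
  then show "(\<lambda>j. \<iota> ((c + d) j)) = (\<lambda>j. \<iota> (c j)) + (\<lambda>j. \<iota> (d j))"
    using T by (auto simp: fun_eq_iff \<iota>_add)
next
  fix t c assume "t \<in> T" "c \<in> K'"
  then show "(\<lambda>j. \<iota> (T.smul t c j)) = R.smul (\<iota> t) (\<lambda>j. \<iota> (c j))"
    using T by (auto simp: fun_eq_iff T.smul_def R.smul_def \<iota>_mul)
next
  fix k assume "k \<in> K"
  then obtain m' where m': "\<forall>i\<in>I. m' i \<in> K'" "\<forall>j. k j = (\<Sum>i\<in>I. r i \<star> \<iota> (m' i j))"
    using split by metis
  have "k = (\<Sum>i\<in>I. R.smul (r i) (\<lambda>j. \<iota> (m' i j)))"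
    by (rule ext) (simp add: m'(2) sum_fun_apply R.smul_def)
  with m'(1) show "\<exists>m'. (\<forall>i\<in>I. m' i \<in> K') \<and> k = (\<Sum>i\<in>I. R.smul (r i) (\<lambda>j. \<iota> (m' i j)))"
    by (intro exI[of _ m'] conjI)
next
  fix m' i
  assume m': "\<forall>i\<in>I. m' i \<in> K'" "(\<Sum>i\<in>I. R.smul (r i) (\<lambda>j. \<iota> (m' i j))) = 0" and i: "i \<in> I"
  have "m' i j = 0" for j
  proof (rule r_indep[of "\<lambda>i. m' i j"])
    show "(\<Sum>i\<in>I. r i \<star> \<iota> (m' i j)) = 0"
      using fun_cong[OF m'(2), of j] by (simp add: sum_fun_apply R.smul_def)
  qed (use m'(1) T i in auto)
  then show "m' i = 0"
    by (simp add: fun_eq_iff)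
qed (use K in auto)

text \<open>Induction is exact: the generators of \<open>M'\<close> also generate \<open>M\<close>, with the same idempotents, and
  the syzygies over \<open>R\<close> are induced from those over \<open>T\<close>.\<close>

lemma syz_induce:
  assumes M: "R.lmod M act" and M': "T.lmod M' act'" and \<psi>: "induces \<psi> M' act' M act"
    and cov: "T.covers M' act' J \<epsilon> x"
  shows "induces (\<lambda>c j. \<iota> (c j)) (T.syz act' J \<epsilon> x) T.smul
    (R.syz act J (\<lambda>j. \<iota> (\<epsilon> j)) (\<lambda>j. \<psi> (x j))) R.smul"
    (is "induces ?\<iota> ?K' _ ?K _")
proof (rule induces_coefficientwise)
  interpret M: module_on R mul one M act by fact
  interpret M': module_on T mulT oneT M' act' by fact
  note D = T.coversD[OF cov]
  have \<psi>0: "\<psi> 0 = 0"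
    using \<psi> M'.zero_memM unfolding induces_def by (metis add_cancel_right_right)
  show K'T: "c j \<in> T" if "c \<in> ?K'" for c j
    using that by (auto simp: T.syz_def)
  show "(\<lambda>j. \<iota> (c j)) \<in> ?K" if c: "c \<in> ?K'" for c
  proof -
    have "(\<Sum>j\<in>J. act (\<iota> (c j)) (\<psi> (x j))) = (\<Sum>j\<in>J. \<psi> (act' (c j) (x j)))"
      using \<psi> K'T[OF c] D by (intro sum.cong refl) (auto simp: induces_def)
    also have "\<dots> = \<psi> (\<Sum>j\<in>J. act' (c j) (x j))"
      by (rule M'.hom_sum[symmetric]) (use \<psi> K'T[OF c] D in \<open>auto simp: induces_def\<close>)
    also have "\<dots> = 0"
      using c \<psi>0 by (simp add: T.syz_def)
    finally show ?thesis
      using c D by (auto simp: R.syz_def T.syz_def simp flip: \<iota>_mul)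
  qed
  fix k assume k: "k \<in> ?K"
  obtain t where t: "\<And>i j. i \<in> I \<Longrightarrow> t i j \<in> T" "\<And>i j. j \<notin> J \<Longrightarrow> t i j = 0"
    "\<And>i j. i \<in> I \<Longrightarrow> j \<in> J \<Longrightarrow> t i j \<bullet> \<epsilon> j = t i j" "\<And>j. k j = (\<Sum>i\<in>I. r i \<star> \<iota> (t i j))"
    by (rule syz_split_family[OF k D(2)]) (assumption, rule that)
  have "(\<Sum>i\<in>I. act (r i) (\<psi> (\<Sum>j\<in>J. act' (t i j) (x j)))) = (\<Sum>j\<in>J. act (k j) (\<psi> (x j)))"
    using t(1,4) D by (intro induced_combination[OF M M' \<psi>, symmetric]) auto
  also have "\<dots> = 0"
    using k by (simp add: R.syz_def)
  finally have s: "(\<Sum>i\<in>I. act (r i) (\<psi> (\<Sum>j\<in>J. act' (t i j) (x j)))) = 0" .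
  have "(\<Sum>j\<in>J. act' (t i j) (x j)) \<in> M'" if "i \<in> I" for i
    using t(1)[OF that] D by (intro M'.sum_memM) auto
  then have "\<forall>i\<in>I. (\<Sum>j\<in>J. act' (t i j) (x j)) = 0"
    by (intro induces_indep[OF \<psi> _ s]) blast
  then have "\<forall>i\<in>I. t i \<in> ?K'"
    using t(1-3) by (simp add: T.syz_def)
  with t(4) show "\<exists>m'. (\<forall>i\<in>I. m' i \<in> ?K') \<and> (\<forall>j. k j = (\<Sum>i\<in>I. r i \<star> \<iota> (m' i j)))"
    by (intro exI[of _ t] conjI allI)
qed

lemma fp_induce:
  "T.fp n K' \<Longrightarrow> T.lmod K' T.smul \<Longrightarrow> R.lmod K R.smul \<Longrightarrow> induces \<psi> K' T.smul K R.smul \<Longrightarrow>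
   R.fp n K"
proof (induction n arbitrary: K K' \<psi>)
  case (Suc n)
  obtain J \<epsilon> x where cov: "T.covers K' T.smul J \<epsilon> x" and fp: "T.fp n (T.syz T.smul J \<epsilon> x)"
    using Suc.prems(1) by auto
  note cov' = covers_induce[OF Suc.prems(3,2,4) cov]
  show ?case
    using cov' Suc.IH[OF fp T.lmod_syz[OF Suc.prems(2) cov] R.lmod_syz[OF Suc.prems(3) cov']
        syz_induce[OF Suc.prems(3,2,4) cov]]
    by auto
qed simp

end

section \<open>The trivial module of an augmented ring\<close>

text \<open>In the intended case \<open>R\<close> is the sum of the scalars \<open>N\<close>, a copy of the integers, and of an ideal
  \<open>Q\<close>, which is the direct sum of the projective modules \<open>R(p l)\<close>. The number \<open>wt i a\<close> is the augmentation of the \<open>i\<close>-th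
  component of \<open>a \<in> Re\<close>. The axiom on \<open>Q\<close> says that left multiplication by an element of \<open>Q\<close>
  distributes the total augmentation over the components without regard to where it came from.\<close>

locale augmented_corner = right_free_corner +
  fixes augR :: "'a \<Rightarrow> int" and augT :: "'b \<Rightarrow> int" and wt :: "'c \<Rightarrow> 'a \<Rightarrow> int"
    and N Q :: "'a set" and P :: "'p set" and p :: "'p \<Rightarrow> 'a"
  assumes augR_add: "a \<in> R \<Longrightarrow> b \<in> R \<Longrightarrow> augR (a + b) = augR a + augR b"
    and augR_mul: "a \<in> R \<Longrightarrow> b \<in> R \<Longrightarrow> augR (a \<star> b) = augR a * augR b"
    and augR_one [simp]: "augR one = 1"
    and augT_add: "s \<in> T \<Longrightarrow> t \<in> T \<Longrightarrow> augT (s + t) = augT s + augT t"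
    and augT_mul: "s \<in> T \<Longrightarrow> t \<in> T \<Longrightarrow> augT (s \<bullet> t) = augT s * augT t"
    and augT_one [simp]: "augT oneT = 1"
    and augR_\<iota> [simp]: "t \<in> T \<Longrightarrow> augR (\<iota> t) = augT t"
    and augR_r [simp]: "i \<in> I \<Longrightarrow> augR (r i) = 1"
    and wt_add: "a \<in> R \<Longrightarrow> b \<in> R \<Longrightarrow> wt i (a + b) = wt i a + wt i b"
    and wt_r: "k \<in> I \<Longrightarrow> i \<in> I \<Longrightarrow> t \<in> T \<Longrightarrow> wt k (r i \<star> \<iota> t) = (if k = i then augT t else 0)"
    and N_Q: "N \<subseteq> R" "Q \<subseteq> R" "a \<in> R \<Longrightarrow> \<exists>\<nu>\<in>N. \<exists>q\<in>Q. a = \<nu> + q"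
    and N_int: "\<exists>\<nu>\<in>N. augR \<nu> = z" "\<nu> \<in> N \<Longrightarrow> augR \<nu> = 0 \<Longrightarrow> \<nu> = 0"
    and wt_N: "\<nu> \<in> N \<Longrightarrow> a \<in> R \<Longrightarrow> a \<star> e = a \<Longrightarrow> i \<in> I \<Longrightarrow> wt i (\<nu> \<star> a) = augR \<nu> * wt i a"
    and wt_Q: "q \<in> Q \<Longrightarrow> i \<in> I \<Longrightarrow> \<exists>w. \<forall>a\<in>R. a \<star> e = a \<longrightarrow> wt i (q \<star> a) = w * augR a"
    and finite_P: "finite P"
    and p: "l \<in> P \<Longrightarrow> p l \<in> Q" "l \<in> P \<Longrightarrow> p l \<star> p l = p l"
    and p_span: "q \<in> Q \<Longrightarrow> \<exists>c. (\<forall>l\<in>P. c l \<in> R) \<and> q = (\<Sum>l\<in>P. c l \<star> p l)"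
    and p_indep: "(\<And>l. l \<in> P \<Longrightarrow> c l \<in> R \<and> c l \<star> p l = c l) \<Longrightarrow> (\<Sum>l\<in>P. c l) = 0 \<Longrightarrow>
       l \<in> P \<Longrightarrow> c l = 0"
begin

abbreviation trivR :: "'a \<Rightarrow> int \<Rightarrow> int" where
  "trivR a k \<equiv> augR a * k"

abbreviation trivT :: "'b \<Rightarrow> int \<Rightarrow> int" where
  "trivT t k \<equiv> augT t * k"

lemma lmod_trivR: "R.lmod UNIV trivR"
  by unfold_locales (auto simp: augR_add augR_mul algebra_simps)

lemma lmod_trivT: "T.lmod UNIV trivT"
  by unfold_locales (auto simp: augT_add augT_mul algebra_simps)

lemma augR_zero [simp]: "augR 0 = 0"
  using augR_add[of 0 0] by simp

lemma augR_diff: "a \<in> R \<Longrightarrow> b \<in> R \<Longrightarrow> augR (a - b) = augR a - augR b"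
  using augR_add[of "a - b" b] R.reg.diff_memM by simp

lemma wt_zero [simp]: "wt i 0 = 0"
  using wt_add[of 0 0 i] by simp

lemma wt_diff: "a \<in> R \<Longrightarrow> b \<in> R \<Longrightarrow> wt i (a - b) = wt i a - wt i b"
  using wt_add[of "a - b" b] R.reg.diff_memM by simp

lemma wt_sum: "(\<And>j. j \<in> J \<Longrightarrow> f j \<in> R) \<Longrightarrow> wt i (sum f J) = (\<Sum>j\<in>J. wt i (f j))"
  by (rule R.reg.hom_sum) (auto simp: wt_add)

lemma augR_sum: "(\<And>j. j \<in> J \<Longrightarrow> f j \<in> R) \<Longrightarrow> augR (sum f J) = (\<Sum>j\<in>J. augR (f j))"
  by (rule R.reg.hom_sum) (auto simp: augR_add)

lemma wt_comb:
  assumes "\<And>i. i \<in> I \<Longrightarrow> t i \<in> T" "k \<in> I"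
  shows "wt k (\<Sum>i\<in>I. r i \<star> \<iota> (t i)) = augT (t k)"
proof -
  have "wt k (\<Sum>i\<in>I. r i \<star> \<iota> (t i)) = (\<Sum>i\<in>I. if k = i then augT (t i) else 0)"
    using assms by (subst wt_sum) (auto intro!: sum.cong simp: wt_r)
  then show ?thesis
    using finite_I assms(2) by simp
qed

lemma sum_wt:
  assumes "a \<in> R" "a \<star> e = a"
  shows "(\<Sum>i\<in>I. wt i a) = augR a"
proof -
  obtain t where t: "\<And>i. i \<in> I \<Longrightarrow> t i \<in> T" "a = (\<Sum>i\<in>I. r i \<star> \<iota> (t i))"
    using r_span[OF assms] by blast
  have "augR a = (\<Sum>i\<in>I. augT (t i))"
    unfolding t(2) using t(1) by (subst augR_sum) (auto simp: augR_mul)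
  moreover have "wt i a = augT (t i)" if "i \<in> I" for i
    unfolding t(2) using t(1) that by (rule wt_comb)
  ultimately show ?thesis
    by simp
qed

lemma wt_mul_\<iota>:
  assumes a: "a \<in> R" "a \<star> e = a" and s: "s \<in> T" and k: "k \<in> I"
  shows "wt k (a \<star> \<iota> s) = wt k a * augT s"
proof -
  obtain t where t: "\<And>i. i \<in> I \<Longrightarrow> t i \<in> T" "a = (\<Sum>i\<in>I. r i \<star> \<iota> (t i))"
    using r_span[OF a] by blast
  have "a \<star> \<iota> s = (\<Sum>i\<in>I. r i \<star> \<iota> (t i \<bullet> s))"
    unfolding t(2) using t(1) s by (subst R.reg.sum_act) (auto simp: \<iota>_mul R.mul_assoc)
  moreover have "wt k (\<Sum>i\<in>I. r i \<star> \<iota> (t i \<bullet> s)) = augT (t k \<bullet> s)"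
    using t(1) s k by (intro wt_comb) auto
  moreover have "wt k a = augT (t k)"
    unfolding t(2) using t(1) k by (rule wt_comb)
  ultimately show ?thesis
    using t(1) s k by (simp add: augT_mul)
qed

lemma right_fixed_by_e:
  assumes "c \<in> R" "t \<in> T" "c \<star> \<iota> t = c"
  shows "c \<star> e = c"
  using R.mul_assoc[of c "\<iota> t" e] assms by simp

text \<open>Generators of the integers over \<open>T\<close> also generate them over \<open>R\<close>. Let \<open>B\<close> be the module of syzygies
  over \<open>R\<close>, and let \<open>v i\<close> apply the relation componentwise, so that on \<open>B\<close> the values
  \<open>v i\<close> sum to zero. Where all \<open>v i\<close> vanish we have the submodule \<open>A\<close> induced from the
  syzygies over \<open>T\<close>. The quotient \<open>B / A\<close> is the group of integer vectors on \<open>I\<close> with sum zero, and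
  \<open>Q\<close> acts on it by zero because it only sees the sum; so \<open>fp_null_extension\<close> applies.\<close>

theorem type_FP_trivial_induce:
  assumes "T.type_FP n UNIV trivT"
  shows "R.type_FP n UNIV trivR"
proof -
  obtain J \<epsilon> x where covT: "T.covers UNIV trivT J \<epsilon> x" and fpT: "T.fp n (T.syz trivT J \<epsilon> x)"
    using assms by (auto simp: T.type_FP_def)
  note D = T.coversD[OF covT]
  have covR: "R.covers UNIV trivR J (\<lambda>j. \<iota> (\<epsilon> j)) x"
    unfolding R.covers_def
  proof (intro conjI ballI)
    fix j assume "j \<in> J"
    then show "\<iota> (\<epsilon> j) \<in> R" "\<iota> (\<epsilon> j) \<star> \<iota> (\<epsilon> j) = \<iota> (\<epsilon> j)" "x j \<in> UNIV" "trivR (\<iota> (\<epsilon> j)) (x j) = x j"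
      using D(2)[of j] D(3)[of j] D(5)[of j] by (auto simp flip: \<iota>_mul)
  next
    fix m :: int
    obtain t where "\<forall>j\<in>J. t j \<in> T" "m = (\<Sum>j\<in>J. trivT (t j) (x j))"
      using T.covers_coeffs[OF covT lmod_trivT, of m] by (metis UNIV_I)
    then show "\<exists>c. (\<forall>j\<in>J. c j \<in> R) \<and> m = (\<Sum>j\<in>J. trivR (c j) (x j))"
      by (intro exI[of _ "\<lambda>j. \<iota> (t j)"]) auto
  qed (rule D(1))
  let ?K' = "T.syz trivT J \<epsilon> x" and ?\<epsilon> = "\<lambda>j. \<iota> (\<epsilon> j)"
  let ?B = "R.syz trivR J ?\<epsilon> x"
  have lmodB: "R.lmod ?B R.smul"
    by (rule R.lmod_syz[OF lmod_trivR covR])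
  interpret B: module_on R mul one ?B R.smul
    by (rule lmodB)
  have BR: "c j \<in> R" and Be: "c j \<star> e = c j" if "c \<in> ?B" for c j
  proof -
    show "c j \<in> R"
      using that by (simp add: R.syz_def)
    then show "c j \<star> e = c j"
      using that D(2)[of j] right_fixed_by_e[of "c j" "\<epsilon> j"] by (cases "j \<in> J") (auto simp: R.syz_def)
  qed
  have B0: "(\<Sum>j\<in>J. augR (c j) * x j) = 0" if "c \<in> ?B" for c
    using that by (simp add: R.syz_def)
  define v where "v i c = (\<Sum>j\<in>J. wt i (c j) * x j)" for i and c :: "nat \<Rightarrow> 'a"
  define A where "A = {c \<in> ?B. \<forall>i\<in>I. v i c = 0}"
  have v_add: "v i (c + d) = v i c + v i d" if "c \<in> ?B" "d \<in> ?B" for i c d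
    using BR[OF that(1)] BR[OF that(2)] by (simp add: v_def wt_add distrib_right sum.distrib)
  have v_diff: "v i (c - d) = v i c - v i d" if "c \<in> ?B" "d \<in> ?B" for i c d
    using BR[OF that(1)] BR[OF that(2)] by (simp add: v_def wt_diff left_diff_distrib sum_subtractf)
  have v_sum: "v i (sum f L) = (\<Sum>l\<in>L. v i (f l))" if "\<And>l. l \<in> L \<Longrightarrow> f l \<in> ?B" for i f and L :: "'c set"
    by (rule B.hom_sum) (rule v_add that, assumption+)+
  have v_N: "v i (R.smul \<nu> c) = augR \<nu> * v i c" if "\<nu> \<in> N" "c \<in> ?B" "i \<in> I" for i \<nu> c
    using that BR[OF that(2)] Be[OF that(2)]
    by (simp add: v_def R.smul_def wt_N sum_distrib_left mult.assoc)
  have v_Q: "v i (R.smul q c) = 0" if q: "q \<in> Q" "i \<in> I" and c: "c \<in> ?B" for i q c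
  proof -
    obtain w where w: "\<And>a. a \<in> R \<Longrightarrow> a \<star> e = a \<Longrightarrow> wt i (q \<star> a) = w * augR a"
      using wt_Q[OF q] by blast
    have "v i (R.smul q c) = w * (\<Sum>j\<in>J. augR (c j) * x j)"
      using BR[OF c] Be[OF c] by (simp add: v_def R.smul_def w sum_distrib_left mult.assoc)
    then show ?thesis
      using B0[OF c] by simp
  qed
  have null: "R.smul q c \<in> A" if "q \<in> Q" "c \<in> ?B" for q c
    using that N_Q(2) v_Q by (auto simp: A_def)
  have lmodA: "R.lmod A R.smul"
  proof (rule R.lmod_subset[OF lmodB])
    fix a c assume a: "a \<in> R" and c: "c \<in> A"
    obtain \<nu> q where \<nu>q: "\<nu> \<in> N" "q \<in> Q" "a = \<nu> + q"
      using N_Q(3)[OF a] by blast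
    have "R.smul a c = R.smul \<nu> c + R.smul q c"
      using c \<nu>q N_Q(1,2) by (auto simp: A_def B.add_act subset_iff)
    moreover have "R.smul \<nu> c \<in> ?B" "R.smul q c \<in> ?B"
      using c \<nu>q N_Q(1,2) by (auto simp: A_def)
    ultimately show "R.smul a c \<in> A"
      using a c \<nu>q by (auto simp: A_def v_add v_N v_Q)
  qed (auto simp: A_def v_add, auto simp: v_def)
  have fpA: "R.fp n A"
  proof (rule fp_induce[OF fpT T.lmod_syz[OF lmod_trivT covT] lmodA, where \<psi> = "\<lambda>c j. \<iota> (c j)"])
    show "induces (\<lambda>c j. \<iota> (c j)) ?K' T.smul A R.smul"
    proof (rule induces_coefficientwise)
      show K'T: "c j \<in> T" if "c \<in> ?K'" for c j
        using that by (simp add: T.syz_def)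
      show "(\<lambda>j. \<iota> (c j)) \<in> A" if c: "c \<in> ?K'" for c
      proof -
        have c0: "(\<Sum>j\<in>J. augT (c j) * x j) = 0"
          using c by (simp add: T.syz_def)
        have "v i (\<lambda>j. \<iota> (c j)) = wt i e * (\<Sum>j\<in>J. augT (c j) * x j)" if "i \<in> I" for i
        proof -
          have "wt i (\<iota> (c j)) = wt i e * augT (c j)" for j
            using wt_mul_\<iota>[of e "c j" i] that K'T[OF c] by simp
          then show ?thesis
            by (simp add: v_def sum_distrib_left mult.assoc)
        qed
        moreover have "(\<lambda>j. \<iota> (c j)) \<in> ?B"
          using c c0 D K'T[OF c] by (auto simp: R.syz_def T.syz_def simp flip: \<iota>_mul)
        ultimately show ?thesis
          using c0 by (simp add: A_def)
      qed
      fix k assume "k \<in> A"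
      then have k: "k \<in> ?B" "\<And>i. i \<in> I \<Longrightarrow> v i k = 0"
        by (auto simp: A_def)
      obtain t where t: "\<And>i j. i \<in> I \<Longrightarrow> t i j \<in> T" "\<And>i j. j \<notin> J \<Longrightarrow> t i j = 0"
        "\<And>i j. i \<in> I \<Longrightarrow> j \<in> J \<Longrightarrow> t i j \<bullet> \<epsilon> j = t i j" "\<And>j. k j = (\<Sum>i\<in>I. r i \<star> \<iota> (t i j))"
        by (rule syz_split_family[OF k(1) D(2)]) (assumption, rule that)
      have "t i \<in> ?K'" if i: "i \<in> I" for i
      proof -
        have "augT (t i j) = wt i (k j)" for j
          unfolding t(4) using wt_comb[of "\<lambda>i. t i j" i] t(1) i by simp
        then have "(\<Sum>j\<in>J. trivT (t i j) (x j)) = v i k"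
          by (simp add: v_def)
        then show ?thesis
          using k(2) i t(1-3) by (auto simp: T.syz_def)
      qed
      with t(4) show "\<exists>m'. (\<forall>i\<in>I. m' i \<in> ?K') \<and> (\<forall>j. k j = (\<Sum>i\<in>I. r i \<star> \<iota> (m' i j)))"
        by (intro exI[of _ t] conjI allI ballI)
    qed
  qed
  \<comment> \<open>\<open>I\<close> is not empty, for otherwise \<open>e = 0\<close>.\<close>
  have "augR e = 1"
    by simp
  then have "e \<noteq> 0"
    by (metis augR_zero zero_neq_one)
  then obtain i0 where i0: "i0 \<in> I"
    using r_span[of e] by fastforce
  obtain b where b: "\<And>j. b j \<in> T" "\<And>j. j \<notin> J \<Longrightarrow> b j = 0" "\<And>j. j \<in> J \<Longrightarrow> b j \<bullet> \<epsilon> j = b j"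
    "1 = (\<Sum>j\<in>J. trivT (b j) (x j))"
    using T.covers_coeffs[OF covT lmod_trivT, of 1] by (metis UNIV_I)
  \<comment> \<open>With \<open>b\<close> a combination of value 1, the elements \<open>y i\<close> lift the basis of the vectors with sum
    zero formed by the differences of the \<open>i\<close>-th and the \<open>i0\<close>-th unit vector.\<close>
  define y where "y i = (\<lambda>j. (r i - r i0) \<star> \<iota> (b j))" for i
  have yB: "y i \<in> ?B" if i: "i \<in> I" for i
  proof -
    have rR: "r i - r i0 \<in> R"
      using i i0 by (intro R.reg.diff_memM) auto
    have "(\<Sum>j\<in>J. trivR (y i j) (x j)) = 0"
      using i i0 b(1) rR by (simp add: y_def augR_mul augR_diff)
    moreover have "y i j \<star> ?\<epsilon> j = y i j" if "j \<in> J" for j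
      using rR b(1) b(3)[OF that] D(2)[OF that] by (simp add: y_def R.mul_assoc flip: \<iota>_mul)
    ultimately show ?thesis
      using rR b(1,2) by (auto simp: R.syz_def y_def)
  qed
  have v_y: "v k (y i) = (if k = i then 1 else 0) - (if k = i0 then 1 else 0)"
    if "i \<in> I" "k \<in> I" for i k
  proof -
    have "wt k (y i j) = ((if k = i then 1 else 0) - (if k = i0 then 1 else 0)) * augT (b j)" for j
      using that i0 b(1) by (simp add: y_def R.reg.diff_act wt_diff wt_r)
    then have "v k (y i) =
        ((if k = i then 1 else 0) - (if k = i0 then 1 else 0)) * (\<Sum>j\<in>J. augT (b j) * x j)"
      by (simp add: v_def sum_distrib_left mult.assoc)
    then show ?thesis
      using b(4) by simp
  qed
  have v_comb: "v k (\<Sum>i\<in>I - {i0}. R.smul (c i) (y i)) = augR (c k)"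
    if c: "\<And>i. i \<in> I - {i0} \<Longrightarrow> c i \<in> N" and k: "k \<in> I - {i0}" for c k
  proof -
    have "v k (\<Sum>i\<in>I - {i0}. R.smul (c i) (y i)) = (\<Sum>i\<in>I - {i0}. v k (R.smul (c i) (y i)))"
      using c N_Q(1) yB by (intro v_sum) auto
    also have "\<dots> = (\<Sum>i\<in>I - {i0}. if k = i then augR (c i) else 0)"
      using c k by (intro sum.cong refl) (auto simp: v_N yB v_y)
    finally show ?thesis
      using finite_I k by simp
  qed
  have "R.fp n ?B"
  proof (rule R.fp_null_extension[OF lmodB _ lmodA fpA, where I = "I - {i0}" and y = y and Q = Q
        and N = N and \<Lambda> = P and e = p])
    show "A \<subseteq> ?B"
      by (auto simp: A_def)
  next
    fix d assume d: "d \<in> ?B"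
    have "\<forall>i. \<exists>\<nu>\<in>N. augR \<nu> = v i d"
      using N_int(1) by blast
    then obtain c where c: "\<And>i. c i \<in> N" "\<And>i. augR (c i) = v i d"
      by metis
    let ?s = "\<Sum>i\<in>I - {i0}. R.smul (c i) (y i)"
    have sB: "?s \<in> ?B"
      using c(1) N_Q(1) yB by (intro B.sum_memM) auto
    have sum_v: "(\<Sum>i\<in>I. v i a) = 0" if a: "a \<in> ?B" for a
    proof -
      have "(\<Sum>i\<in>I. v i a) = (\<Sum>j\<in>J. (\<Sum>i\<in>I. wt i (a j)) * x j)"
        unfolding v_def sum_distrib_right by (rule sum.swap)
      then show ?thesis
        using B0[OF a] BR[OF a] Be[OF a] by (simp add: sum_wt)
    qed
    have other: "v k (d - ?s) = 0" if "k \<in> I - {i0}" for k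
      using v_diff[OF d sB] v_comb[of c k] c that by simp
    moreover have "v i0 (d - ?s) = 0"
      using sum_v[of "d - ?s"] d sB finite_I i0 other
      by (simp add: sum.remove[of I i0] B.diff_memM del: minus_apply)
    ultimately have "d - ?s \<in> A"
      using d sB by (auto simp: A_def B.diff_memM simp del: minus_apply)
    then show "\<exists>a\<in>A. \<exists>c. (\<forall>i\<in>I - {i0}. c i \<in> R) \<and> d = a + (\<Sum>i\<in>I - {i0}. R.smul (c i) (y i))"
      using c(1) N_Q(1) by (intro bexI[of _ "d - ?s"] exI[of _ c]) auto
  next
    fix c i
    assume c: "\<And>i. i \<in> I - {i0} \<Longrightarrow> c i \<in> N" and s: "(\<Sum>i\<in>I - {i0}. R.smul (c i) (y i)) \<in> A"
      and i: "i \<in> I - {i0}"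
    have "augR (c i) = 0"
      using v_comb[of c i] c i s by (simp add: A_def)
    then show "c i = 0"
      using N_int(2) c i by blast
  next
    fix q i assume "q \<in> Q" "i \<in> I - {i0}"
    then show "R.smul q (y i) \<in> A"
      using null yB by blast
  next
    fix c l
    assume "\<And>l. l \<in> P \<Longrightarrow> c l \<in> R \<and> c l \<star> p l = c l" "(\<Sum>l\<in>P. c l) = 0" "l \<in> P"
    then show "c l = 0"
      by (rule p_indep)
  qed (use finite_I yB N_Q finite_P p p_span in auto)
  with covR show ?thesis
    by (auto simp: R.type_FP_def)
qed

end

section \<open>Comparison with resolutions by free modules\<close>

lemma (in left_module) smult_zero:
  assumes "a \<in> carrier R"
  shows "a \<odot>\<^bsub>M\<^esub> \<zero>\<^bsub>M\<^esub> = \<zero>\<^bsub>M\<^esub>"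
proof -
  have "a \<odot>\<^bsub>M\<^esub> \<zero>\<^bsub>M\<^esub> \<oplus>\<^bsub>M\<^esub> a \<odot>\<^bsub>M\<^esub> \<zero>\<^bsub>M\<^esub> = a \<odot>\<^bsub>M\<^esub> \<zero>\<^bsub>M\<^esub>"
    using smult_r_distr[OF assms M.zero_closed M.zero_closed] by simp
  then show ?thesis
    using smult_closed[OF assms M.zero_closed] M.add.l_cancel_one' by metis
qed

lemma (in left_module) smult_finsum:
  "finite B \<Longrightarrow> a \<in> carrier R \<Longrightarrow> g \<in> B \<rightarrow> carrier M \<Longrightarrow>
    a \<odot>\<^bsub>M\<^esub> (\<Oplus>\<^bsub>M\<^esub>b\<in>B. g b) = (\<Oplus>\<^bsub>M\<^esub>b\<in>B. a \<odot>\<^bsub>M\<^esub> g b)"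
proof (induction B rule: finite_induct)
  case (insert b B)
  then have "g b \<in> carrier M" "g \<in> B \<rightarrow> carrier M" "(\<lambda>b. a \<odot>\<^bsub>M\<^esub> g b) \<in> B \<rightarrow> carrier M"
    "a \<odot>\<^bsub>M\<^esub> g b \<in> carrier M"
    by (auto intro!: smult_closed)
  with insert show ?case
    by (simp add: smult_r_distr)
qed (simp add: smult_zero)

abbreviation supp :: "('a \<Rightarrow>\<^sub>0 int) \<Rightarrow> 'a set" where
  "supp \<equiv> Poly_Mapping.keys"

locale integral_monoid_ring = Group.monoid S for S :: "('a, 'k) monoid_scheme" (structure)
begin

abbreviation ZS :: "('a \<Rightarrow>\<^sub>0 int) ring" where
  "ZS \<equiv> monoid_ring S"

lemma ZS_simps:
  "a \<in> carrier ZS \<longleftrightarrow> supp a \<subseteq> carrier S"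
  "a \<oplus>\<^bsub>ZS\<^esub> b = a + b" "\<zero>\<^bsub>ZS\<^esub> = 0" "\<one>\<^bsub>ZS\<^esub> = frag_of \<one>"
  by (simp_all add: monoid_ring_def)

sublocale ZS: ring ZS
  by (rule ring_monoid_ring) unfold_locales

sublocale RS: ring_on "carrier ZS" "mult ZS" "one ZS"
proof unfold_locales
  show "a + b \<in> carrier ZS" if "a \<in> carrier ZS" "b \<in> carrier ZS" for a b
    using ZS.add.m_closed[OF that] by (simp add: ZS_simps(2))
  show "- a \<in> carrier ZS" if "a \<in> carrier ZS" for a
    using that by (simp add: ZS_simps(1))
  show "0 \<in> carrier ZS"
    by (simp add: ZS_simps(1))
qed (simp_all add: ZS.m_assoc monoid_ring_add_mult monoid_ring_mult_add)

abbreviation triv :: "('a \<Rightarrow>\<^sub>0 int) \<Rightarrow> int \<Rightarrow> int" where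
  "triv a k \<equiv> augmentation a * k"

lemma lmod_triv: "RS.lmod UNIV triv"
proof unfold_locales
  show "augmentation \<one>\<^bsub>ZS\<^esub> * k = k" for k :: int
    by (simp add: ZS_simps(4))
qed (simp_all add: augmentation_add augmentation_mult algebra_simps)

text \<open>\<open>exact_to_trivial\<close> with the integers replaced by an arbitrary module, so that a resolution can
  be cut off at its beginning: what remains resolves a syzygy module.\<close>

definition resolves ::
  "nat \<Rightarrow> (nat \<Rightarrow> ('a \<Rightarrow>\<^sub>0 int, nat \<Rightarrow> ('a \<Rightarrow>\<^sub>0 int)) module) \<Rightarrow>
   (nat \<Rightarrow> (nat \<Rightarrow> ('a \<Rightarrow>\<^sub>0 int)) \<Rightarrow> nat \<Rightarrow> ('a \<Rightarrow>\<^sub>0 int)) \<Rightarrow> ((nat \<Rightarrow> ('a \<Rightarrow>\<^sub>0 int)) \<Rightarrow> 'm) \<Rightarrow>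
   'm::ab_group_add set \<Rightarrow> (('a \<Rightarrow>\<^sub>0 int) \<Rightarrow> 'm \<Rightarrow> 'm) \<Rightarrow> bool" where
  "resolves n A d \<phi> M act \<longleftrightarrow>
     (\<forall>i\<le>n. left_module ZS (A i) \<and> finitely_generated_free ZS (A i)) \<and>
     (\<forall>x\<in>carrier (A 0). \<forall>y\<in>carrier (A 0). \<phi> (x \<oplus>\<^bsub>A 0\<^esub> y) = \<phi> x + \<phi> y) \<and>
     (\<forall>a\<in>carrier ZS. \<forall>x\<in>carrier (A 0). \<phi> (a \<odot>\<^bsub>A 0\<^esub> x) = act a (\<phi> x)) \<and>
     \<phi> ` carrier (A 0) = M \<and>
     (\<forall>i<n. d i \<in> module_hom ZS (A (Suc i)) (A i)) \<and>
     (0 < n \<longrightarrow> d 0 ` carrier (A 1) = {x \<in> carrier (A 0). \<phi> x = 0}) \<and>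
     (\<forall>i. Suc i < n \<longrightarrow> d (Suc i) ` carrier (A (Suc (Suc i))) = a_kernel (A (Suc i)) (A i) (d i))"

lemma monoid_left_FP_resolves:
  "monoid_left_FP n S \<longleftrightarrow> (\<exists>A d \<phi>. resolves n A d \<phi> (UNIV :: int set) triv)"
  by (simp add: monoid_left_FP_def exact_to_trivial_def resolves_def module_hom_def
      trivial_module_def a_kernel_def' conj_ac)

definition coords :: "nat set \<Rightarrow> (nat \<Rightarrow> ('a \<Rightarrow>\<^sub>0 int)) set" where
  "coords J = {c. (\<forall>j. c j \<in> carrier ZS) \<and> (\<forall>j. j \<notin> J \<longrightarrow> c j = 0)}"

lemma lmod_coords: "RS.lmod (coords J) RS.smul"
  by (rule RS.lmod_subset[OF RS.lmod_funs]) (auto simp: coords_def RS.smul_def)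

definition unit_vector :: "nat \<Rightarrow> nat \<Rightarrow> ('a \<Rightarrow>\<^sub>0 int)" where
  "unit_vector j = (\<lambda>i. if i = j then \<one>\<^bsub>ZS\<^esub> else 0)"

lemma unit_vector_mem: "j \<in> J \<Longrightarrow> unit_vector j \<in> coords J"
  by (auto simp: unit_vector_def coords_def)

lemma coords_expand:
  assumes "finite J" "c \<in> coords J"
  shows "c = (\<Sum>j\<in>J. RS.smul (c j) (unit_vector j))"
proof
  fix i
  have "(\<Sum>j\<in>J. RS.smul (c j) (unit_vector j)) i = (\<Sum>j\<in>J. if i = j then c j else 0)"
    unfolding sum_fun_apply
    by (rule sum.cong) (use assms in \<open>auto simp: RS.smul_def unit_vector_def coords_def\<close>)
  then show "c i = (\<Sum>j\<in>J. RS.smul (c j) (unit_vector j)) i"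
    using assms by (auto simp: coords_def)
qed

text \<open>Coordinates with respect to a finite basis, taken from tuples to module elements: in this direction
  linearity is a computation, and unique representation is bijectivity.\<close>

lemma free_coordinates:
  assumes "left_module ZS A" "finitely_generated_free ZS A"
  obtains J \<eta> where "finite J" "bij_betw \<eta> (coords J) (carrier A)"
    "\<forall>c\<in>coords J. \<forall>d\<in>coords J. \<eta> (c + d) = \<eta> c \<oplus>\<^bsub>A\<^esub> \<eta> d"
    "\<forall>a\<in>carrier ZS. \<forall>c\<in>coords J. \<eta> (RS.smul a c) = a \<odot>\<^bsub>A\<^esub> \<eta> c"
proof -
  interpret A: left_module ZS A by fact
  obtain B where fin: "finite B" and B: "B \<subseteq> carrier A"
    and ex1: "\<And>x. x \<in> carrier A \<Longrightarrow> \<exists>!c. c \<in> B \<rightarrow>\<^sub>E carrier ZS \<and> x = (\<Oplus>\<^bsub>A\<^esub>b\<in>B. c b \<odot>\<^bsub>A\<^esub> b)"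
    using assms(2) by (auto simp: finitely_generated_free_def module_basis_def)
  obtain h where h: "bij_betw h B {0..<card B}"
    using ex_bij_betw_finite_nat[OF fin] by (elim exE)
  define J where "J = {0..<card B}"
  have h_inj: "inj_on h B" and h_img: "h ` B = J"
    using h by (auto simp: bij_betw_def J_def)
  define \<eta> where "\<eta> c = (\<Oplus>\<^bsub>A\<^esub>b\<in>B. c (h b) \<odot>\<^bsub>A\<^esub> b)" for c
  have cR: "c j \<in> carrier ZS" if "c \<in> coords J" for c j
    using that by (simp add: coords_def)
  have Pi: "(\<lambda>b. c (h b) \<odot>\<^bsub>A\<^esub> b) \<in> B \<rightarrow> carrier A" if "c \<in> coords J" for c
    using B cR[OF that] by (auto intro!: A.smult_closed)
  show thesis
  proof (rule that[of J \<eta>])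
    show "finite J"
      by (simp add: J_def)
    show "\<forall>c\<in>coords J. \<forall>d\<in>coords J. \<eta> (c + d) = \<eta> c \<oplus>\<^bsub>A\<^esub> \<eta> d"
    proof (intro ballI)
      fix c d assume cd: "c \<in> coords J" "d \<in> coords J"
      have "\<eta> (c + d) = (\<Oplus>\<^bsub>A\<^esub>b\<in>B. c (h b) \<odot>\<^bsub>A\<^esub> b \<oplus>\<^bsub>A\<^esub> d (h b) \<odot>\<^bsub>A\<^esub> b)"
        unfolding \<eta>_def
      proof (rule A.finsum_cong')
        show "(\<lambda>b. c (h b) \<odot>\<^bsub>A\<^esub> b \<oplus>\<^bsub>A\<^esub> d (h b) \<odot>\<^bsub>A\<^esub> b) \<in> B \<rightarrow> carrier A"
          using Pi[OF cd(1)] Pi[OF cd(2)] by auto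
        show "(c + d) (h b) \<odot>\<^bsub>A\<^esub> b = c (h b) \<odot>\<^bsub>A\<^esub> b \<oplus>\<^bsub>A\<^esub> d (h b) \<odot>\<^bsub>A\<^esub> b" if "b \<in> B" for b
          using that B cR[OF cd(1)] cR[OF cd(2)] A.smult_l_distr[of "c (h b)" "d (h b)" b]
          by (auto simp: ZS_simps(2))
      qed simp
      also have "\<dots> = \<eta> c \<oplus>\<^bsub>A\<^esub> \<eta> d"
        unfolding \<eta>_def by (rule A.finsum_addf[OF Pi[OF cd(1)] Pi[OF cd(2)]])
      finally show "\<eta> (c + d) = \<eta> c \<oplus>\<^bsub>A\<^esub> \<eta> d" .
    qed
    show "\<forall>a\<in>carrier ZS. \<forall>c\<in>coords J. \<eta> (RS.smul a c) = a \<odot>\<^bsub>A\<^esub> \<eta> c"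
    proof (intro ballI)
      fix a c assume ac: "a \<in> carrier ZS" "c \<in> coords J"
      have "\<eta> (RS.smul a c) = (\<Oplus>\<^bsub>A\<^esub>b\<in>B. a \<odot>\<^bsub>A\<^esub> (c (h b) \<odot>\<^bsub>A\<^esub> b))"
        unfolding \<eta>_def
      proof (rule A.finsum_cong')
        show "(\<lambda>b. a \<odot>\<^bsub>A\<^esub> (c (h b) \<odot>\<^bsub>A\<^esub> b)) \<in> B \<rightarrow> carrier A"
          using Pi[OF ac(2)] ac(1) by (auto intro: A.smult_closed)
        show "RS.smul a c (h b) \<odot>\<^bsub>A\<^esub> b = a \<odot>\<^bsub>A\<^esub> (c (h b) \<odot>\<^bsub>A\<^esub> b)" if "b \<in> B" for b
          using that B cR[OF ac(2)] ac(1) by (auto simp: RS.smul_def A.smult_assoc)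
      qed simp
      also have "\<dots> = a \<odot>\<^bsub>A\<^esub> \<eta> c"
        unfolding \<eta>_def by (rule A.smult_finsum[symmetric, OF fin ac(1) Pi[OF ac(2)]])
      finally show "\<eta> (RS.smul a c) = a \<odot>\<^bsub>A\<^esub> \<eta> c" .
    qed
    have \<eta>_mem: "\<eta> c \<in> carrier A" if "c \<in> coords J" for c
      unfolding \<eta>_def by (rule A.finsum_closed[OF Pi[OF that]])
    have \<eta>_restrict: "\<eta> c = (\<Oplus>\<^bsub>A\<^esub>b\<in>B. restrict (\<lambda>b. c (h b)) B b \<odot>\<^bsub>A\<^esub> b)" if "c \<in> coords J" for c
      unfolding \<eta>_def by (rule A.finsum_cong') (use Pi[OF that] in auto)
    show "bij_betw \<eta> (coords J) (carrier A)"
    proof (rule bij_betw_imageI)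
      show "inj_on \<eta> (coords J)"
      proof (rule inj_onI)
        fix c d assume cd: "c \<in> coords J" "d \<in> coords J" and eq: "\<eta> c = \<eta> d"
        have r: "restrict (\<lambda>b. c (h b)) B \<in> B \<rightarrow>\<^sub>E carrier ZS" "restrict (\<lambda>b. d (h b)) B \<in> B \<rightarrow>\<^sub>E carrier ZS"
          using cR[OF cd(1)] cR[OF cd(2)] by auto
        obtain c0 where uniq: "\<forall>c'. c' \<in> B \<rightarrow>\<^sub>E carrier ZS \<and> \<eta> c = (\<Oplus>\<^bsub>A\<^esub>b\<in>B. c' b \<odot>\<^bsub>A\<^esub> b) \<longrightarrow> c' = c0"
          using ex1[OF \<eta>_mem[OF cd(1)]] by (elim ex1E) (rule that)
        have "restrict (\<lambda>b. c (h b)) B = c0"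
          by (rule uniq[rule_format, OF conjI, OF r(1) \<eta>_restrict[OF cd(1)]])
        moreover have "restrict (\<lambda>b. d (h b)) B = c0"
          by (rule uniq[rule_format, OF conjI, OF r(2) trans[OF eq \<eta>_restrict[OF cd(2)]]])
        ultimately have "restrict (\<lambda>b. c (h b)) B = restrict (\<lambda>b. d (h b)) B"
          by simp
        then have "c (h b) = d (h b)" if "b \<in> B" for b
          using that by (metis restrict_apply')
        then have "c j = d j" if "j \<in> J" for j
          using that h_img by auto
        moreover have "c j = d j" if "j \<notin> J" for j
          using that cd by (simp add: coords_def)
        ultimately show "c = d"
          by (intro ext) metis
      qed
      show "\<eta> ` coords J = carrier A"
      proof (intro equalityI subsetI)
        fix x assume x: "x \<in> carrier A"
        obtain c where c: "c \<in> B \<rightarrow>\<^sub>E carrier ZS" "x = (\<Oplus>\<^bsub>A\<^esub>b\<in>B. c b \<odot>\<^bsub>A\<^esub> b)"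
          using ex1[OF x] by (elim ex1E conjE)
        define c' where "c' j = (if j \<in> J then c (the_inv_into B h j) else 0)" for j
        have c'h: "c' (h b) = c b" if "b \<in> B" for b
          using that h_inj h_img by (auto simp: c'_def the_inv_into_f_f)
        have c': "c' \<in> coords J"
          using c(1) h_inj h_img by (auto simp: coords_def c'_def the_inv_into_f_f)
        have "\<eta> c' = x"
          unfolding \<eta>_def c(2) by (rule A.finsum_cong') (use c(1) B c'h in \<open>auto intro!: A.smult_closed\<close>)
        with c' show "x \<in> \<eta> ` coords J"
          by (intro image_eqI[of _ _ c']) auto
      qed (use \<eta>_mem in auto)
    qed
  qed
qed

text \<open>The images of a basis of \<open>A 0\<close> generate \<open>M\<close>, and in coordinates the kernel of \<open>A 0 \<rightarrow> M\<close> is their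
  syzygy module, which \<open>A 1\<close> maps onto. Hence the remaining complex resolves it.\<close>

lemma resolves_cover:
  assumes M: "RS.lmod M act" and res: "resolves n A d \<phi> M act"
  obtains J x where "RS.free_covers M act J x"
    "\<forall>k. n = Suc k \<longrightarrow>
       (\<exists>\<phi>'. resolves k (A \<circ> Suc) (d \<circ> Suc) \<phi>' (RS.free_syz act J x) RS.smul)"
proof -
  interpret M: module_on "carrier ZS" "mult ZS" "one ZS" M act by (rule M)
  have mod: "\<And>i. i \<le> n \<Longrightarrow> left_module ZS (A i)" "\<And>i. i \<le> n \<Longrightarrow> finitely_generated_free ZS (A i)"
    and \<phi>_add: "\<And>x y. x \<in> carrier (A 0) \<Longrightarrow> y \<in> carrier (A 0) \<Longrightarrow> \<phi> (x \<oplus>\<^bsub>A 0\<^esub> y) = \<phi> x + \<phi> y"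
    and \<phi>_act: "\<And>a x. a \<in> carrier ZS \<Longrightarrow> x \<in> carrier (A 0) \<Longrightarrow> \<phi> (a \<odot>\<^bsub>A 0\<^esub> x) = act a (\<phi> x)"
    and \<phi>_img: "\<phi> ` carrier (A 0) = M"
    and hom: "\<And>i. i < n \<Longrightarrow> d i \<in> module_hom ZS (A (Suc i)) (A i)"
    and ex0: "0 < n \<Longrightarrow> d 0 ` carrier (A 1) = {x \<in> carrier (A 0). \<phi> x = 0}"
    and ex: "\<And>i. Suc i < n \<Longrightarrow> d (Suc i) ` carrier (A (Suc (Suc i))) = a_kernel (A (Suc i)) (A i) (d i)"
    using res by (simp_all add: resolves_def)
  interpret A0: left_module ZS "A 0" by (rule mod) simp
  obtain J \<eta> where J: "finite J" and \<eta>: "bij_betw \<eta> (coords J) (carrier (A 0))"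
    and \<eta>_add: "\<forall>c\<in>coords J. \<forall>d\<in>coords J. \<eta> (c + d) = \<eta> c \<oplus>\<^bsub>A 0\<^esub> \<eta> d"
    and \<eta>_smul: "\<forall>a\<in>carrier ZS. \<forall>c\<in>coords J. \<eta> (RS.smul a c) = a \<odot>\<^bsub>A 0\<^esub> \<eta> c"
    using free_coordinates[OF mod[of 0]] by auto
  interpret E: module_on "carrier ZS" "mult ZS" "one ZS" "coords J" RS.smul
    by (rule lmod_coords)
  have \<eta>_mem: "\<eta> c \<in> carrier (A 0)" if "c \<in> coords J" for c
    using \<eta> that by (auto simp: bij_betw_def)
  have \<eta>_inj: "inj_on \<eta> (coords J)" and \<eta>_img: "\<eta> ` coords J = carrier (A 0)"
    using \<eta> by (simp_all add: bij_betw_def)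
  define x where "x j = \<phi> (\<eta> (unit_vector j))" for j
  have \<phi>\<eta>: "\<phi> (\<eta> c) = (\<Sum>j\<in>J. act (c j) (x j))" if c: "c \<in> coords J" for c
  proof -
    have cj: "c j \<in> carrier ZS" for j
      using c by (simp add: coords_def)
    have "\<phi> (\<eta> c) = \<phi> (\<eta> (\<Sum>j\<in>J. RS.smul (c j) (unit_vector j)))"
      using coords_expand[OF J c] by simp
    also have "\<dots> = (\<Sum>j\<in>J. \<phi> (\<eta> (RS.smul (c j) (unit_vector j))))"
    proof (rule E.hom_sum)
      show "\<phi> (\<eta> (a + b)) = \<phi> (\<eta> a) + \<phi> (\<eta> b)" if "a \<in> coords J" "b \<in> coords J" for a b
        using \<eta>_add \<phi>_add \<eta>_mem that by metis
    qed (simp add: cj unit_vector_mem)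
    also have "\<dots> = (\<Sum>j\<in>J. act (c j) (x j))"
      by (intro sum.cong refl) (simp add: \<eta>_smul \<phi>_act \<eta>_mem cj unit_vector_mem x_def)
    finally show ?thesis .
  qed
  have xM: "x j \<in> M" if "j \<in> J" for j
    using \<phi>_img \<eta>_mem[OF unit_vector_mem[OF that]] by (auto simp: x_def)
  have cov: "RS.free_covers M act J x"
    unfolding RS.covers_def
  proof (intro conjI ballI)
    fix m assume "m \<in> M"
    then obtain c where c: "c \<in> coords J" "m = \<phi> (\<eta> c)"
      using \<phi>_img \<eta>_img by (metis imageE)
    then show "\<exists>c. (\<forall>j\<in>J. c j \<in> carrier ZS) \<and> m = (\<Sum>j\<in>J. act (c j) (x j))"
      by (intro exI[of _ c]) (auto simp: \<phi>\<eta> coords_def)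
  qed (use J xM in auto)
  have syz: "RS.free_syz act J x = {c \<in> coords J. \<phi> (\<eta> c) = 0}"
    by (auto simp: RS.syz_def coords_def \<phi>\<eta>)
  have "\<exists>\<phi>'. resolves k (A \<circ> Suc) (d \<circ> Suc) \<phi>' (RS.free_syz act J x) RS.smul"
    if n: "n = Suc k" for k
  proof -
    define \<phi>' where "\<phi>' a = the_inv_into (coords J) \<eta> (d 0 a)" for a
    interpret A1: left_module ZS "A (Suc 0)" by (rule mod) (simp add: n)
    have d0: "d 0 ` carrier (A (Suc 0)) = {x \<in> carrier (A 0). \<phi> x = 0}"
      using ex0 n by simp
    have d0_mem: "d 0 a \<in> carrier (A 0)" "\<phi> (d 0 a) = 0" if "a \<in> carrier (A (Suc 0))" for a
      using d0 that by auto
    have d0_hom: "\<And>a b. a \<in> carrier (A (Suc 0)) \<Longrightarrow> b \<in> carrier (A (Suc 0)) \<Longrightarrow>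
        d 0 (a \<oplus>\<^bsub>A (Suc 0)\<^esub> b) = d 0 a \<oplus>\<^bsub>A 0\<^esub> d 0 b"
      "\<And>a z. a \<in> carrier (A (Suc 0)) \<Longrightarrow> z \<in> carrier ZS \<Longrightarrow>
        d 0 (z \<odot>\<^bsub>A (Suc 0)\<^esub> a) = z \<odot>\<^bsub>A 0\<^esub> d 0 a"
      using hom[of 0] n by (simp_all add: module_hom_def)
    have \<phi>'_mem: "\<phi>' a \<in> coords J" and \<eta>\<phi>': "\<eta> (\<phi>' a) = d 0 a" if "a \<in> carrier (A (Suc 0))" for a
      using d0_mem(1)[OF that] \<eta>_inj \<eta>_img
      by (auto simp: \<phi>'_def the_inv_into_into f_the_inv_into_f)
    have \<phi>'_eq: "\<phi>' a = c" if "a \<in> carrier (A (Suc 0))" "c \<in> coords J" "\<eta> c = d 0 a" for a c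
      by (rule inj_onD[OF \<eta>_inj]) (use that \<phi>'_mem \<eta>\<phi>' in auto)
    have \<eta>0: "\<eta> 0 = \<zero>\<^bsub>A 0\<^esub>"
    proof -
      have "\<eta> 0 \<oplus>\<^bsub>A 0\<^esub> \<eta> 0 = \<eta> 0"
        using \<eta>_add E.zero_memM by (metis add_0)
      then show ?thesis
        using \<eta>_mem[OF E.zero_memM] A0.M.add.l_cancel_one' by metis
    qed
    have "\<phi>' ` carrier (A (Suc 0)) = RS.free_syz act J x"
    proof (intro equalityI subsetI)
      fix c assume "c \<in> \<phi>' ` carrier (A (Suc 0))"
      then show "c \<in> RS.free_syz act J x"
        using \<phi>'_mem \<eta>\<phi>' d0_mem by (auto simp: syz)
    next
      fix c assume "c \<in> RS.free_syz act J x"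
      then have c: "c \<in> coords J" "\<eta> c \<in> d 0 ` carrier (A (Suc 0))"
        unfolding d0 by (auto simp: syz \<eta>_mem)
      then obtain a where "a \<in> carrier (A (Suc 0))" "\<eta> c = d 0 a"
        by (elim imageE)
      then show "c \<in> \<phi>' ` carrier (A (Suc 0))"
        using \<phi>'_eq[of a c] c(1) by (intro image_eqI[of _ _ a]) auto
    qed
    moreover have "\<phi>' (a \<oplus>\<^bsub>A (Suc 0)\<^esub> b) = \<phi>' a + \<phi>' b" if "a \<in> carrier (A (Suc 0))" "b \<in> carrier (A (Suc 0))" for a b
      by (rule \<phi>'_eq) (use that in \<open>simp_all add: \<phi>'_mem \<eta>\<phi>' \<eta>_add d0_hom\<close>)
    moreover have "\<phi>' (z \<odot>\<^bsub>A (Suc 0)\<^esub> a) = RS.smul z (\<phi>' a)" if "a \<in> carrier (A (Suc 0))" "z \<in> carrier ZS" for a z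
      by (rule \<phi>'_eq) (use that in \<open>simp_all add: \<phi>'_mem \<eta>\<phi>' \<eta>_smul d0_hom A1.smult_closed\<close>)
    moreover have "{a \<in> carrier (A (Suc 0)). \<phi>' a = 0} = a_kernel (A (Suc 0)) (A 0) (d 0)"
    proof -
      have "\<phi>' a = 0 \<longleftrightarrow> d 0 a = \<zero>\<^bsub>A 0\<^esub>" if "a \<in> carrier (A (Suc 0))" for a
        using \<phi>'_eq[of a 0] \<eta>\<phi>'[of a] \<eta>0 that E.zero_memM by metis
      then show ?thesis
        by (auto simp: a_kernel_def')
    qed
    ultimately show ?thesis
      unfolding resolves_def
      by (intro exI[of _ \<phi>'] conjI) (use mod hom ex n in \<open>auto simp: One_nat_def\<close>)
  qed
  then show thesis
    using cov that by metis
qed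

lemma fp_of_resolves: "resolves n A d \<phi> K RS.smul \<Longrightarrow> RS.lmod K RS.smul \<Longrightarrow> RS.fp (Suc n) K"
proof (induction n arbitrary: A d \<phi> K)
  case 0
  obtain J x where "RS.free_covers K RS.smul J x"
    using resolves_cover[OF 0(2,1)] by metis
  then show ?case
    by auto
next
  case (Suc n)
  obtain J x where cov: "RS.free_covers K RS.smul J x"
    and res: "\<forall>k. Suc n = Suc k \<longrightarrow> (\<exists>\<phi>'. resolves k (A \<circ> Suc) (d \<circ> Suc) \<phi>'
      (RS.free_syz RS.smul J x) RS.smul)"
    using resolves_cover[OF Suc.prems(2,1)] by metis
  then have "RS.fp (Suc n) (RS.free_syz RS.smul J x)"
    using Suc.IH RS.lmod_syz[OF Suc.prems(2) cov] by metis
  with cov show ?case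
    using RS.fp.simps(2) by metis
qed

lemma type_FP_of_resolves:
  assumes "RS.lmod M act" "resolves n A d \<phi> M act"
  shows "RS.type_FP n M act"
proof -
  obtain J x where cov: "RS.free_covers M act J x"
    and res: "\<forall>k. n = Suc k \<longrightarrow> (\<exists>\<phi>'. resolves k (A \<circ> Suc) (d \<circ> Suc) \<phi>'
      (RS.free_syz act J x) RS.smul)"
    using resolves_cover[OF assms] by metis
  have "RS.fp n (RS.free_syz act J x)"
  proof (cases n)
    case (Suc k)
    then show ?thesis
      using res fp_of_resolves RS.lmod_syz[OF assms(1) cov] by metis
  qed simp
  with cov show ?thesis
    unfolding RS.type_FP_def by metis
qed

definition free_module :: "nat set \<Rightarrow> ('a \<Rightarrow>\<^sub>0 int, nat \<Rightarrow> ('a \<Rightarrow>\<^sub>0 int)) module" where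
  "free_module J = \<lparr>carrier = coords J, mult = \<lambda>x y. x, one = 0, zero = 0, add = (+), smult = RS.smul\<rparr>"

lemma left_module_free_module: "left_module ZS (free_module J)"
proof -
  interpret E: module_on "carrier ZS" "mult ZS" "one ZS" "coords J" RS.smul
    by (rule lmod_coords)
  have "abelian_group (free_module J)"
  proof (rule abelian_groupI)
    fix x assume "x \<in> carrier (free_module J)"
    then show "\<exists>y\<in>carrier (free_module J). y \<oplus>\<^bsub>free_module J\<^esub> x = \<zero>\<^bsub>free_module J\<^esub>"
      by (intro bexI[of _ "- x"]) (auto simp: free_module_def)
  qed (auto simp: free_module_def algebra_simps)
  then show ?thesis
    by (intro left_module.intro left_module_axioms.intro ZS.ring_axioms)
      (simp_all add: free_module_def E.add_act E.act_add E.mul_act ZS_simps(2))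
qed

lemma finsum_free_module:
  assumes "\<And>b. b \<in> B \<Longrightarrow> g b \<in> coords J" "finite B"
  shows "(\<Oplus>\<^bsub>free_module J\<^esub>b\<in>B. g b) = (\<Sum>b\<in>B. g b)"
proof -
  interpret F: left_module ZS "free_module J"
    by (rule left_module_free_module)
  show ?thesis
    using assms(2,1)
  proof (induction B rule: finite_induct)
    case empty
    have "\<zero>\<^bsub>free_module J\<^esub> = 0"
      by (simp add: free_module_def)
    then show ?case
      by simp
  next
    case (insert b B)
    then have "g b \<in> carrier (free_module J)" "g \<in> B \<rightarrow> carrier (free_module J)"
      by (auto simp: free_module_def)
    moreover have "x \<oplus>\<^bsub>free_module J\<^esub> y = x + y" for x y
      by (simp add: free_module_def)
    ultimately show ?case
      using insert by simp
  qed
qed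

lemma finitely_generated_free_free_module:
  assumes J: "finite J"
  shows "finitely_generated_free ZS (free_module J)"
proof -
  interpret E: module_on "carrier ZS" "mult ZS" "one ZS" "coords J" RS.smul
    by (rule lmod_coords)
  have one0: "\<one>\<^bsub>ZS\<^esub> \<noteq> 0"
    by (simp add: ZS_simps(4))
  have inj: "inj_on unit_vector J"
    by (rule inj_onI) (metis unit_vector_def one0)
  have comb: "(\<Oplus>\<^bsub>free_module J\<^esub>b\<in>unit_vector ` J. c b \<odot>\<^bsub>free_module J\<^esub> b) i =
      (if i \<in> J then c (unit_vector i) else 0)"
    if c: "c \<in> unit_vector ` J \<rightarrow>\<^sub>E carrier ZS" for c i
  proof -
    have "(\<Oplus>\<^bsub>free_module J\<^esub>b\<in>unit_vector ` J. c b \<odot>\<^bsub>free_module J\<^esub> b) =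
        (\<Sum>b\<in>unit_vector ` J. RS.smul (c b) b)"
      using J c by (subst finsum_free_module)
        (auto simp: free_module_def PiE_iff intro!: E.act_memM unit_vector_mem)
    also have "\<dots> = (\<Sum>j\<in>J. RS.smul (c (unit_vector j)) (unit_vector j))"
      using inj by (simp add: sum.reindex)
    finally have "(\<Oplus>\<^bsub>free_module J\<^esub>b\<in>unit_vector ` J. c b \<odot>\<^bsub>free_module J\<^esub> b) i =
        (\<Sum>j\<in>J. RS.smul (c (unit_vector j)) (unit_vector j)) i"
      by (rule fun_cong)
    also have "\<dots> = (\<Sum>j\<in>J. if i = j then c (unit_vector j) else 0)"
      unfolding sum_fun_apply
      by (rule sum.cong) (use c in \<open>auto simp: RS.smul_def unit_vector_def PiE_iff\<close>)
    finally show ?thesis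
      using J by simp
  qed
  have "module_basis ZS (free_module J) (unit_vector ` J)"
    unfolding module_basis_def
  proof (intro conjI ballI)
    show "unit_vector ` J \<subseteq> carrier (free_module J)"
      by (auto simp: free_module_def unit_vector_mem)
    fix x assume "x \<in> carrier (free_module J)"
    then have x: "x j \<in> carrier ZS" "j \<notin> J \<Longrightarrow> x j = 0" for j
      by (auto simp: free_module_def coords_def)
    let ?c = "restrict (\<lambda>b. x (the_inv_into J unit_vector b)) (unit_vector ` J)"
    show "\<exists>!c. c \<in> unit_vector ` J \<rightarrow>\<^sub>E carrier ZS \<and>
        x = (\<Oplus>\<^bsub>free_module J\<^esub>b\<in>unit_vector ` J. c b \<odot>\<^bsub>free_module J\<^esub> b)"
    proof (rule ex1I[of _ ?c])
      have c: "?c \<in> unit_vector ` J \<rightarrow>\<^sub>E carrier ZS"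
        using x(1) by auto
      have "x i = (\<Oplus>\<^bsub>free_module J\<^esub>b\<in>unit_vector ` J. ?c b \<odot>\<^bsub>free_module J\<^esub> b) i" for i
        unfolding comb[OF c] using x(2) by (auto simp: the_inv_into_f_f[OF inj])
      then show "?c \<in> unit_vector ` J \<rightarrow>\<^sub>E carrier ZS \<and>
          x = (\<Oplus>\<^bsub>free_module J\<^esub>b\<in>unit_vector ` J. ?c b \<odot>\<^bsub>free_module J\<^esub> b)"
        by (intro conjI c) (rule ext)
    next
      fix c assume c: "c \<in> unit_vector ` J \<rightarrow>\<^sub>E carrier ZS \<and>
          x = (\<Oplus>\<^bsub>free_module J\<^esub>b\<in>unit_vector ` J. c b \<odot>\<^bsub>free_module J\<^esub> b)"
      have "x i = (if i \<in> J then c (unit_vector i) else 0)" for i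
        by (rule trans[OF fun_cong[OF conjunct2[OF c], of i] comb[OF conjunct1[OF c], of i]])
      then have "c b = ?c b" for b
        using c by (cases "b \<in> unit_vector ` J") (auto simp: the_inv_into_f_f[OF inj] PiE_iff extensional_def)
      then show "c = ?c"
        by (rule ext)
    qed
  qed (use J in auto)
  then show ?thesis
    unfolding finitely_generated_free_def by (rule exI)
qed

text \<open>The converse: a free module on the index set of the generators is put in front of a resolution of
  their syzygies.\<close>

lemma resolves_of_cover:
  assumes M: "RS.lmod M act" and cov: "RS.free_covers M act J x"
    and k: "n = 0 \<or> n = Suc k \<and> resolves k A d \<phi> (RS.free_syz act J x) RS.smul"
  shows "\<exists>A d \<phi>. resolves n A d \<phi> M act"
proof -
  interpret M: module_on "carrier ZS" "mult ZS" "one ZS" M act by (rule M)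
  interpret E: module_on "carrier ZS" "mult ZS" "one ZS" "coords J" RS.smul
    by (rule lmod_coords)
  note D = RS.coversD[OF cov]
  define \<phi>' where "\<phi>' c = (\<Sum>j\<in>J. act (c j) (x j))" for c
  define A' where "A' = (\<lambda>i. case i of 0 \<Rightarrow> free_module J | Suc i \<Rightarrow> A i)"
  define d' where "d' = (\<lambda>i. case i of 0 \<Rightarrow> \<phi> | Suc i \<Rightarrow> d i)"
  have A'_simps: "A' 0 = free_module J" "A' (Suc i) = A i" "d' 0 = \<phi>" "d' (Suc i) = d i" for i
    by (simp_all add: A'_def d'_def)
  have cR: "c j \<in> carrier ZS" if "c \<in> coords J" for c j
    using that by (simp add: coords_def)
  have \<phi>'_add: "\<phi>' (c + d) = \<phi>' c + \<phi>' d" if "c \<in> coords J" "d \<in> coords J" for c d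
    using cR[OF that(1)] cR[OF that(2)] D(4) by (simp add: \<phi>'_def M.add_act sum.distrib)
  have \<phi>'_smul: "\<phi>' (RS.smul a c) = act a (\<phi>' c)" if "a \<in> carrier ZS" "c \<in> coords J" for a c
    using that(1) cR[OF that(2)] D(4) by (simp add: \<phi>'_def RS.smul_def M.mul_act M.act_sum)
  have \<phi>'_img: "\<phi>' ` coords J = M"
  proof (intro equalityI subsetI)
    fix m assume "m \<in> \<phi>' ` coords J"
    then show "m \<in> M"
      using cR D(4) by (auto simp: \<phi>'_def intro!: M.sum_memM)
  next
    fix m assume "m \<in> M"
    obtain c where c: "\<And>j. c j \<in> carrier ZS" "\<And>j. j \<notin> J \<Longrightarrow> c j = 0" "m = (\<Sum>j\<in>J. act (c j) (x j))"
      using RS.covers_coeffs[OF cov M \<open>m \<in> M\<close>] by metis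
    then show "m \<in> \<phi>' ` coords J"
      by (intro image_eqI[of _ _ c]) (auto simp: \<phi>'_def coords_def)
  qed
  have syz: "RS.free_syz act J x = {c \<in> coords J. \<phi>' c = 0}"
    by (auto simp: RS.syz_def coords_def \<phi>'_def)
  have base: "n = 0 \<Longrightarrow> resolves n A' d' \<phi>' M act"
    using \<phi>'_add \<phi>'_smul \<phi>'_img left_module_free_module[of J] finitely_generated_free_free_module[OF D(1)]
    by (simp add: resolves_def A'_simps) (simp add: free_module_def)
  have "resolves n A' d' \<phi>' M act" if n: "n = Suc k"
    and res: "resolves k A d \<phi> (RS.free_syz act J x) RS.smul"
  proof -
    have rest: "\<forall>i\<le>k. left_module ZS (A i) \<and> finitely_generated_free ZS (A i)"
      and \<phi>_add: "\<forall>x\<in>carrier (A 0). \<forall>y\<in>carrier (A 0). \<phi> (x \<oplus>\<^bsub>A 0\<^esub> y) = \<phi> x + \<phi> y"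
      and \<phi>_act: "\<forall>a\<in>carrier ZS. \<forall>x\<in>carrier (A 0). \<phi> (a \<odot>\<^bsub>A 0\<^esub> x) = RS.smul a (\<phi> x)"
      and \<phi>_img: "\<phi> ` carrier (A 0) = {c \<in> coords J. \<phi>' c = 0}"
      and hom: "\<forall>i<k. d i \<in> module_hom ZS (A (Suc i)) (A i)"
      and ex0: "0 < k \<longrightarrow> d 0 ` carrier (A 1) = {x \<in> carrier (A 0). \<phi> x = 0}"
      and ex: "\<forall>i. Suc i < k \<longrightarrow> d (Suc i) ` carrier (A (Suc (Suc i))) = a_kernel (A (Suc i)) (A i) (d i)"
      using res by (simp_all add: resolves_def syz)
    have hom0: "\<phi> \<in> module_hom ZS (A 0) (free_module J)"
      using \<phi>_add \<phi>_act \<phi>_img by (auto simp: module_hom_def free_module_def)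
    have ker0: "a_kernel (A 0) (free_module J) \<phi> = {x \<in> carrier (A 0). \<phi> x = 0}"
      by (simp add: a_kernel_def' free_module_def)
    have "left_module ZS (A' i) \<and> finitely_generated_free ZS (A' i)" if "i \<le> n" for i
      using that n rest left_module_free_module[of J] finitely_generated_free_free_module[OF D(1)]
      by (cases i) (auto simp: A'_simps)
    moreover have "d' i \<in> module_hom ZS (A' (Suc i)) (A' i)" if "i < n" for i
      using that n hom hom0 by (cases i) (auto simp: A'_simps)
    moreover have "d' (Suc i) ` carrier (A' (Suc (Suc i))) = a_kernel (A' (Suc i)) (A' i) (d' i)"
      if "Suc i < n" for i
      using that n ex0 ex ker0 by (cases i) (auto simp: A'_simps)
    moreover have "d' 0 ` carrier (A' 1) = {x \<in> carrier (A' 0). \<phi>' x = 0}"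
      using \<phi>_img by (simp add: A'_simps) (simp add: free_module_def)
    moreover have "\<phi>' (c \<oplus>\<^bsub>A' 0\<^esub> d) = \<phi>' c + \<phi>' d" if "c \<in> carrier (A' 0)" "d \<in> carrier (A' 0)" for c d
      using that \<phi>'_add by (simp add: A'_simps free_module_def)
    moreover have "\<phi>' (a \<odot>\<^bsub>A' 0\<^esub> c) = act a (\<phi>' c)" if "a \<in> carrier ZS" "c \<in> carrier (A' 0)" for a c
      using that \<phi>'_smul by (simp add: A'_simps free_module_def)
    moreover have "\<phi>' ` carrier (A' 0) = M"
      using \<phi>'_img by (simp add: A'_simps free_module_def)
    ultimately show ?thesis
      by (simp add: resolves_def)
  qed
  with base k show ?thesis
    by (intro exI[of _ A'] exI[of _ d'] exI[of _ \<phi>']) argo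
qed

lemma resolves_of_fp: "RS.fp (Suc n) K \<Longrightarrow> RS.lmod K RS.smul \<Longrightarrow> \<exists>A d \<phi>. resolves n A d \<phi> K RS.smul"
proof (induction n arbitrary: K)
  case 0
  obtain J x where "RS.free_covers K RS.smul J x"
    using RS.type_FP_free_cover[OF 0(2) 0(1)[unfolded RS.fp_Suc]] by metis
  from resolves_of_cover[OF 0(2) this] show ?case
    by simp
next
  case (Suc n)
  obtain J x where cov: "RS.free_covers K RS.smul J x"
    and fp: "RS.fp (Suc n) (RS.free_syz RS.smul J x)"
    using RS.type_FP_free_cover[OF Suc.prems(2) Suc.prems(1)[unfolded RS.fp_Suc[of "Suc n"]]] by metis
  obtain A d \<phi> where "resolves n A d \<phi> (RS.free_syz RS.smul J x) RS.smul"
    using Suc.IH[OF fp RS.lmod_syz[OF Suc.prems(2) cov]] by (elim exE)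
  then show ?case
    by (intro resolves_of_cover[OF Suc.prems(2) cov, where k = n and A = A and d = d and \<phi> = \<phi>]) simp
qed

lemma resolves_of_type_FP:
  assumes M: "RS.lmod M act" and FP: "RS.type_FP n M act"
  shows "\<exists>A d \<phi>. resolves n A d \<phi> M act"
proof -
  obtain J x where cov: "RS.free_covers M act J x"
    and fp: "RS.fp n (RS.free_syz act J x)"
    using RS.type_FP_free_cover[OF M FP] by metis
  show ?thesis
  proof (cases n)
    case 0
    then show ?thesis
      by (intro resolves_of_cover[OF M cov]) simp
  next
    case (Suc k)
    then obtain A d \<phi> where "resolves k A d \<phi> (RS.free_syz act J x) RS.smul"
      using resolves_of_fp[of k] fp RS.lmod_syz[OF M cov] by metis
    with Suc show ?thesis
      by (intro resolves_of_cover[OF M cov, where k = k and A = A and d = d and \<phi> = \<phi>]) simp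
  qed
qed

theorem monoid_left_FP_iff_type_FP: "monoid_left_FP n S \<longleftrightarrow> RS.type_FP n UNIV triv"
  unfolding monoid_left_FP_resolves
  using type_FP_of_resolves[OF lmod_triv] resolves_of_type_FP[OF lmod_triv] by metis

end

section \<open>Linear extension of maps of monoids\<close>

abbreviation push :: "('a \<Rightarrow> 'b) \<Rightarrow> ('a \<Rightarrow>\<^sub>0 int) \<Rightarrow> 'b \<Rightarrow>\<^sub>0 int" where
  "push h \<equiv> frag_extend (frag_of \<circ> h)"

text \<open>A disjoint decomposition of a set into injective images of the \<open>G i\<close> is a direct decomposition
  of the free abelian group on it. Applied to \<open>Ue\<close> and \<open>eU\<close> as unions of translates of a
  group, and to \<open>U\<close> as the union of its left classes.\<close>

lemma frag_decomposition:
  fixes k :: "'i \<Rightarrow> 'g \<Rightarrow> 's"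
  assumes "finite I" and cover: "supp a \<subseteq> (\<Union>i\<in>I. k i ` G i)"
  shows "\<exists>t. (\<forall>i\<in>I. supp (t i) \<subseteq> G i) \<and> a = (\<Sum>i\<in>I. push (k i) (t i))"
  using cover
proof (induction a rule: frag_induction)
  case zero
  show ?case
    by (intro exI[of _ "\<lambda>_. 0"]) simp
next
  case (one s)
  then obtain i g where ig: "i \<in> I" "g \<in> G i" "s = k i g"
    by auto
  have "(\<Sum>j\<in>I. push (k j) (if j = i then frag_of g else 0)) =
      (\<Sum>j\<in>I. if j = i then frag_of s else 0)"
    by (rule sum.cong) (auto simp: ig(3))
  also have "\<dots> = frag_of s"
    using ig(1) \<open>finite I\<close> by simp
  finally have "frag_of s = (\<Sum>j\<in>I. push (k j) (if j = i then frag_of g else 0))" ..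
  moreover have "\<forall>j\<in>I. supp (if j = i then frag_of g else 0) \<subseteq> G j"
    using ig(2) by auto
  ultimately show ?case
    by (intro exI[of _ "\<lambda>j. if j = i then frag_of g else 0"] conjI)
next
  case (diff a b)
  obtain s where s: "\<forall>i\<in>I. supp (s i) \<subseteq> G i"
    "a = (\<Sum>i\<in>I. push (k i) (s i))" 
    using diff.IH(1) by (elim exE conjE)
  obtain t where t: "\<forall>i\<in>I. supp (t i) \<subseteq> G i"
    "b = (\<Sum>i\<in>I. push (k i) (t i))"
    using diff.IH(2) by (elim exE conjE)
  have "supp (s i - t i) \<subseteq> G i" if "i \<in> I" for i
    using s(1) t(1) that keys_diff[of "s i" "t i"] by blast
  moreover have "a - b = (\<Sum>i\<in>I. push (k i) (s i - t i))"
    unfolding s(2) t(2) by (simp only: frag_extend_diff sum_subtractf)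
  ultimately show ?case
    by (intro exI[of _ "\<lambda>i. s i - t i"] conjI ballI)
qed

lemma frag_decomposition_unique:
  fixes k :: "'i \<Rightarrow> 'g \<Rightarrow> 's"
  assumes "finite I" and inj: "\<And>i. i \<in> I \<Longrightarrow> inj_on (k i) (G i)"
    and disj: "\<And>i j. i \<in> I \<Longrightarrow> j \<in> I \<Longrightarrow> i \<noteq> j \<Longrightarrow> k i ` G i \<inter> k j ` G j = {}"
    and t: "\<And>i. i \<in> I \<Longrightarrow> supp (t i) \<subseteq> G i"
    and sum: "(\<Sum>i\<in>I. push (k i) (t i)) = 0" and i: "i \<in> I"
  shows "t i = 0"
proof -
  define \<pi> where "\<pi> s = (if s \<in> k i ` G i then frag_of (the_inv_into (G i) (k i) s) else 0)" for s
  have proj: "frag_extend \<pi> (push (k j) (t j)) = (if j = i then t j else 0)"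
    if j: "j \<in> I" for j
  proof -
    have "frag_extend \<pi> (push (k j) (t j)) = frag_extend (\<pi> \<circ> k j) (t j)"
      by (rule frag_extend_compose)
    also have "\<dots> = frag_extend (\<lambda>g. if j = i then frag_of g else 0) (t j)"
    proof (rule frag_extend_eq)
      fix g assume "g \<in> supp (t j)"
      then have g: "g \<in> G j"
        using t[OF j] by blast
      show "(\<pi> \<circ> k j) g = (if j = i then frag_of g else 0)"
      proof (cases "j = i")
        case True
        then show ?thesis
          using g inj[OF j] by (simp add: \<pi>_def the_inv_into_f_f)
      next
        case False
        then show ?thesis
          using g disj[OF i j] by (auto simp: \<pi>_def)
      qed
    qed
    also have "\<dots> = (if j = i then t j else 0)"
      using frag_expansion[of "t j"] by (auto simp: frag_extend_eq_0)
    finally show ?thesis .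
  qed
  have "0 = frag_extend \<pi> (\<Sum>j\<in>I. push (k j) (t j))"
    by (simp add: sum)
  also have "\<dots> = (\<Sum>j\<in>I. if j = i then t j else 0)"
    using \<open>finite I\<close> by (simp add: frag_extend_sum proj)
  finally show ?thesis
    using i \<open>finite I\<close> by simp
qed

lemma frag_of_mult:
  "frag_of s \<otimes>\<^bsub>monoid_ring S\<^esub> c = frag_extend (\<lambda>t. frag_of (s \<otimes>\<^bsub>S\<^esub> t)) c"
proof -
  have "supp c \<subseteq> UNIV" by simp
  then show ?thesis
    by (induction c rule: frag_induction)
      (simp_all add: monoid_ring_mult_single monoid_ring_mult_diff frag_extend_diff)
qed

lemma mult_frag_of:
  "c \<otimes>\<^bsub>monoid_ring S\<^esub> frag_of t = frag_extend (\<lambda>s. frag_of (s \<otimes>\<^bsub>S\<^esub> t)) c"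
proof -
  have "supp c \<subseteq> UNIV" by simp
  then show ?thesis
    by (induction c rule: frag_induction)
      (simp_all add: monoid_ring_mult_single monoid_ring_diff_mult frag_extend_diff)
qed

lemma augmentation_frag_extend: "augmentation (push h c) = augmentation c"
proof -
  have "supp c \<subseteq> UNIV" by simp
  then show ?thesis
    by (induction c rule: frag_induction) (simp_all add: frag_extend_diff augmentation_diff)
qed

lemma keys_frag_extend_of:
  "supp (push h c) \<subseteq> h ` supp c"
  by (rule order_trans[OF keys_frag_extend]) auto

lemma frag_extend_hom:
  assumes "\<And>x y. x \<in> carrier G \<Longrightarrow> y \<in> carrier G \<Longrightarrow> h (x \<otimes>\<^bsub>G\<^esub> y) = h x \<otimes>\<^bsub>S\<^esub> h y"
    and "c \<in> carrier (monoid_ring G)" "d \<in> carrier (monoid_ring G)"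
  shows "push h (c \<otimes>\<^bsub>monoid_ring G\<^esub> d) =
    push h c \<otimes>\<^bsub>monoid_ring S\<^esub> push h d"
proof -
  have c: "supp c \<subseteq> carrier G" and d: "supp d \<subseteq> carrier G"
    using assms(2,3) by (simp_all add: monoid_ring_def)
  from c show ?thesis
  proof (induction c rule: frag_induction)
    case (one s)
    from d show ?case
      by (induction d rule: frag_induction)
        (simp_all add: one assms(1) monoid_ring_mult_single monoid_ring_mult_diff frag_extend_diff)
  qed (simp_all add: monoid_ring_diff_mult frag_extend_diff)
qed

lemma ring_corner_monoid_ring:
  assumes "integral_monoid_ring S" "integral_monoid_ring G"
    and "\<And>x. x \<in> carrier G \<Longrightarrow> h x \<in> carrier S"
    and "\<And>x y. x \<in> carrier G \<Longrightarrow> y \<in> carrier G \<Longrightarrow> h (x \<otimes>\<^bsub>G\<^esub> y) = h x \<otimes>\<^bsub>S\<^esub> h y"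
  shows "ring_corner (carrier (monoid_ring S)) (mult (monoid_ring S)) (one (monoid_ring S))
    (carrier (monoid_ring G)) (mult (monoid_ring G)) (one (monoid_ring G)) (push h)"
proof -
  interpret S: integral_monoid_ring S by fact
  interpret G: integral_monoid_ring G by fact
  show ?thesis
  proof unfold_locales
    fix t assume t: "t \<in> carrier (monoid_ring G)"
    have "h ` supp t \<subseteq> carrier S"
      using t assms(3) by (auto simp: G.ZS_simps)
    then show "push h t \<in> carrier (monoid_ring S)"
      unfolding S.ZS_simps by (rule order_trans[OF keys_frag_extend_of])
  qed (simp_all add: frag_extend_add frag_extend_hom[OF assms(4)])
qed

section \<open>Isomorphic and opposite monoids\<close>

text \<open>An isomorphism of monoids is the extreme case \<open>e = 1\<close> of a corner, with a single basis
  element.\<close>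

lemma monoid_left_FP_isomorphic:
  fixes S :: "('a, 'k) monoid_scheme" and G :: "('b, 'l) monoid_scheme"
  assumes "Group.monoid S" "Group.monoid G"
    and bij: "bij_betw h (carrier G) (carrier S)" and one: "h \<one>\<^bsub>G\<^esub> = \<one>\<^bsub>S\<^esub>"
    and hom: "\<And>x y. x \<in> carrier G \<Longrightarrow> y \<in> carrier G \<Longrightarrow> h (x \<otimes>\<^bsub>G\<^esub> y) = h x \<otimes>\<^bsub>S\<^esub> h y"
    and FP: "monoid_left_FP n S"
  shows "monoid_left_FP n G"
proof -
  interpret S: integral_monoid_ring S
    using assms(1) by (rule integral_monoid_ring.intro)
  interpret G: integral_monoid_ring G
    using assms(2) by (rule integral_monoid_ring.intro)
  let ?\<iota> = "push h"
  interpret C: ring_corner "carrier S.ZS" "mult S.ZS" "one S.ZS"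
    "carrier G.ZS" "mult G.ZS" "one G.ZS" ?\<iota>
    using bij hom
    by (intro ring_corner_monoid_ring S.integral_monoid_ring_axioms G.integral_monoid_ring_axioms)
      (auto simp: bij_betw_def)
  have e: "?\<iota> \<one>\<^bsub>G.ZS\<^esub> = \<one>\<^bsub>S.ZS\<^esub>"
    by (simp add: S.ZS_simps G.ZS_simps one)
  let ?g = "the_inv_into (carrier G) h"
  have g: "?g (h x) = x" if "x \<in> carrier G" for x
    using bij that by (simp add: bij_betw_def the_inv_into_f_f)
  have hg: "h (?g y) = y" "?g y \<in> carrier G" if "y \<in> carrier S" for y
    using bij that by (auto simp: bij_betw_def f_the_inv_into_f the_inv_into_into)
  have inj: "t = 0" if "t \<in> carrier G.ZS" "?\<iota> t = 0" for t
  proof -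
    have "push ?g (?\<iota> t) = frag_extend (frag_of \<circ> ?g \<circ> h) t"
      by (rule frag_extend_compose)
    also have "\<dots> = frag_extend frag_of t"
      by (rule frag_extend_eq) (use that(1) g in \<open>auto simp: G.ZS_simps\<close>)
    finally show "t = 0"
      using that(2) frag_expansion[of t] by simp
  qed
  interpret C: left_free_corner "carrier S.ZS" "mult S.ZS" "one S.ZS"
    "carrier G.ZS" "mult G.ZS" "one G.ZS" ?\<iota>
    "{0}" "\<lambda>_. \<one>\<^bsub>S.ZS\<^esub>"
  proof unfold_locales
    fix a assume a: "a \<in> carrier S.ZS"
    let ?t = "push ?g a"
    have "?g ` supp a \<subseteq> carrier G"
      using a hg(2) by (auto simp: S.ZS_simps)
    then have t: "?t \<in> carrier G.ZS"
      unfolding G.ZS_simps by (rule order_trans[OF keys_frag_extend_of])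
    have "?\<iota> ?t = frag_extend (frag_of \<circ> h \<circ> ?g) a"
      by (rule frag_extend_compose)
    also have "\<dots> = frag_extend frag_of a"
      by (rule frag_extend_eq) (use a hg(1) in \<open>auto simp: S.ZS_simps\<close>)
    finally have "a = ?\<iota> ?t"
      using frag_expansion[of a] by simp
    then show "\<exists>t. (\<forall>l\<in>{0::nat}. t l \<in> carrier G.ZS) \<and>
        a = (\<Sum>l\<in>{0}. ?\<iota> (t l) \<otimes>\<^bsub>S.ZS\<^esub> \<one>\<^bsub>S.ZS\<^esub>)"
      using t a by (intro exI[of _ "\<lambda>_. ?t"]) simp
  next
    fix t :: "nat \<Rightarrow> 'b \<Rightarrow>\<^sub>0 int" and l :: nat
    assume t: "\<And>l. l \<in> {0} \<Longrightarrow> t l \<in> carrier G.ZS" and l: "l \<in> {0}"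
      and s: "(\<Sum>l\<in>{0}. ?\<iota> (t l) \<otimes>\<^bsub>S.ZS\<^esub> \<one>\<^bsub>S.ZS\<^esub>) = 0"
    have "?\<iota> (t 0) = 0"
      using s C.\<iota>_mem[OF t[of 0]] by simp
    then show "t l = 0"
      using inj t l by simp
  qed (simp_all add: e)
  have "C.restricts id UNIV G.triv UNIV S.triv"
    by (simp add: C.restricts_def augmentation_frag_extend e) (simp add: S.ZS_simps)
  then show ?thesis
    using FP C.type_FP_restrict[OF S.lmod_triv G.lmod_triv]
    unfolding S.monoid_left_FP_iff_type_FP G.monoid_left_FP_iff_type_FP by blast
qed

definition opposite :: "('a, 'k) monoid_scheme \<Rightarrow> 'a monoid" where
  "opposite S = \<lparr>carrier = carrier S, mult = (\<lambda>x y. y \<otimes>\<^bsub>S\<^esub> x), one = \<one>\<^bsub>S\<^esub>\<rparr>"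

lemma monoid_opposite: "Group.monoid S \<Longrightarrow> Group.monoid (opposite S)"
  by (rule monoidI)
    (simp_all add: opposite_def monoid.m_closed monoid.one_closed monoid.m_assoc
      monoid.l_one monoid.r_one)

lemma monoid_ring_opposite_simps:
  "carrier (monoid_ring (opposite S)) = carrier (monoid_ring S)"
  "one (monoid_ring (opposite S)) = one (monoid_ring S)"
  "add (monoid_ring (opposite S)) = add (monoid_ring S)"
  "a \<otimes>\<^bsub>monoid_ring (opposite S)\<^esub> b = b \<otimes>\<^bsub>monoid_ring S\<^esub> a"
proof -
  show "a \<otimes>\<^bsub>monoid_ring (opposite S)\<^esub> b = b \<otimes>\<^bsub>monoid_ring S\<^esub> a"
    by (simp add: monoid_ring_def opposite_def mult.commute) (rule sum.swap)
qed (simp_all add: monoid_ring_def opposite_def)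

text \<open>Reversing the multiplication of a monoid reverses that of its monoid ring, which
  is all that distinguishes left from right modules. Homomorphisms and bases do not involve it.\<close>

lemma left_module_opposite_iff:
  assumes "Group.monoid S"
  shows "left_module (monoid_ring (opposite S)) M \<longleftrightarrow> right_module (monoid_ring S) M"
  using ring_monoid_ring[OF assms] ring_monoid_ring[OF monoid_opposite[OF assms]]
  by (auto simp: left_module_def right_module_def left_module_axioms_def right_module_axioms_def
      monoid_ring_opposite_simps)

lemma monoid_right_FP_eq:
  assumes "Group.monoid S"
  shows "monoid_right_FP n S \<longleftrightarrow> monoid_left_FP n (opposite S)"
  by (simp add: monoid_right_FP_def monoid_left_FP_def left_module_opposite_iff[OF assms]
      finitely_generated_free_def module_basis_def exact_to_trivial_def module_hom_def
      monoid_ring_opposite_simps)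

lemma group_left_FP_opposite:
  assumes "Group.group G" "monoid_left_FP n G"
  shows "monoid_left_FP n (opposite G)"
proof -
  interpret Group.group G by fact
  show ?thesis
  proof (rule monoid_left_FP_isomorphic[where h = "m_inv G" and S = G])
    show "bij_betw (m_inv G) (carrier (opposite G)) (carrier G)"
      by (rule bij_betwI[where g = "m_inv G"]) (auto simp: opposite_def)
  qed (use assms monoid_opposite is_monoid in \<open>auto simp: opposite_def inv_mult_group\<close>)
qed

section \<open>Completely simple semigroups\<close>

text \<open>The two cancellation properties say that \<open>U\<close> is the union of its minimal left ideals \<open>Ua\<close> and of
  its minimal right ideals \<open>aU\<close>. They are interchanged by passing to the opposite
  multiplication, which provides the left-handed half of the statements below.\<close>

locale completely_simple =
  fixes U :: "'a set" and f :: "'a \<Rightarrow> 'a \<Rightarrow> 'a" (infixl "\<cdot>" 70)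
  assumes closed [simp, intro]: "x \<in> U \<Longrightarrow> y \<in> U \<Longrightarrow> x \<cdot> y \<in> U"
    and assoc: "x \<in> U \<Longrightarrow> y \<in> U \<Longrightarrow> z \<in> U \<Longrightarrow> x \<cdot> y \<cdot> z = x \<cdot> (y \<cdot> z)"
    and left_simple: "a \<in> U \<Longrightarrow> b \<in> U \<Longrightarrow> \<exists>c\<in>U. c \<cdot> (b \<cdot> a) = a"
    and right_simple: "a \<in> U \<Longrightarrow> b \<in> U \<Longrightarrow> \<exists>c\<in>U. a \<cdot> b \<cdot> c = a"

lemma left_ideal_flip: "left_ideal U (\<lambda>x y. f y x) = right_ideal U f"
  and right_ideal_flip: "right_ideal U (\<lambda>x y. f y x) = left_ideal U f"
  by (auto simp: left_ideal_def right_ideal_def fun_eq_iff)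

lemma completely_simple_semigroup_flip:
  "completely_simple_semigroup U f \<Longrightarrow> completely_simple_semigroup U (\<lambda>x y. f y x)"
  by (auto simp: completely_simple_semigroup_def simple_semigroup_def semigroup_on_def
      two_sided_ideal_def minimal_left_ideal_def minimal_right_ideal_def
      left_ideal_flip[of U f] right_ideal_flip[of U f])

text \<open>For a minimal left ideal \<open>L\<close> every translate \<open>Ls\<close> is again a minimal left ideal. The union of the
  translates is a two-sided ideal, hence all of \<open>U\<close> by simplicity. So \<open>a\<close> lies in a minimal left
  ideal, and this must coincide with its left subideal \<open>Uba\<close>.\<close>

lemma minimal_left_ideal_absorbs:
  assumes "completely_simple_semigroup U f" "a \<in> U" "b \<in> U"
  shows "\<exists>c\<in>U. f c (f b a) = a"
proof -
  have clos: "f x y \<in> U" if "x \<in> U" "y \<in> U" for x y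
    using assms(1) that
    by (simp add: completely_simple_semigroup_def simple_semigroup_def semigroup_on_def)
  have assoc: "f (f x y) z = f x (f y z)" if "x \<in> U" "y \<in> U" "z \<in> U" for x y z
    using assms(1) that
    by (simp add: completely_simple_semigroup_def simple_semigroup_def semigroup_on_def)
  have simple: "V = U" if "left_ideal U f V" "right_ideal U f V" for V
    using assms(1) that
    by (simp add: completely_simple_semigroup_def simple_semigroup_def two_sided_ideal_def)
  obtain L where "minimal_left_ideal U f L"
    using assms(1) by (auto simp: completely_simple_semigroup_def)
  then have L: "left_ideal U f L" and L_min: "\<And>V. left_ideal U f V \<Longrightarrow> V \<subseteq> L \<Longrightarrow> V = L"
    by (auto simp: minimal_left_ideal_def)
  have LU: "x \<in> U" if "x \<in> L" for x
    using L that by (auto simp: left_ideal_def)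
  have Ls_min: "V = (\<lambda>x. f x s) ` L" if s: "s \<in> U" and V: "left_ideal U f V" "V \<subseteq> (\<lambda>x. f x s) ` L" for s V
  proof -
    have "left_ideal U f {x \<in> L. f x s \<in> V}"
      unfolding left_ideal_def
    proof (intro conjI ballI)
      show "{x \<in> L. f x s \<in> V} \<noteq> {}"
        using V by (auto simp: left_ideal_def)
      show "f t x \<in> {x \<in> L. f x s \<in> V}" if "t \<in> U" "x \<in> {x \<in> L. f x s \<in> V}" for t x
        using that L V s LU by (auto simp: left_ideal_def assoc)
    qed (use LU in auto)
    then have "{x \<in> L. f x s \<in> V} = L"
      by (rule L_min) auto
    then show ?thesis
      using V(2) by auto
  qed
  let ?W = "\<Union>s\<in>U. (\<lambda>x. f x s) ` L"
  have "L \<noteq> {}"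
    using L by (simp add: left_ideal_def)
  have W_l: "left_ideal U f ?W"
    unfolding left_ideal_def
  proof (intro conjI ballI)
    show "?W \<noteq> {}"
      using \<open>L \<noteq> {}\<close> assms(2) by auto
    show "?W \<subseteq> U"
      using LU clos by auto
    fix t w assume t: "t \<in> U" and "w \<in> ?W"
    then obtain s x where sx: "s \<in> U" "x \<in> L" "w = f x s"
      by auto
    then have "f t w = f (f t x) s" "f t x \<in> L"
      using t L LU by (auto simp: assoc left_ideal_def)
    then show "f t w \<in> ?W"
      using sx(1) by auto
  qed
  have W_r: "right_ideal U f ?W"
    unfolding right_ideal_def
  proof (intro conjI ballI)
    show "?W \<noteq> {}" "?W \<subseteq> U"
      using W_l unfolding left_ideal_def by blast+
    fix t w assume t: "t \<in> U" and "w \<in> ?W"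
    then obtain s x where sx: "s \<in> U" "x \<in> L" "w = f x s"
      by auto
    then have "f w t = f x (f s t)" "f s t \<in> U"
      using t LU clos by (auto simp: assoc)
    then show "f w t \<in> ?W"
      using sx(2) by auto
  qed
  obtain s where s: "s \<in> U" "a \<in> (\<lambda>x. f x s) ` L"
    using simple[OF W_l W_r] assms(2) by blast
  then obtain x where x: "x \<in> L" "a = f x s"
    by auto
  let ?V = "(\<lambda>c. f c (f b a)) ` U"
  have ba: "f b a \<in> U"
    using clos assms by simp
  have "?V \<subseteq> (\<lambda>x. f x s) ` L"
  proof
    fix v assume "v \<in> ?V"
    then obtain c where c: "c \<in> U" "v = f c (f b a)"
      by auto
    then have "v = f (f c (f b x)) s"
      using x s(1) assms(3) LU clos by (simp add: assoc)
    moreover have "f c (f b x) \<in> L"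
      using c(1) assms(3) x(1) L by (simp add: left_ideal_def)
    ultimately show "v \<in> (\<lambda>x. f x s) ` L"
      by simp
  qed
  moreover have "left_ideal U f ?V"
    unfolding left_ideal_def
  proof (intro conjI ballI)
    fix t v assume "t \<in> U" "v \<in> ?V"
    then show "f t v \<in> ?V"
      using ba clos by (auto simp: assoc[symmetric])
  qed (use assms clos in auto)
  ultimately have "?V = (\<lambda>x. f x s) ` L"
    using Ls_min[OF s(1)] by simp
  then show ?thesis
    using s(2) by (metis (no_types, lifting) imageE)
qed

lemma completely_simple_semigroup_imp:
  assumes "completely_simple_semigroup U f"
  shows "completely_simple U f"
proof
  show "\<exists>c\<in>U. f c (f b a) = a" if "a \<in> U" "b \<in> U" for a b
    by (rule minimal_left_ideal_absorbs[OF assms that])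
  show "\<exists>c\<in>U. f (f a b) c = a" if "a \<in> U" "b \<in> U" for a b
    by (rule minimal_left_ideal_absorbs[OF completely_simple_semigroup_flip[OF assms] that])
qed (use assms in \<open>auto simp: completely_simple_semigroup_def simple_semigroup_def semigroup_on_def\<close>)

context completely_simple
begin

lemma flip: "completely_simple U (\<lambda>x y. y \<cdot> x)"
  by unfold_locales (use assoc left_simple right_simple in auto)

definition right_class :: "'a \<Rightarrow> 'a set" where
  "right_class a = (\<lambda>s. a \<cdot> s) ` U"

definition left_class :: "'a \<Rightarrow> 'a set" where
  "left_class a = (\<lambda>s. s \<cdot> a) ` U"

lemma left_class_flip: "completely_simple.right_class U (\<lambda>x y. y \<cdot> x) = left_class"
  by (intro ext) (simp add: completely_simple.right_class_def[OF flip] left_class_def)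

lemma right_class_mult:
  assumes "a \<in> U" "b \<in> U"
  shows "right_class (a \<cdot> b) = right_class a"
proof -
  have sub: "right_class (a \<cdot> b) \<subseteq> right_class a" if "a \<in> U" "b \<in> U" for a b
    using that by (auto simp: right_class_def assoc)
  obtain c where "c \<in> U" "a \<cdot> b \<cdot> c = a"
    using right_simple[OF assms] by blast
  with sub[of "a \<cdot> b" c] sub[OF assms] assms show ?thesis
    by auto
qed

lemma right_class_self: "a \<in> U \<Longrightarrow> a \<in> right_class a"
  using right_simple[of a a] assoc unfolding right_class_def
  by (metis (no_types, lifting) closed image_eqI)

lemma left_class_mult: "a \<in> U \<Longrightarrow> b \<in> U \<Longrightarrow> left_class (a \<cdot> b) = left_class b"
  using completely_simple.right_class_mult[OF flip] by (simp add: left_class_flip)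

lemma left_class_self: "a \<in> U \<Longrightarrow> a \<in> left_class a"
  using completely_simple.right_class_self[OF flip] by (simp add: left_class_flip)

text \<open>By \<open>right_class_mult\<close> the class of a product of generators is that of the first one.\<close>

lemma finite_right_classes:
  assumes "finitely_generated_semigroup U f"
  shows "finite (right_class ` U)"
proof -
  obtain X where X: "finite X" "X \<subseteq> U" "subsemigroup_generated f X = U"
    using assms by (auto simp: finitely_generated_semigroup_def)
  let ?T = "{s \<in> U. right_class s \<in> right_class ` X}"
  have "subsemigroup_generated f X \<subseteq> ?T"
    unfolding subsemigroup_generated_def
    using X(2) by (intro Inter_lower) (auto simp: right_class_mult)
  then have "right_class ` U \<subseteq> right_class ` X"
    unfolding X(3) by auto
  then show ?thesis
    using X(1) finite_surj by blast
qed

lemma finitely_generated_semigroup_flip: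
  assumes "finitely_generated_semigroup U f"
  shows "finitely_generated_semigroup U (\<lambda>x y. y \<cdot> x)"
proof -
  have "subsemigroup_generated (\<lambda>x y. y \<cdot> x) X = subsemigroup_generated f X" for X
    by (simp add: subsemigroup_generated_def) (metis (no_types, lifting))
  with assms show ?thesis
    by (simp add: finitely_generated_semigroup_def)
qed

lemma finite_left_classes:
  assumes "finitely_generated_semigroup U f"
  shows "finite (left_class ` U)"
  using completely_simple.finite_right_classes[OF flip finitely_generated_semigroup_flip[OF assms]]
  by (simp add: left_class_flip)

definition idem :: "'a \<Rightarrow> bool" where
  "idem e \<longleftrightarrow> e \<in> U \<and> e \<cdot> e = e"

text \<open>Write \<open>a = d \<cdot> a \<cdot> a = a \<cdot> a \<cdot> c\<close>. Then \<open>d \<cdot> a = a \<cdot> c\<close> is an identity for \<open>a\<close> on both sides, and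
  hence idempotent.\<close>

lemma idem_in_left_class:
  assumes "a \<in> U"
  obtains e where "idem e" "left_class e = left_class a"
proof -
  obtain d where d: "d \<in> U" "d \<cdot> (a \<cdot> a) = a"
    using left_simple[OF assms assms] by blast
  obtain c where c: "c \<in> U" "a \<cdot> a \<cdot> c = a"
    using right_simple[OF assms assms] by blast
  have "d \<cdot> a = d \<cdot> (a \<cdot> a \<cdot> c)"
    using c by simp
  also have "\<dots> = d \<cdot> (a \<cdot> a) \<cdot> c"
    using assms c(1) d(1) by (intro assoc[symmetric]) auto
  finally have da: "d \<cdot> a = a \<cdot> c"
    using d by simp
  have "d \<cdot> a \<cdot> (d \<cdot> a) = d \<cdot> (a \<cdot> (d \<cdot> a))"
    using assms d(1) by (simp add: assoc)
  also have "a \<cdot> (d \<cdot> a) = a"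
    using assms c by (simp add: da assoc)
  finally have "idem (d \<cdot> a)"
    using assms d(1) by (simp add: idem_def)
  moreover have "left_class (d \<cdot> a) = left_class a"
    by (rule left_class_mult[OF d(1) assms])
  ultimately show thesis
    by (rule that)
qed

definition subgrp :: "'a \<Rightarrow> 'a set" where
  "subgrp e = {x \<in> U. e \<cdot> x = x \<and> x \<cdot> e = x}"

lemma subgrp_flip: "completely_simple.subgrp U (\<lambda>x y. y \<cdot> x) = subgrp"
  by (intro ext) (auto simp: completely_simple.subgrp_def[OF flip] subgrp_def)

lemma subgrp_left_inverse:
  assumes "idem e" "x \<in> subgrp e"
  shows "\<exists>y\<in>subgrp e. y \<cdot> x = e"
proof -
  have e: "e \<in> U" "e \<cdot> e = e" and x: "x \<in> U" "e \<cdot> x = x" "x \<cdot> e = x"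
    using assms by (auto simp: idem_def subgrp_def)
  obtain c where c: "c \<in> U" "c \<cdot> (x \<cdot> e) = e"
    using left_simple[OF e(1) x(1)] by blast
  have "e \<cdot> c \<cdot> e \<cdot> x = e"
    using e x c by (simp add: assoc)
  moreover have "e \<cdot> c \<cdot> e \<in> subgrp e"
    using e c(1) by (simp add: subgrp_def assoc) (simp flip: assoc)
  ultimately show ?thesis
    by blast
qed

text \<open>All of \<open>eUe\<close> consists of units: by left cancellation each of its elements has a left inverse in
  \<open>eUe\<close>, which is enough for a group.\<close>

lemma maximal_subgroup_eq:
  assumes "idem e"
  shows "maximal_subgroup U f e = \<lparr>carrier = subgrp e, mult = f, one = e\<rparr>"
    and group_subgrp: "Group.group \<lparr>carrier = subgrp e, mult = f, one = e\<rparr>"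
proof -
  have e: "e \<in> U" "e \<cdot> e = e"
    using assms by (auto simp: idem_def)
  let ?G = "\<lparr>carrier = subgrp e, mult = f, one = e\<rparr>"
  show group: "Group.group ?G"
  proof (rule groupI)
    fix x y assume "x \<in> carrier ?G" "y \<in> carrier ?G"
    then show "x \<otimes>\<^bsub>?G\<^esub> y \<in> carrier ?G"
      using e by (auto simp: subgrp_def assoc) (simp flip: assoc)
  next
    fix x assume "x \<in> carrier ?G"
    then show "\<exists>y\<in>carrier ?G. y \<otimes>\<^bsub>?G\<^esub> x = \<one>\<^bsub>?G\<^esub>"
      using subgrp_left_inverse[OF assms] by simp
  qed (use e in \<open>auto simp: subgrp_def assoc\<close>)
  have "(\<lambda>x. e \<cdot> x \<cdot> e) ` U = subgrp e"
  proof (intro equalityI subsetI)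
    fix x assume "x \<in> (\<lambda>x. e \<cdot> x \<cdot> e) ` U"
    then obtain y where y: "y \<in> U" "x = e \<cdot> y \<cdot> e"
      by auto
    have "e \<cdot> (e \<cdot> y \<cdot> e) = e \<cdot> e \<cdot> y \<cdot> e"
      using y e(1) by (simp add: assoc)
    moreover have "e \<cdot> y \<cdot> e \<cdot> e = e \<cdot> y \<cdot> (e \<cdot> e)"
      using y e(1) by (simp add: assoc)
    ultimately show "x \<in> subgrp e"
      using y e by (simp add: subgrp_def)
  next
    fix x assume "x \<in> subgrp e"
    then show "x \<in> (\<lambda>x. e \<cdot> x \<cdot> e) ` U"
      by (intro image_eqI[of _ _ x]) (auto simp: subgrp_def)
  qed
  then have local: "local_monoid U f e = ?G"
    by (simp add: local_monoid_def)
  interpret G: Group.group ?G by (rule group)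
  show "maximal_subgroup U f e = ?G"
    using G.Units_eq by (simp add: maximal_subgroup_def local units_of_def)
qed

text \<open>\<open>Ue\<close> is a free right \<open>G\<close>-set for \<open>G = subgrp e\<close>, with the right classes as orbits:
  two elements of \<open>Ue\<close> in one class differ by right multiplication with an element of \<open>U\<close>,
  which may be cut down to \<open>eUe\<close>, and left cancellation makes the action free.\<close>

lemma right_section:
  assumes "idem e"
  obtains r where "\<And>i. i \<in> right_class ` U \<Longrightarrow> r i \<in> U"
    "\<And>i. i \<in> right_class ` U \<Longrightarrow> r i \<cdot> e = r i"
    "\<And>i. i \<in> right_class ` U \<Longrightarrow> right_class (r i) = i"
    "\<And>a. a \<in> U \<Longrightarrow> a \<cdot> e = a \<Longrightarrow> \<exists>g\<in>subgrp e. a = r (right_class a) \<cdot> g"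
    "\<And>i. i \<in> right_class ` U \<Longrightarrow> inj_on (\<lambda>g. r i \<cdot> g) (subgrp e)"
proof -
  have e: "e \<in> U" "e \<cdot> e = e"
    using assms by (auto simp: idem_def)
  have "\<exists>r. i \<in> right_class ` U \<longrightarrow> r \<in> U \<and> r \<cdot> e = r \<and> right_class r = i" for i
  proof (cases "i \<in> right_class ` U")
    case True
    then obtain s where "s \<in> U" "i = right_class s"
      by blast
    then show ?thesis
      using e by (intro exI[of _ "s \<cdot> e"]) (simp add: right_class_mult assoc)
  qed simp
  then obtain r where r: "\<And>i. i \<in> right_class ` U \<Longrightarrow> r i \<in> U"
    "\<And>i. i \<in> right_class ` U \<Longrightarrow> r i \<cdot> e = r i"
    "\<And>i. i \<in> right_class ` U \<Longrightarrow> right_class (r i) = i"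
    by metis
  have dec: "\<exists>g\<in>subgrp e. a = r (right_class a) \<cdot> g" if a: "a \<in> U" "a \<cdot> e = a" for a
  proof -
    let ?r = "r (right_class a)"
    have i: "right_class a \<in> right_class ` U"
      using a(1) by blast
    have "a \<in> right_class ?r"
      using r(3)[OF i] right_class_self[OF a(1)] by simp
    then obtain s where s: "s \<in> U" "a = ?r \<cdot> s"
      by (auto simp: right_class_def)
    have "?r \<cdot> (e \<cdot> s \<cdot> e) = ?r \<cdot> e \<cdot> s \<cdot> e"
      using r(1)[OF i] e(1) s(1) by (simp add: assoc)
    also have "\<dots> = a"
      using r(2)[OF i] s(2) a(2) by simp
    finally have "a = ?r \<cdot> (e \<cdot> s \<cdot> e)" ..
    moreover have "e \<cdot> s \<cdot> e \<in> subgrp e"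
      using e s(1) by (simp add: subgrp_def assoc) (simp flip: assoc)
    ultimately show ?thesis
      by blast
  qed
  have inj: "inj_on (\<lambda>g. r i \<cdot> g) (subgrp e)" if i: "i \<in> right_class ` U" for i
  proof (rule inj_onI)
    fix g h assume gh: "g \<in> subgrp e" "h \<in> subgrp e" "r i \<cdot> g = r i \<cdot> h"
    obtain c where c: "c \<in> U" "c \<cdot> (r i \<cdot> e) = e"
      using left_simple[OF e(1) r(1)[OF i]] by blast
    have "c \<cdot> (r i \<cdot> x) = x" if "x \<in> subgrp e" for x
    proof -
      have "c \<cdot> (r i \<cdot> x) = c \<cdot> (r i \<cdot> e) \<cdot> x"
        using that c(1) r(1,2)[OF i] by (simp add: subgrp_def assoc)
      then show ?thesis
        using c(2) that by (simp add: subgrp_def)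
    qed
    then show "g = h"
      using gh by metis
  qed
  show thesis
    by (rule that[of r]) (rule r dec inj; assumption)+
qed

lemma left_section:
  assumes "idem e"
  obtains u where "\<And>i. i \<in> left_class ` U \<Longrightarrow> u i \<in> U"
    "\<And>i. i \<in> left_class ` U \<Longrightarrow> e \<cdot> u i = u i"
    "\<And>i. i \<in> left_class ` U \<Longrightarrow> left_class (u i) = i"
    "\<And>a. a \<in> U \<Longrightarrow> e \<cdot> a = a \<Longrightarrow> \<exists>g\<in>subgrp e. a = g \<cdot> u (left_class a)"
    "\<And>i. i \<in> left_class ` U \<Longrightarrow> inj_on (\<lambda>g. g \<cdot> u i) (subgrp e)"
proof -
  have "completely_simple.idem U (\<lambda>x y. y \<cdot> x) e"
    using assms by (simp add: completely_simple.idem_def[OF flip] idem_def)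
  then show thesis
    by (rule completely_simple.right_section[OF flip, unfolded left_class_flip subgrp_flip]) (rule that)
qed

end


section \<open>Maximal subgroups\<close>

context completely_simple
begin

abbreviation U1 :: "'a option monoid" where
  "U1 \<equiv> adjoin_identity U f"

abbreviation H :: "'a \<Rightarrow> 'a monoid" where
  "H e \<equiv> \<lparr>carrier = subgrp e, mult = f, one = e\<rparr>"

lemma U1_simps:
  "carrier U1 = insert None (Some ` U)" "\<one>\<^bsub>U1\<^esub> = None" "None \<otimes>\<^bsub>U1\<^esub> y = y" "x \<otimes>\<^bsub>U1\<^esub> None = x"
  "Some a \<otimes>\<^bsub>U1\<^esub> Some b = Some (a \<cdot> b)"
  by (auto simp: adjoin_identity_def split: option.splits)

lemma monoid_U1: "Group.monoid U1"
  by (rule monoidI) (auto simp: U1_simps assoc)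

sublocale U1: integral_monoid_ring U1
  by (rule integral_monoid_ring.intro[OF monoid_U1])

lemma integral_monoid_ring_H: "idem e \<Longrightarrow> integral_monoid_ring (H e)"
  using group_subgrp by (intro integral_monoid_ring.intro group.is_monoid)

lemma ring_corner_U1:
  assumes "idem e"
  shows "ring_corner (carrier U1.ZS) (mult U1.ZS) (one U1.ZS)
    (carrier (monoid_ring (H e))) (mult (monoid_ring (H e))) (one (monoid_ring (H e)))
    (push Some)"
  by (rule ring_corner_monoid_ring[OF U1.integral_monoid_ring_axioms integral_monoid_ring_H[OF assms]])
    (auto simp: U1_simps subgrp_def)

lemma \<iota>_one: "push Some \<one>\<^bsub>monoid_ring (H e)\<^esub> = frag_of (Some e)"
  by (simp add: monoid_ring_def)

text \<open>Right multiplication by \<open>e\<close> maps the support of \<open>a\<close> onto a set that contains the support of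
  the product, which here is that of \<open>a\<close>.\<close>

lemma keys_right_fixed:
  assumes "idem e" "a \<in> carrier U1.ZS" "a \<otimes>\<^bsub>U1.ZS\<^esub> frag_of (Some e) = a"
  shows "supp a \<subseteq> Some ` {x \<in> U. x \<cdot> e = x}"
proof
  fix s assume s: "s \<in> supp a"
  have "supp a \<subseteq> (\<lambda>s. s \<otimes>\<^bsub>U1\<^esub> Some e) ` supp a"
    using keys_frag_extend_of[of "\<lambda>s. s \<otimes>\<^bsub>U1\<^esub> Some e" a] assms(3)
    by (simp add: mult_frag_of comp_def)
  then obtain t where "t \<in> supp a" "s = t \<otimes>\<^bsub>U1\<^esub> Some e"
    using s by blast
  moreover have "supp a \<subseteq> insert None (Some ` U)"
    using assms(2) by (simp add: U1.ZS_simps U1_simps)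
  ultimately show "s \<in> Some ` {x \<in> U. x \<cdot> e = x}"
    using assms(1) by (auto simp: U1_simps idem_def assoc)
qed

lemma keys_left_fixed:
  assumes "idem e" "a \<in> carrier U1.ZS" "frag_of (Some e) \<otimes>\<^bsub>U1.ZS\<^esub> a = a"
  shows "supp a \<subseteq> Some ` {x \<in> U. e \<cdot> x = x}"
proof
  fix s assume s: "s \<in> supp a"
  have "supp a \<subseteq> (\<lambda>s. Some e \<otimes>\<^bsub>U1\<^esub> s) ` supp a"
    using keys_frag_extend_of[of "\<lambda>s. Some e \<otimes>\<^bsub>U1\<^esub> s" a] assms(3)
    by (simp add: frag_of_mult comp_def)
  then obtain t where "t \<in> supp a" "s = Some e \<otimes>\<^bsub>U1\<^esub> t"
    using s by blast
  moreover have "supp a \<subseteq> insert None (Some ` U)"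
    using assms(2) by (simp add: U1.ZS_simps U1_simps)
  ultimately show "s \<in> Some ` {x \<in> U. e \<cdot> x = x}"
    using assms(1) by (auto simp: U1_simps idem_def simp flip: assoc)
qed

text \<open>The product of \<open>e\<close> with the adjoined identity is \<open>e\<close>, so \<open>e \<int>S\<close> is the free abelian group on
  \<open>eU\<close>, which \<open>left_section\<close> decomposes into free orbits of the maximal subgroup.\<close>

lemma subgroup_FP_of_FP:
  assumes e: "idem e" and fin: "finite (left_class ` U)" and FP: "monoid_left_FP n U1"
  shows "monoid_left_FP n (H e)"
proof -
  interpret G: integral_monoid_ring "H e"
    by (rule integral_monoid_ring_H[OF e])
  let ?\<iota> = "push Some"
  interpret C: ring_corner "carrier U1.ZS" "mult U1.ZS" "one U1.ZS"
    "carrier G.ZS" "mult G.ZS" "one G.ZS" ?\<iota>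
    by (rule ring_corner_U1[OF e])
  obtain v where v: "\<And>i. i \<in> left_class ` U \<Longrightarrow> v i \<in> U"
    "\<And>i. i \<in> left_class ` U \<Longrightarrow> e \<cdot> v i = v i"
    "\<And>i. i \<in> left_class ` U \<Longrightarrow> left_class (v i) = i"
    "\<And>a. a \<in> U \<Longrightarrow> e \<cdot> a = a \<Longrightarrow> \<exists>g\<in>subgrp e. a = g \<cdot> v (left_class a)"
    "\<And>i. i \<in> left_class ` U \<Longrightarrow> inj_on (\<lambda>g. g \<cdot> v i) (subgrp e)"
    by (rule left_section[OF e]) (rule that)
  obtain h where h: "bij_betw h {0..<card (left_class ` U)} (left_class ` U)"
    using ex_bij_betw_nat_finite[OF fin] by (elim exE)
  define \<Lambda> where "\<Lambda> = {0..<card (left_class ` U)}"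
  have h_inj: "inj_on h \<Lambda>" and h_img: "h ` \<Lambda> = left_class ` U"
    using h by (simp_all add: bij_betw_def \<Lambda>_def)
  have h_mem: "h l \<in> left_class ` U" if "l \<in> \<Lambda>" for l
    using that unfolding h_img[symmetric] by (rule imageI)
  define k where "k l g = Some (g \<cdot> v (h l))" for l g
  have k_sum: "(\<Sum>l\<in>\<Lambda>. ?\<iota> (t l) \<otimes>\<^bsub>U1.ZS\<^esub> frag_of (Some (v (h l)))) =
      (\<Sum>l\<in>\<Lambda>. push (k l) (t l))" for t
    by (intro sum.cong refl) (simp add: mult_frag_of frag_extend_compose comp_def k_def U1_simps
        frag_extend_compose[of _ Some, unfolded comp_def])
  interpret C: left_free_corner "carrier U1.ZS" "mult U1.ZS" "one U1.ZS"
    "carrier G.ZS" "mult G.ZS" "one G.ZS" ?\<iota>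
    \<Lambda> "\<lambda>l. frag_of (Some (v (h l)))"
  proof unfold_locales
    show "finite \<Lambda>"
      by (simp add: \<Lambda>_def)
    show "frag_of (Some (v (h l))) \<in> carrier U1.ZS" if "l \<in> \<Lambda>" for l
      using v(1)[OF h_mem[OF that]] by (simp add: U1.ZS_simps U1_simps)
    show "?\<iota> \<one>\<^bsub>G.ZS\<^esub> \<otimes>\<^bsub>U1.ZS\<^esub> frag_of (Some (v (h l))) = frag_of (Some (v (h l)))"
      if "l \<in> \<Lambda>" for l
      unfolding \<iota>_one using v(2)[OF h_mem[OF that]] by (simp add: monoid_ring_mult_single U1_simps)
  next
    fix a assume a: "a \<in> carrier U1.ZS"
      "?\<iota> \<one>\<^bsub>G.ZS\<^esub> \<otimes>\<^bsub>U1.ZS\<^esub> a = a"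
    have "supp a \<subseteq> (\<Union>l\<in>\<Lambda>. k l ` subgrp e)"
    proof
      fix s assume "s \<in> supp a"
      then obtain x where x: "x \<in> U" "e \<cdot> x = x" "s = Some x"
        using keys_left_fixed[OF e a(1) a(2)[unfolded \<iota>_one]] by blast
      obtain g where g: "g \<in> subgrp e" "x = g \<cdot> v (left_class x)"
        using v(4)[OF x(1,2)] by blast
      obtain l where l: "l \<in> \<Lambda>" "h l = left_class x"
        using h_img x(1) by (metis imageE image_eqI)
      have "s = k l g"
        using g(2) x(3) l(2) by (simp add: k_def)
      then show "s \<in> (\<Union>l\<in>\<Lambda>. k l ` subgrp e)"
        using l(1) g(1) by blast
    qed
    from frag_decomposition[OF _ this]
    show "\<exists>t. (\<forall>l\<in>\<Lambda>. t l \<in> carrier G.ZS) \<and>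
        a = (\<Sum>l\<in>\<Lambda>. ?\<iota> (t l) \<otimes>\<^bsub>U1.ZS\<^esub> frag_of (Some (v (h l))))"
      unfolding k_sum by (simp add: G.ZS_simps \<Lambda>_def)
  next
    fix t l assume t: "\<And>l. l \<in> \<Lambda> \<Longrightarrow> t l \<in> carrier G.ZS" and l: "l \<in> \<Lambda>"
      and s: "(\<Sum>l\<in>\<Lambda>. ?\<iota> (t l) \<otimes>\<^bsub>U1.ZS\<^esub> frag_of (Some (v (h l)))) = 0"
    have lc: "left_class (g \<cdot> v (h i)) = h i" if "i \<in> \<Lambda>" "g \<in> subgrp e" for i g
      using left_class_mult v(1,3)[OF h_mem[OF that(1)]] that(2) by (simp add: subgrp_def)
    show "t l = 0"
    proof (rule frag_decomposition_unique[where k = k and G = "\<lambda>_. subgrp e" and t = t and I = \<Lambda>])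
      show "inj_on (k i) (subgrp e)" if "i \<in> \<Lambda>" for i
        using v(5)[OF h_mem[OF that]] by (simp add: inj_on_def k_def)
      show "k i ` subgrp e \<inter> k j ` subgrp e = {}" if "i \<in> \<Lambda>" "j \<in> \<Lambda>" "i \<noteq> j" for i j
      proof (rule ccontr)
        assume "k i ` subgrp e \<inter> k j ` subgrp e \<noteq> {}"
        then obtain g g' where "g \<in> subgrp e" "g' \<in> subgrp e" "k i g = k j g'"
          by blast
        then have "h i = h j"
          using lc[OF that(1), of g] lc[OF that(2), of g'] by (simp add: k_def)
        then show False
          using inj_onD[OF h_inj _ that(1,2)] that(3) by blast
      qed
      show "(\<Sum>i\<in>\<Lambda>. push (k i) (t i)) = 0"
        using s unfolding k_sum .
    qed (use t l in \<open>simp_all add: \<Lambda>_def G.ZS_simps\<close>)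
  qed
  have "C.restricts id UNIV G.triv UNIV U1.triv"
    by (simp add: C.restricts_def augmentation_frag_extend) (simp add: G.ZS_simps)
  then show ?thesis
    using FP C.type_FP_restrict[OF U1.lmod_triv G.lmod_triv]
    unfolding U1.monoid_left_FP_iff_type_FP G.monoid_left_FP_iff_type_FP by blast
qed

text \<open>The augmented ring is \<open>\<int>S = \<int>1 + \<int>U\<close>: the scalars \<open>N\<close> are the multiples of the adjoined
  identity, and \<open>Q\<close> is \<open>\<int>U\<close>.\<close>

lemma FP_of_subgroup_FP:
  assumes e: "idem e" and fin: "finite (left_class ` U)" "finite (right_class ` U)"
    and FP: "monoid_left_FP n (H e)"
  shows "monoid_left_FP n U1"
proof -
  interpret G: integral_monoid_ring "H e"
    by (rule integral_monoid_ring_H[OF e])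
  let ?\<iota> = "push Some"
  interpret C: ring_corner "carrier U1.ZS" "mult U1.ZS" "one U1.ZS"
    "carrier G.ZS" "mult G.ZS" "one G.ZS" ?\<iota>
    by (rule ring_corner_U1[OF e])
  obtain v where v: "\<And>i. i \<in> right_class ` U \<Longrightarrow> v i \<in> U"
    "\<And>i. i \<in> right_class ` U \<Longrightarrow> v i \<cdot> e = v i"
    "\<And>i. i \<in> right_class ` U \<Longrightarrow> right_class (v i) = i"
    "\<And>a. a \<in> U \<Longrightarrow> a \<cdot> e = a \<Longrightarrow> \<exists>g\<in>subgrp e. a = v (right_class a) \<cdot> g"
    "\<And>i. i \<in> right_class ` U \<Longrightarrow> inj_on (\<lambda>g. v i \<cdot> g) (subgrp e)"
    by (rule right_section[OF e]) (rule that)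
  define I where "I = right_class ` U"
  define k where "k i g = Some (v i \<cdot> g)" for i g
  have k_mult: "frag_of (Some (v i)) \<otimes>\<^bsub>U1.ZS\<^esub> ?\<iota> t = push (k i) t" for i t
    by (simp add: frag_of_mult comp_def k_def U1_simps
        frag_extend_compose[of _ Some, unfolded comp_def])
  have rc: "right_class (v i \<cdot> g) = i" if "i \<in> I" "g \<in> subgrp e" for i g
    using right_class_mult v(1,3)[of i] that by (simp add: subgrp_def I_def)
  interpret C: right_free_corner "carrier U1.ZS" "mult U1.ZS" "one U1.ZS"
    "carrier G.ZS" "mult G.ZS" "one G.ZS" ?\<iota>
    I "\<lambda>i. frag_of (Some (v i))"
  proof unfold_locales
    show "finite I"
      using fin(2) by (simp add: I_def)
    show "frag_of (Some (v i)) \<in> carrier U1.ZS" if "i \<in> I" for i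
      using v(1) that by (simp add: U1.ZS_simps U1_simps I_def)
    show "frag_of (Some (v i)) \<otimes>\<^bsub>U1.ZS\<^esub> ?\<iota> \<one>\<^bsub>G.ZS\<^esub> = frag_of (Some (v i))"
      if "i \<in> I" for i
      unfolding \<iota>_one using v(2) that by (simp add: monoid_ring_mult_single U1_simps I_def)
  next
    fix a assume a: "a \<in> carrier U1.ZS"
      "a \<otimes>\<^bsub>U1.ZS\<^esub> ?\<iota> \<one>\<^bsub>G.ZS\<^esub> = a"
    have "supp a \<subseteq> (\<Union>i\<in>I. k i ` subgrp e)"
    proof
      fix s assume "s \<in> supp a"
      then obtain x where x: "x \<in> U" "x \<cdot> e = x" "s = Some x"
        using keys_right_fixed[OF e a(1) a(2)[unfolded \<iota>_one]] by blast
      obtain g where g: "g \<in> subgrp e" "x = v (right_class x) \<cdot> g"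
        using v(4)[OF x(1,2)] by blast
      have "s = k (right_class x) g"
        using g(2) x(3) by (simp add: k_def)
      then show "s \<in> (\<Union>i\<in>I. k i ` subgrp e)"
        using x(1) g(1) unfolding I_def by blast
    qed
    from frag_decomposition[OF _ this]
    show "\<exists>t. (\<forall>i\<in>I. t i \<in> carrier G.ZS) \<and>
        a = (\<Sum>i\<in>I. frag_of (Some (v i)) \<otimes>\<^bsub>U1.ZS\<^esub> ?\<iota> (t i))"
      unfolding k_mult using fin(2) by (simp add: G.ZS_simps I_def)
  next
    fix t i assume t: "\<And>i. i \<in> I \<Longrightarrow> t i \<in> carrier G.ZS" and i: "i \<in> I"
      and s: "(\<Sum>i\<in>I. frag_of (Some (v i)) \<otimes>\<^bsub>U1.ZS\<^esub> ?\<iota> (t i)) = 0"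
    show "t i = 0"
    proof (rule frag_decomposition_unique[where k = k and G = "\<lambda>_. subgrp e" and t = t and I = I])
      show "inj_on (k i) (subgrp e)" if "i \<in> I" for i
        using v(5)[of i] that by (simp add: inj_on_def k_def I_def)
      show "k i ` subgrp e \<inter> k j ` subgrp e = {}" if "i \<in> I" "j \<in> I" "i \<noteq> j" for i j
      proof (rule ccontr)
        assume "k i ` subgrp e \<inter> k j ` subgrp e \<noteq> {}"
        then obtain g g' where "g \<in> subgrp e" "g' \<in> subgrp e" "k i g = k j g'"
          by blast
        then show False
          using rc[OF that(1), of g] rc[OF that(2), of g'] that(3) by (simp add: k_def)
      qed
      show "(\<Sum>i\<in>I. push (k i) (t i)) = 0"
        using s unfolding k_mult .
    qed (use t i fin(2) in \<open>simp_all add: I_def G.ZS_simps\<close>)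
  qed
  \<comment> \<open>\<open>wt i\<close> adds up the coefficients over the right class \<open>i\<close>. The adjoined identity belongs to
    no class.\<close>
  define c where "c i s = (case s of None \<Rightarrow> 0 | Some x \<Rightarrow> if right_class x = i then frag_of s else 0)"
    for i and s :: "'a option"
  define wt where "wt i a = augmentation (frag_extend (c i) a)" for i a
  have wt_simps: "wt i 0 = 0" "wt i (a - b) = wt i a - wt i b" "wt i (a + b) = wt i a + wt i b" for i a b
    by (simp_all add: wt_def frag_extend_diff frag_extend_add augmentation_diff augmentation_add)
  define N where "N = {a :: 'a option \<Rightarrow>\<^sub>0 int. supp a \<subseteq> {None}}"
  define Q where "Q = {a :: 'a option \<Rightarrow>\<^sub>0 int. supp a \<subseteq> Some ` U}"
  \<comment> \<open>Each left class is of the form \<open>Up\<close> with \<open>p\<close> idempotent, so that \<open>\<int>U\<close> is the sum of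
    the modules \<open>\<int>Sp\<close>.\<close>
  have "\<exists>p. l \<in> left_class ` U \<longrightarrow> idem p \<and> left_class p = l" for l
    using idem_in_left_class by (metis imageE)
  then obtain p where p: "\<And>l. l \<in> left_class ` U \<Longrightarrow> idem (p l)"
    "\<And>l. l \<in> left_class ` U \<Longrightarrow> left_class (p l) = l"
    by metis
  have pU: "p l \<in> U" "p l \<cdot> p l = p l" if "l \<in> left_class ` U" for l
    using p(1)[OF that] by (simp_all add: idem_def)
  define G where "G l = Some ` {x \<in> U. left_class x = l}" for l
  have fixed_by_p: "x \<cdot> p l = x" if "l \<in> left_class ` U" "x \<in> U" "left_class x = l" for x l
  proof -
    have "x \<in> left_class (p l)"
      using left_class_self[OF that(2)] that(3) p(2)[OF that(1)] by simp
    then obtain s where "s \<in> U" "x = s \<cdot> p l"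
      by (auto simp: left_class_def)
    then show ?thesis
      using pU[OF that(1)] by (simp add: assoc)
  qed
  interpret C: augmented_corner "carrier U1.ZS" "mult U1.ZS" "one U1.ZS"
    "carrier G.ZS" "mult G.ZS" "one G.ZS" ?\<iota>
    I "\<lambda>i. frag_of (Some (v i))" augmentation augmentation wt N Q "left_class ` U"
    "\<lambda>l. frag_of (Some (p l))"
  proof unfold_locales
    fix i j t assume ij: "j \<in> I" "i \<in> I" and t: "t \<in> carrier G.ZS"
    have "wt j (frag_of (Some (v i)) \<otimes>\<^bsub>U1.ZS\<^esub> ?\<iota> t) = augmentation (frag_extend (c j \<circ> k i) t)"
      unfolding wt_def k_mult frag_extend_compose ..
    also have "frag_extend (c j \<circ> k i) t = frag_extend (\<lambda>g. if j = i then (frag_of \<circ> k i) g else 0) t"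
      by (rule frag_extend_eq) (use t rc[OF ij(2)] in \<open>auto simp: c_def k_def G.ZS_simps\<close>)
    also have "augmentation \<dots> = (if j = i then augmentation t else 0)"
      using augmentation_frag_extend[of "k i" t] by (auto simp: frag_extend_eq_0 comp_def)
    finally show "wt j (frag_of (Some (v i)) \<otimes>\<^bsub>U1.ZS\<^esub> ?\<iota> t) = (if j = i then augmentation t else 0)" .
  next
    fix a assume "a \<in> carrier U1.ZS"
    then have "supp a \<subseteq> {None} \<union> Some ` U"
      by (simp add: U1.ZS_simps U1_simps)
    then obtain \<nu> q where "supp \<nu> \<subseteq> {None}" "supp q \<subseteq> Some ` U" "\<nu> + q = a"
      by (rule frag_split)
    then show "\<exists>\<nu>\<in>N. \<exists>q\<in>Q. a = \<nu> + q"
      by (auto simp: N_def Q_def)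
  next
    fix z show "\<exists>\<nu>\<in>N. augmentation \<nu> = z"
      by (intro bexI[of _ "Poly_Mapping.single None z"]) (auto simp: N_def)
  next
    fix \<nu> assume \<nu>: "\<nu> \<in> N" "augmentation \<nu> = 0"
    then have "Poly_Mapping.lookup \<nu> None = 0"
      by (simp add: N_def augmentation_superset[of "{None}"])
    then have "None \<notin> supp \<nu>"
      by (simp add: in_keys_iff)
    then show "\<nu> = 0"
      using \<nu>(1) by (auto simp: N_def simp flip: keys_eq_empty)
  next
    fix \<nu> a i assume "\<nu> \<in> N"
    then have "supp \<nu> \<subseteq> {None}"
      by (simp add: N_def)
    then show "wt i (\<nu> \<otimes>\<^bsub>U1.ZS\<^esub> a) = augmentation \<nu> * wt i a"
    proof (induction \<nu> rule: frag_induction)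
      case (one s)
      then show ?case
        by (simp add: frag_of_mult U1_simps flip: frag_expansion)
    qed (simp_all add: wt_simps monoid_ring_diff_mult augmentation_diff left_diff_distrib)
  next
    fix q i assume "q \<in> Q"
    then have q: "supp q \<subseteq> Some ` U"
      by (simp add: Q_def)
    have "\<exists>w. \<forall>a\<in>carrier U1.ZS. wt i (q \<otimes>\<^bsub>U1.ZS\<^esub> a) = w * augmentation a"
      using q
    proof (induction q rule: frag_induction)
      case zero
      show ?case
        by (intro exI[of _ 0]) (simp add: wt_simps)
    next
      case (one s)
      then obtain x where x: "x \<in> U" "s = Some x"
        by blast
      \<comment> \<open>Every product \<open>x \<cdot> t\<close> lies in the right class of \<open>x\<close>, whatever \<open>t\<close> is.\<close>
      have "wt i (frag_of s \<otimes>\<^bsub>U1.ZS\<^esub> a) = (if right_class x = i then 1 else 0) * augmentation a"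
        if "a \<in> carrier U1.ZS" for a
      proof -
        have "supp a \<subseteq> insert None (Some ` U)"
          using that by (simp add: U1.ZS_simps U1_simps)
        then show ?thesis
        proof (induction a rule: frag_induction)
          case (one t)
          then have "\<exists>y. Some x \<otimes>\<^bsub>U1\<^esub> t = Some y \<and> right_class y = right_class x"
            using right_class_mult[OF x(1)] by (elim insertE imageE) (simp_all add: U1_simps)
          then obtain y where "Some x \<otimes>\<^bsub>U1\<^esub> t = Some y" "right_class y = right_class x"
            by blast
          then show ?case
            by (simp add: x(2) monoid_ring_mult_single wt_def c_def)
        qed (simp_all add: wt_simps monoid_ring_mult_diff augmentation_diff right_diff_distrib)
      qed
      then show ?case
        by blast
    next
      case (diff a b)
      then obtain w w' where
        "\<forall>x\<in>carrier U1.ZS. wt i (a \<otimes>\<^bsub>U1.ZS\<^esub> x) = w * augmentation x"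
        "\<forall>x\<in>carrier U1.ZS. wt i (b \<otimes>\<^bsub>U1.ZS\<^esub> x) = w' * augmentation x"
        by blast
      then show ?case
        by (intro exI[of _ "w - w'"]) (simp add: wt_simps monoid_ring_diff_mult left_diff_distrib)
    qed
    then show "\<exists>w. \<forall>a\<in>carrier U1.ZS.
        a \<otimes>\<^bsub>U1.ZS\<^esub> ?\<iota> \<one>\<^bsub>G.ZS\<^esub> = a \<longrightarrow>
        wt i (q \<otimes>\<^bsub>U1.ZS\<^esub> a) = w * augmentation a"
      by blast
  next
    fix q assume "q \<in> Q"
    then have "supp q \<subseteq> Some ` U"
      by (simp add: Q_def)
    also have "\<dots> \<subseteq> (\<Union>l\<in>left_class ` U. (\<lambda>s. s) ` G l)"
      by (auto simp: G_def)
    finally have "supp q \<subseteq> (\<Union>l\<in>left_class ` U. (\<lambda>s. s) ` G l)" .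
    from frag_decomposition[OF fin(1) this]
    obtain t where t: "\<forall>l\<in>left_class ` U. supp (t l) \<subseteq> G l"
      "q = (\<Sum>l\<in>left_class ` U. t l)"
      by (auto simp: comp_def simp flip: frag_expansion)
    have "t l \<otimes>\<^bsub>U1.ZS\<^esub> frag_of (Some (p l)) = t l" if l: "l \<in> left_class ` U" for l
    proof -
      have "t l \<otimes>\<^bsub>U1.ZS\<^esub> frag_of (Some (p l)) = frag_extend frag_of (t l)"
        unfolding mult_frag_of
      proof (rule frag_extend_eq)
        fix s assume "s \<in> supp (t l)"
        then have "s \<in> G l"
          using t(1) l by blast
        then obtain x where "x \<in> U" "left_class x = l" "s = Some x"
          by (auto simp: G_def)
        then show "frag_of (s \<otimes>\<^bsub>U1\<^esub> Some (p l)) = frag_of s"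
          using fixed_by_p[OF l] by (simp add: U1_simps)
      qed
      then show ?thesis
        by (simp flip: frag_expansion)
    qed
    moreover have "t l \<in> carrier U1.ZS" if l: "l \<in> left_class ` U" for l
    proof -
      have "supp (t l) \<subseteq> G l"
        using t(1) l by blast
      then show ?thesis
        by (auto simp: U1.ZS_simps U1_simps G_def)
    qed
    ultimately show "\<exists>c. (\<forall>l\<in>left_class ` U. c l \<in> carrier U1.ZS) \<and>
        q = (\<Sum>l\<in>left_class ` U. c l \<otimes>\<^bsub>U1.ZS\<^esub> frag_of (Some (p l)))"
      using t(2) by (intro exI[of _ t]) simp
  next
    fix t l assume t: "\<And>l. l \<in> left_class ` U \<Longrightarrow> t l \<in> carrier U1.ZS \<and>
        t l \<otimes>\<^bsub>U1.ZS\<^esub> frag_of (Some (p l)) = t l"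
      and s: "(\<Sum>l\<in>left_class ` U. t l) = 0" and l: "l \<in> left_class ` U"
    show "t l = 0"
    proof (rule frag_decomposition_unique[OF fin(1), where k = "\<lambda>_ s. s" and G = G and t = t])
      fix i assume i: "i \<in> left_class ` U"
      have "left_class x = i" if "x \<in> U" "x \<cdot> p i = x" for x
        using left_class_mult[OF that(1) pU(1)[OF i]] that(2) p(2)[OF i] by simp
      then have "Some ` {x \<in> U. x \<cdot> p i = x} \<subseteq> G i"
        by (auto simp: G_def)
      then show "supp (t i) \<subseteq> G i"
        using keys_right_fixed[OF p(1)[OF i], of "t i"] t[OF i] by (meson order_trans)
    qed (use s l in \<open>auto simp: G_def comp_def simp flip: frag_expansion\<close>)
  qed (use fin(1) pU in \<open>auto simp: wt_simps augmentation_add augmentation_mult augmentation_frag_extend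
      N_def Q_def U1.ZS_simps U1_simps G.ZS_simps monoid_ring_mult_single\<close>)
  show ?thesis
    using FP C.type_FP_trivial_induce
    unfolding U1.monoid_left_FP_iff_type_FP G.monoid_left_FP_iff_type_FP by blast
qed

end

text \<open>If \<open>U\<close> has an identity, left cancellation shows that it is the only idempotent, so \<open>U\<close> is
  its own maximal subgroup. Otherwise the monoid ring of \<open>U1\<close> is compared with its corner.\<close>

theorem semigroup_left_FP_iff_maximal_subgroup:
  assumes cs: "completely_simple_semigroup U f" and fg: "finitely_generated_semigroup U f"
    and e: "e \<in> idempotents U f"
  shows "semigroup_left_FP n U f \<longleftrightarrow> group_FP n (maximal_subgroup U f e)"
proof -
  interpret completely_simple U f
    by (rule completely_simple_semigroup_imp[OF cs])
  have idem: "idem e"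
    using e by (simp add: idempotents_def idem_def)
  have max: "maximal_subgroup U f e = H e"
    by (rule maximal_subgroup_eq[OF idem])
  show ?thesis
  proof (cases "\<exists>i. is_identity U f i")
    case True
    have "i = e" if i: "is_identity U f i" for i
    proof -
      obtain c where "c \<in> U" "f c (f e i) = i"
        using left_simple[of i e] i idem by (auto simp: is_identity_def idem_def)
      then have "f c e = i" "f c (f e e) = f (f c e) e"
        using i idem by (auto simp: is_identity_def idem_def assoc)
      then show ?thesis
        using i idem by (auto simp: is_identity_def idem_def)
    qed
    then have i: "is_identity U f e" "\<And>i. is_identity U f i \<longleftrightarrow> i = e"
      using True by auto
    have "subgrp e = U"
      using i(1) by (auto simp: is_identity_def subgrp_def)
    then show ?thesis
      by (simp add: semigroup_left_FP_def group_FP_def max i(2))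
  next
    case False
    then show ?thesis
      using subgroup_FP_of_FP[OF idem] FP_of_subgroup_FP[OF idem]
        finite_left_classes[OF fg] finite_right_classes[OF fg]
      by (auto simp: semigroup_left_FP_def group_FP_def max)
  qed
qed

lemma adjoin_identity_flip: "adjoin_identity U (\<lambda>x y. f y x) = opposite (adjoin_identity U f)"
  by (auto simp: adjoin_identity_def opposite_def fun_eq_iff split: option.splits)

lemma semigroup_right_FP_eq:
  assumes "completely_simple U f"
  shows "semigroup_right_FP n U f \<longleftrightarrow> semigroup_left_FP n U (\<lambda>x y. f y x)"
proof -
  interpret completely_simple U f by fact
  have id: "is_identity U (\<lambda>x y. f y x) e \<longleftrightarrow> is_identity U f e" for e
    by (auto simp: is_identity_def)
  have "monoid_right_FP n \<lparr>carrier = U, mult = f, one = e\<rparr> \<longleftrightarrow>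
      monoid_left_FP n \<lparr>carrier = U, mult = (\<lambda>x y. f y x), one = e\<rparr>" if "is_identity U f e" for e
  proof -
    have "Group.monoid \<lparr>carrier = U, mult = f, one = e\<rparr>"
      using that by (intro monoidI) (auto simp: is_identity_def assoc)
    then show ?thesis
      by (simp add: monoid_right_FP_eq opposite_def)
  qed
  then show ?thesis
    by (simp add: semigroup_right_FP_def semigroup_left_FP_def id adjoin_identity_flip[of U f]
        monoid_right_FP_eq[OF monoid_U1] cong: conj_cong)
qed

theorem corollary1:
  fixes n :: nat and U :: "'a set" and f :: "'a \<Rightarrow> 'a \<Rightarrow> 'a"
  assumes "completely_simple_semigroup U f"
    and "finitely_generated_semigroup U f"
  shows "(semigroup_left_FP n U f \<longleftrightarrow> semigroup_right_FP n U f) \<and>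
         (semigroup_right_FP n U f \<longleftrightarrow>
            (\<forall>e\<in>idempotents U f. group_FP n (maximal_subgroup U f e)))"
proof -
  interpret completely_simple U f
    by (rule completely_simple_semigroup_imp[OF assms(1)])
  interpret flip: completely_simple U "\<lambda>x y. f y x"
    by (rule flip)
  have left: "semigroup_left_FP n U f \<longleftrightarrow> group_FP n (maximal_subgroup U f e)"
    if "e \<in> idempotents U f" for e
    by (rule semigroup_left_FP_iff_maximal_subgroup[OF assms that])
  have right: "semigroup_right_FP n U f \<longleftrightarrow> group_FP n (maximal_subgroup U f e)"
    if e: "e \<in> idempotents U f" for e
  proof -
    have idem: "idem e" "flip.idem e"
      using e by (simp_all add: idempotents_def idem_def flip.idem_def)
    have grp: "Group.group (H e)" "Group.group (opposite (H e))"
      using group_subgrp[OF idem(1)] flip.group_subgrp[OF idem(2)]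
      by (simp_all add: opposite_def subgrp_flip)
    have "opposite (opposite (H e)) = H e"
      by (simp add: opposite_def)
    then have "monoid_left_FP n (opposite (H e)) \<longleftrightarrow> monoid_left_FP n (H e)"
      using group_left_FP_opposite[OF grp(1)] group_left_FP_opposite[OF grp(2)] by metis
    moreover have "maximal_subgroup U (\<lambda>x y. f y x) e = opposite (H e)"
      using flip.maximal_subgroup_eq[OF idem(2)] by (simp add: opposite_def subgrp_flip)
    moreover have "e \<in> idempotents U (\<lambda>x y. f y x)"
      using e by (simp add: idempotents_def)
    ultimately show ?thesis
      using semigroup_left_FP_iff_maximal_subgroup[OF completely_simple_semigroup_flip[OF assms(1)]
          finitely_generated_semigroup_flip[OF assms(2)], of e n]
      by (simp add: semigroup_right_FP_eq[OF completely_simple_axioms] group_FP_def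
          maximal_subgroup_eq[OF idem(1)])
  qed
  have "U \<noteq> {}"
    using assms(1)
    by (auto simp: completely_simple_semigroup_def minimal_left_ideal_def left_ideal_def)
  then obtain a where "a \<in> U"
    by blast
  then obtain e where "idem e"
    by (rule idem_in_left_class)
  then have "e \<in> idempotents U f"
    by (simp add: idempotents_def idem_def)
  with left right show ?thesis
    by metis
qed

end
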